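(* (1) For every even $k$ and $n\ge0$, the function $F_{n,k}$ (if $k\le0$), resp. $G_{n,k}$ (if $k\ge2$), belongs to $V_k^{n+1}(0)$. (2) For even $k\le0$ and $n\ge0$, $F_{n,k}\in V_k^{n+1}(0)\setminus V_k^n(0)$. For even $k\ge4$ and $n\ge0$, $G_{n,k}\in V_k^{n+1}(0)\setminus V_k^n(0)$. For $k=2$ and $n\ge1$, $G_{n,2}\in V_2^n(0)\setminus V_2^{n-1}(0)$.
   Context: Write $z=x+iy\in\mathbb H$. For $k\in2\mathbb Z$, $\Delta_k=y^2(\partial_x^2+\partial_y^2)-iky(\partial_x+i\partial_y)$. A weight-$k$ modular form here means a smooth $f:\mathbb H\to\mathbb C$ with $f(\frac{az+b}{cz+d})=(cz+d)^kf(z)$ for all $\begin{pmatrix}a&b\\c&d\end{pmatrix}\in SL_2(\mathbb Z)$; moderate growth means $f(x+iy)=O(y^\alpha)$ as $y\to\infty$ uniformly in $x$, for some $\alpha$. For an integer $m\ge0$, $V_k^m(0)$ is the space of weight-$k$ modular forms of moderate growth with $\Delta_k^mf=0$ ($V_k^0(0)=\{0\}$). Eisenstein series: $E_k(z,s)=\frac12\sum_{(m,n)\ne(0,0)}\frac{y^s}{(mz+n)^k|mz+n|^{2s}}$ (meromorphically continued in $s$), $\widehat E_k=\pi^{-(s+k/2)}\Gamma(s+\frac k2+\frac{|k|}2)E_k$, $\widehat{\widehat E}_k=(s+\frac k2)(s+\frac k2-1)\widehat E_k$ (entire in $s$), with Taylor coefficients at $s=0$: $\widehat{\widehat E}_k(z,s)=\sum_nF_{n,k}(z)s^n$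 for $k\le0$ and $=\sum_nG_{n,k}(z)s^n$ for $k\ge2$. *)

theory Defs
  imports "HOL-Analysis.Analysis"
begin

definition UHP :: "complex set" where
  "UHP = {z. Im z > 0}"

definition Dx :: "(complex \<Rightarrow> complex) \<Rightarrow> complex \<Rightarrow> complex" where
  "Dx f z = frechet_derivative f (at z) 1"

definition Dy :: "(complex \<Rightarrow> complex) \<Rightarrow> complex \<Rightarrow> complex" where
  "Dy f z = frechet_derivative f (at z) \<i>"

text \<open>Smoothness (C-infinity in the real sense) on an open set S:
  f is (real-)differentiable at every point of S, and so are all iterated partial derivatives.\<close>
coinductive smooth_on :: "complex set \<Rightarrow> (complex \<Rightarrow> complex) \<Rightarrow> bool" for S where
  "(\<forall>z\<in>S. f differentiable (at z)) \<Longrightarrow> smooth_on S (Dx f) \<Longrightarrow> smooth_on S (Dy f)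
     \<Longrightarrow> smooth_on S f"

definition Delta :: "int \<Rightarrow> (complex \<Rightarrow> complex) \<Rightarrow> complex \<Rightarrow> complex" where
  "Delta k f z = complex_of_real ((Im z)\<^sup>2) * (Dx (Dx f) z + Dy (Dy f) z)
     - \<i> * of_int k * complex_of_real (Im z) * (Dx f z + \<i> * Dy f z)"

definition modular_of_weight :: "int \<Rightarrow> (complex \<Rightarrow> complex) \<Rightarrow> bool" where
  "modular_of_weight k f \<longleftrightarrow> smooth_on UHP f \<and>
     (\<forall>a b c d :: int. a * d - b * c = 1 \<longrightarrow>
        (\<forall>z\<in>UHP. f ((of_int a * z + of_int b) / (of_int c * z + of_int d))
                   = (of_int c * z + of_int d) powi k * f z))"

definition moderate_growth :: "(complex \<Rightarrow> complex) \<Rightarrow> bool" where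
  "moderate_growth f \<longleftrightarrow> (\<exists>\<alpha> C Y. \<forall>x y. y > 0 \<and> y \<ge> Y \<longrightarrow>
       cmod (f (Complex x y)) \<le> C * y powr \<alpha>)"

text \<open>V_k^m(0).  Functions are compared on the upper half plane only: membership depends only
  on the restriction to UHP; V_k^0(0) consists of the functions vanishing on UHP.\<close>
definition V :: "int \<Rightarrow> nat \<Rightarrow> (complex \<Rightarrow> complex) set" where
  "V k m = {f. modular_of_weight k f \<and> moderate_growth f \<and>
               (\<forall>z\<in>UHP. ((Delta k ^^ m) f) z = 0)}"

text \<open>Eisenstein series E_k(z,s) in its region of absolute convergence Re s > 1 - k/2.\<close>
definition EisE :: "int \<Rightarrow> complex \<Rightarrow> complex \<Rightarrow> complex" where
  "EisE k z s = (1/2) * infsum (\<lambda>(m,n). complex_of_real (Im z) powr s /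
        ((of_int m * z + of_int n) powi k *
         complex_of_real (cmod (of_int m * z + of_int n)) powr (2 * s)))
      (UNIV - {(0::int, 0::int)})"

text \<open>The doubly completed series: \<^emph>\<open>the\<close> entire function of s which agrees with
  (s+k/2)(s+k/2-1) pi^-(s+k/2) Gamma(s+k/2+|k|/2) E_k(z,s) where the series converges
  (its meromorphic continuation is entire; uniqueness by the identity theorem).\<close>
definition EisEhh :: "int \<Rightarrow> complex \<Rightarrow> complex \<Rightarrow> complex" where
  "EisEhh k z = (THE g. g holomorphic_on UNIV \<and>
      (\<forall>s. Re s > 1 - real_of_int k / 2 \<longrightarrow>
         g s = (s + of_int k / 2) * (s + of_int k / 2 - 1) *
               complex_of_real pi powr (- (s + of_int k / 2)) *
               Gamma (s + of_int k / 2 + of_int \<bar>k\<bar> / 2) * EisE k z s))"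

text \<open>Taylor coefficients at s = 0: F_{n,k} (k \<le> 0) and G_{n,k} (k \<ge> 2).\<close>
definition EisCoeff :: "nat \<Rightarrow> int \<Rightarrow> complex \<Rightarrow> complex" where
  "EisCoeff n k z = (deriv ^^ n) (EisEhh k z) 0 / fact n"

definition F :: "nat \<Rightarrow> int \<Rightarrow> complex \<Rightarrow> complex" where
  "F n k = EisCoeff n k"

definition G :: "nat \<Rightarrow> int \<Rightarrow> complex \<Rightarrow> complex" where
  "G n k = EisCoeff n k"

end

theory Submission
  imports Defs "HOL-Complex_Analysis.Complex_Analysis" "HOL-Probability.Characteristic_Functions"
begin

text \<open>
  Write k = 2j and w = s + j. On the upper half plane the series E_k(z, s) is half of
  the lattice sum of y^(-j) U^j Q^(-w), where N = mz + n, U = cnj N / N and Q = |N|^2 / y.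
  Raising (R = 2i d/dz + 2j/y) and lowering (L = -2i y^2 d/d(cnj z)) multiply it by w + j
  and w - j and shift j by 1, and Delta_k = R L; after the completion by Gamma factors the
  weight k series is therefore obtained from weight 0 by applying R or L alone.
  In weight 0, Riemann's argument (theta inversion, Mellin transform) writes the doubly
  completed series as w(w-1)/2 times a sum of incomplete Gamma functions, plus 1/2. It is
  entire in w, smooth in z and of polynomial growth, uniformly for bounded w, and these
  properties survive R, L and d/dw. Modularity and Delta_k f = s(s+k-1) f hold where the
  series converges, hence everywhere. So Delta_k^m of the n-th Taylor coefficient is the
  n-th coefficient of (s(s+k-1))^m f: it vanishes for m > n, and for m = n it is
  (k-1)^n f(z, 0). The symmetry w -> 1 - w moves s = 0 into the region of convergence,
  where the terms with m = 0 dominate for large y, unless k = 0 (where the value is 1/2) or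
  k = 2. For k = 2 the value at s = 0 vanishes, but L sends the first coefficient to 1/2.
\<close>

section \<open>Poisson summation for Gaussians\<close>

text \<open>The obstacle is that the functions in question are values at s = 0 of a continuation,
  while everything known about them (modularity, Laplace equation, effect of raising) is visible
  only where the lattice sum converges. Each identity has to be carried across by the identity
  theorem in w, also after differentiation in z. This forces a notion of family that is entire in w,
  smooth in z, bounded jointly, and closed under both kinds of derivative. A direct Mellin argument
  in weight k would need theta series with harmonic coefficients. The ladder avoids them because the
  completion is adapted to it: a step away from weight 0 multiplies the lattice sum by w + |j|,
  exactly the step from Gamma(w + |j|) to Gamma(w + |j| + 1). Nothing is divided by, so no poles can
  arise, and since the operators do not involve w, the symmetry passes to all weights without a
  sign. Theta inversion uses one-dimensional Poisson summation only, which in turn rests on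
  pointwise convergence of the Fourier series of an entire periodic function.\<close>

text \<open>One integration by parts: equal end values remove the boundary term and leave 1/k times
  a bounded integral. Holomorphy is asked for on some open \<open>S\<close> around the segment,
  since the quotient treated below lives on a strip.\<close>

lemma riemann_lebesgue_periodic:
  fixes h :: "complex \<Rightarrow> complex"
  assumes hol: "h holomorphic_on S" and S: "open S" and sub: "\<And>x::real. \<bar>x\<bar> \<le> 1/2 \<Longrightarrow> of_real x \<in> S"
    and per: "h (1/2) = h (-1/2)"
  shows "\<exists>M. \<forall>k::int. k \<noteq> 0 \<longrightarrow> 
     norm (integral {-1/2..1/2} (\<lambda>x. h (of_real x) * exp (- (2 * pi * \<i> * k * x)))) \<le> M / \<bar>real_of_int k\<bar>"
proof -
  have ch: "continuous_on {-1/2..1/2} (\<lambda>x. h (of_real x))"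
    by (intro continuous_on_compose2[OF holomorphic_on_imp_continuous_on[OF hol]] continuous_intros)
       (use sub in auto)
  have cd: "continuous_on {-1/2..1/2} (\<lambda>x. deriv h (of_real x))"
    by (intro continuous_on_compose2[OF holomorphic_on_imp_continuous_on[OF holomorphic_deriv[OF hol S]]] continuous_intros)
       (use sub in auto)
  have "bounded ((\<lambda>x::real. deriv h (of_real x)) ` {-1/2..1/2})"
    by (intro compact_imp_bounded compact_continuous_image cd) auto
  then obtain M where M: "\<And>x::real. x \<in> {-1/2..1/2} \<Longrightarrow> norm (deriv h (of_real x)) \<le> M"
    unfolding bounded_iff by (metis image_eqI)
  have "norm (integral {-1/2..1/2} (\<lambda>x. h (of_real x) * exp (- (2 * pi * \<i> * k * x)))) \<le> M / (2*pi) / \<bar>real_of_int k\<bar>"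
    if k: "k \<noteq> 0" for k :: int
  proof -
    define c where "c = - (2 * pi * \<i> * k)"
    have c0: "norm c = 2 * pi * \<bar>k\<bar>" by (simp add: c_def norm_mult)
    have dh: "(h has_field_derivative deriv h (of_real x)) (at (of_real x))" if "x \<in> {-1/2..1/2}" for x :: real
      by (rule holomorphic_derivI[OF hol S]) (use that sub in auto)
    have 1: "((\<lambda>x. deriv h (of_real x) * exp (c * of_real x) + c * (h (of_real x) * exp (c * of_real x))) has_integral
        (h (of_real (1/2)) * exp (c * of_real (1/2)) - h (of_real (-1/2)) * exp (c * of_real (-1/2)))) {-1/2..1/2}"
      by (intro fundamental_theorem_of_calculus has_vector_derivative_real_field)
         (auto intro!: derivative_eq_intros dh simp: algebra_simps)
    have "exp (c * of_real (1/2)) = exp (c * of_real (-1/2))"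
      unfolding exp_eq by (intro exI[of _ "-k"]) (simp add: c_def algebra_simps)
    with per have 2: "h (of_real (1/2)) * exp (c * of_real (1/2)) - h (of_real (-1/2)) * exp (c * of_real (-1/2)) = 0"
      by simp
    have i1: "(\<lambda>x. h (of_real x) * exp (c * of_real x)) integrable_on {-1/2..1/2}"
      by (intro integrable_continuous_real continuous_intros ch)
    have i2: "(\<lambda>x. deriv h (of_real x) * exp (c * of_real x)) integrable_on {-1/2..1/2}"
      by (intro integrable_continuous_real continuous_intros cd)
    have "integral {-1/2..1/2} (\<lambda>x. deriv h (of_real x) * exp (c * of_real x)) + 
       c * integral {-1/2..1/2} (\<lambda>x. h (of_real x) * exp (c * of_real x)) = 0"
      using integral_unique[OF 1] unfolding 2
      using i1 i2 by (subst (asm) integral_add) (auto intro!: integrable_on_mult_right)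
    hence "norm (c * integral {-1/2..1/2} (\<lambda>x. h (of_real x) * exp (c * of_real x))) = 
           norm (integral {-1/2..1/2} (\<lambda>x. deriv h (of_real x) * exp (c * of_real x)))"
      unfolding add_eq_0_iff by (simp only: norm_minus_cancel)
    also have "\<dots> \<le> M * (1/2 - (-1/2))"
    proof (rule integral_bound)
      show "continuous_on {-1/2..1/2} (\<lambda>x. deriv h (of_real x) * exp (c * of_real x))"
        by (intro continuous_intros cd)
      show "norm (deriv h (of_real x) * exp (c * of_real x)) \<le> M" if "x \<in> {-1/2..1/2}" for x
        using M[OF that] by (simp add: norm_mult c_def)
    qed auto
    finally have "2 * pi * \<bar>k\<bar> * norm (integral {-1/2..1/2} (\<lambda>x. h (of_real x) * exp (c * of_real x))) \<le> M"
      by (simp add: norm_mult c0)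
    with k show ?thesis by (simp add: field_simps c_def)
  qed
  thus ?thesis by blast
qed

text \<open>
  Chernoff's argument: dividing \<open>f - f 0\<close> by \<open>exp (2 \<pi> i z) - 1\<close> makes its Fourier coefficients telescope.
\<close>
lemma fourier_series_at_0:
  assumes hol: "f holomorphic_on UNIV" and per: "\<And>z. f (z + 1) = f z"
  shows "(\<lambda>N. \<Sum>k\<in>{-int N..int N}. integral {-1/2..1/2} (\<lambda>x. f (of_real x) * exp (- (2 * pi * \<i> * k * x))))
           \<longlonglongrightarrow> f 0"
proof -
  define e where "e = (\<lambda>z::complex. exp (2 * pi * \<i> * z))"
  \<comment> \<open>Wide enough for the segment, narrow enough that 0 is the only point with
    \<open>e z = 1\<close>.\<close>
  define S where "S = {z::complex. \<bar>Re z\<bar> < 1}"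
  \<comment> \<open>\<open>f - f 0\<close> and \<open>e - 1\<close> both vanish at 0, the latter to
    first order; dividing each by z first makes their quotient \<open>h\<close> holomorphic across
    0.\<close>
  define A where "A = (\<lambda>z. if z = 0 then deriv f 0 else (f z - f 0) / (z - 0))"
  define B where "B = (\<lambda>z. if z = 0 then deriv e 0 else (e z - e 0) / (z - 0))"
  define h where "h = (\<lambda>z. A z / B z)"
  have S: "open S"
    unfolding S_def by (intro open_Collect_less continuous_intros)
  have hA: "A holomorphic_on S" unfolding A_def
    by (rule pole_lemma_open) (use hol S in \<open>auto intro: holomorphic_on_subset\<close>)
  have hB: "B holomorphic_on S" unfolding B_def
    by (rule pole_lemma_open) (use S in \<open>auto intro!: holomorphic_intros simp: e_def\<close>)
  have "(e has_field_derivative 2 * pi * \<i>) (at 0)"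
    unfolding e_def by (auto intro!: derivative_eq_intros)
  hence de: "deriv e 0 = 2 * pi * \<i>" by (rule DERIV_imp_deriv)
  have e1: "e z \<noteq> 1" if "z \<in> S" "z \<noteq> 0" for z
  proof
    assume "e z = 1"
    then obtain n :: int where "Im (2 * pi * \<i> * z) = of_int (2 * n) * pi" "Re (2 * pi * \<i> * z) = 0"
      unfolding e_def exp_eq_1 by auto
    hence "Re z = of_int n" "Im z = 0" by (auto simp: algebra_simps)
    with that have "n = 0" by (simp add: S_def)
    with \<open>Re z = _\<close> \<open>Im z = 0\<close> that show False by (simp add: complex_eq_iff)
  qed
  have B0: "B z \<noteq> 0" if "z \<in> S" for z
    using e1[OF that] by (auto simp: B_def de) (auto simp: e_def)
  have hh: "h holomorphic_on S" unfolding h_def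
    by (intro holomorphic_intros hA hB B0)
  have fe: "f z - f 0 = h z * (e z - 1)" if "z \<in> S" for z
    using e1[OF that] by (auto simp: h_def A_def B_def) (auto simp: e_def)
  have sub: "of_real x \<in> S" if "\<bar>x\<bar> \<le> 1/2" for x :: real
    using that by (simp add: S_def)
  have perh: "h (1/2) = h (-1/2)"
  proof -
    have "f (1/2) = f (-1/2)" using per[of "-1/2"] by simp
    moreover have "e (1/2) = e (-1/2)"
      unfolding e_def exp_eq by (intro exI[of _ 1]) (simp add: algebra_simps)
    moreover have "e (1/2) - 1 \<noteq> 0" using e1[of "1/2"] by (simp add: S_def)
    moreover have "h (1/2) * (e (1/2) - 1) = f (1/2) - f 0" 
      by (rule fe[symmetric]) (simp add: S_def)
    moreover have "h (-1/2) * (e (-1/2) - 1) = f (-1/2) - f 0"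
      by (rule fe[symmetric]) (simp add: S_def)
    ultimately have "h (1/2) * (e (1/2) - 1) = h (-1/2) * (e (1/2) - 1)" by simp
    with \<open>e (1/2) - 1 \<noteq> 0\<close> show ?thesis by simp
  qed
  define a where "a = (\<lambda>k::int. integral {-1/2..1/2} (\<lambda>x. h (of_real x) * exp (- (2 * pi * \<i> * k * x))))"
  have "\<exists>M. \<forall>k. k \<noteq> 0 \<longrightarrow> norm (a k) \<le> M / \<bar>real_of_int k\<bar>"
    unfolding a_def by (rule riemann_lebesgue_periodic[OF hh S sub perh])
  then obtain M where M: "\<And>k. k \<noteq> 0 \<Longrightarrow> norm (a k) \<le> M / \<bar>real_of_int k\<bar>"
    by metis
  have ch: "continuous_on {-1/2..1/2} (\<lambda>x. h (of_real x))"
    by (intro continuous_on_compose2[OF holomorphic_on_imp_continuous_on[OF hh]] continuous_intros)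
       (use sub in auto)
  have i1: "(\<lambda>x. h (of_real x) * exp (- (2 * pi * \<i> * k * x))) integrable_on {-1/2..1/2}" for k :: int
    by (intro integrable_continuous_real continuous_intros ch)
  have E: "((\<lambda>x::real. exp (- (2 * pi * \<i> * k * x))) has_integral (if k = 0 then 1 else 0)) {-1/2..1/2}" for k :: int
  proof (cases "k = 0")
    case True
    have "((\<lambda>x::real. 1::complex) has_integral (1/2 - (-1/2)) *\<^sub>R 1) {-1/2..1/2}"
      using has_integral_const_real[of "1::complex" "-1/2" "1/2"] by simp
    thus ?thesis using True by simp
  next
    case False
    define c where "c = - (2 * pi * \<i> * k)"
    have [simp]: "c \<noteq> 0" using False by (simp add: c_def)
    have 1: "((\<lambda>x. exp (c * of_real x)) has_integral
        (exp (c * of_real (1/2)) / c - exp (c * of_real (-1/2)) / c)) {-1/2..1/2}"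
      by (intro fundamental_theorem_of_calculus has_vector_derivative_real_field)
         (auto intro!: derivative_eq_intros)
    have "exp (c * of_real (1/2)) = exp (c * of_real (-1/2))"
      unfolding exp_eq by (intro exI[of _ "-k"]) (simp add: c_def algebra_simps)
    with 1 False show ?thesis by (simp add: c_def)
  qed
  define w where "w = (\<lambda>k::int. \<lambda>x::real. h (of_real x) * exp (- (2 * pi * \<i> * k * x)))"
  have iw: "(w k has_integral a k) {-1/2..1/2}" for k
    unfolding w_def a_def by (rule integrable_integral[OF i1])
  have coeff: "integral {-1/2..1/2} (\<lambda>x. f (of_real x) * exp (- (2 * pi * \<i> * k * x))) = 
     a (k - 1) - a k + f 0 * (if k = 0 then 1 else 0)" for k
  proof (rule integral_unique, rule has_integral_eq[rotated])
    show "((\<lambda>x::real. w (k - 1) x - w k x + f 0 * exp (- (2 * pi * \<i> * k * x))) has_integral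
            (a (k - 1) - a k + f 0 * (if k = 0 then 1 else 0))) {-1/2..1/2}"
      by (intro has_integral_add has_integral_diff has_integral_mult_right iw E)
    fix x :: real assume x: "x \<in> {-1/2..1/2}"
    have "exp (- (2 * pi * \<i> * (k - 1) * x)) = exp (- (2 * pi * \<i> * k * x)) * e (of_real x)"
      unfolding e_def exp_add[symmetric] by (simp add: algebra_simps)
    hence w1: "w (k - 1) x = h (of_real x) * (exp (- (2 * pi * \<i> * k * x)) * e (of_real x))"
      unfolding w_def by simp
    have "f (of_real x) = f 0 + h (of_real x) * (e (of_real x) - 1)"
      using fe[OF sub[of x]] x by (auto simp: algebra_simps abs_le_iff)
    thus "w (k - 1) x - w k x + f 0 * exp (- (2 * pi * \<i> * k * x)) = f (of_real x) * exp (- (2 * pi * \<i> * k * x))"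
      unfolding w1 unfolding w_def by (simp only: ring_distribs) simp
  qed
  have tele: "(\<Sum>k\<in>{-int N..int N}. a (k - 1) - a k + f 0 * (if k = 0 then 1 else 0)) = 
     a (- int N - 1) - a (int N) + f 0" for N
  proof (induction N)
    case (Suc N)
    have "{-int (Suc N)..int (Suc N)} = insert (- int N - 1) (insert (int N + 1) {-int N..int N})" by auto
    with Suc show ?case by (simp add: sum.insert algebra_simps)
  qed auto
  have bd: "norm (a (- int N - 1)) \<le> M * inverse (real (Suc N))" for N
    using M[of "- int N - 1"] by (simp add: field_simps)
  have l1: "(\<lambda>N. a (- int N - 1)) \<longlonglongrightarrow> 0"
    by (rule Lim_null_comparison[OF _ tendsto_mult_right_zero[OF LIMSEQ_inverse_real_of_nat, of M]])
       (use bd in auto)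
  have bd: "norm (a (int (Suc N))) \<le> M * inverse (real (Suc N))" for N
    using M[of "int (Suc N)"] by (simp add: field_simps)
  have "(\<lambda>N. a (int (Suc N))) \<longlonglongrightarrow> 0"
    by (rule Lim_null_comparison[OF _ tendsto_mult_right_zero[OF LIMSEQ_inverse_real_of_nat, of M]])
       (use bd in auto)
  hence l2: "(\<lambda>N. a (int N)) \<longlonglongrightarrow> 0"
    by (rule LIMSEQ_imp_Suc)
  have "(\<lambda>N. a (- int N - 1) - a (int N) + f 0) \<longlonglongrightarrow> 0 - 0 + f 0"
    by (intro tendsto_intros l1 l2)
  thus ?thesis unfolding coeff tele by simp
qed

section \<open>Gaussian sums over the integers and Gaussian Fourier integrals\<close>

lemma summable_on_int_of_nat:
  fixes g :: "nat \<Rightarrow> real"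
  assumes "summable g" "\<And>n. g n \<ge> 0"
  shows "(\<lambda>n::int. g (nat \<bar>n\<bar>)) summable_on UNIV"
proof -
  have g: "g summable_on UNIV"
    using assms by (simp add: summable_on_UNIV_nonneg_real_iff)
  have 1: "(\<lambda>n::int. g (nat \<bar>n\<bar>)) summable_on (int ` UNIV)"
    by (subst summable_on_reindex) (auto simp: o_def g)
  have 2: "(\<lambda>n::int. g (nat \<bar>n\<bar>)) summable_on ((\<lambda>n. - int n) ` UNIV)"
    by (subst summable_on_reindex) (auto simp: o_def g inj_on_def)
  have "(\<lambda>n::int. g (nat \<bar>n\<bar>)) summable_on ((int ` UNIV) \<union> ((\<lambda>n. - int n) ` UNIV))"
    by (rule summable_on_union[OF 1 2])
  also have "(int ` UNIV) \<union> ((\<lambda>n. - int n) ` UNIV) = UNIV"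
  proof -
    have "n \<in> range int \<union> range (\<lambda>n. - int n)" for n
      by (cases n rule: int_cases2) auto
    thus ?thesis by auto
  qed
  finally show ?thesis .
qed

lemma summable_on_int_gaussian:
  assumes c: "c > 0"
  shows "(\<lambda>n::int. exp (- c * of_int n ^ 2) :: real) summable_on UNIV"
proof -
  have "summable (\<lambda>n. exp (-c) ^ n)" using c by (intro summable_geometric) auto
  hence "summable (\<lambda>n::nat. exp (- c * of_nat n ^ 2))"
  proof (rule summable_comparison_test_ev[rotated])
    have "real n \<le> real n ^ 2" for n
      by (cases n) (auto simp: power2_eq_square)
    thus "\<forall>\<^sub>F n in sequentially. norm (exp (- c * of_nat n ^ 2)) \<le> exp (-c) ^ n"
      using c by (auto simp: exp_of_nat_mult[symmetric] mult.commute)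
  qed
  from summable_on_int_of_nat[OF this] show ?thesis by simp
qed

text \<open>Passes from unordered sums to symmetric partial sums, the form in which the Fourier
  series converges.\<close>

lemma filterlim_symmetric_intervals:
  "filterlim (\<lambda>N. {-int N..int N}) (finite_subsets_at_top UNIV) sequentially"
  unfolding filterlim_iff
proof safe
  fix P assume "eventually P (finite_subsets_at_top (UNIV :: int set))"
  then obtain X where X: "finite X" "\<And>Y. finite Y \<Longrightarrow> X \<subseteq> Y \<Longrightarrow> P Y"
    unfolding eventually_finite_subsets_at_top by auto
  obtain B where B: "\<And>x. x \<in> X \<Longrightarrow> \<bar>x\<bar> \<le> B"
    using X(1) by (meson Max_ge finite_imageI imageI)
  show "\<forall>\<^sub>F N in sequentially. P {-int N..int N}"
    using eventually_ge_at_top[of "nat B"]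
  proof eventually_elim
    case (elim N)
    show ?case by (rule X(2)) (use B elim in fastforce)+
  qed
qed

text \<open>Up to an affine substitution this is the characteristic function of the standard normal
  distribution.\<close>

lemma gaussian_fourier_transform:
  fixes a y k :: real
  assumes a: "a > 0"
  shows "integrable lborel (\<lambda>x::real. exp (- (pi * a * (x + y)^2)) * exp (- (2 * pi * \<i> * k * x)))" 
    and "(LINT x::real|lborel. exp (- (pi * a * (x + y)^2)) * exp (- (2 * pi * \<i> * k * x))) =
      exp (2 * pi * \<i> * k * y) * exp (- (pi * k^2 / a)) / sqrt a"
proof -
  \<comment> \<open>Chosen so that \<open>(x / s)^2 / 2 = pi * a * x^2\<close>: the Gaussian is a
    normal density rescaled by \<open>s\<close>.\<close>
  define s where "s = 1 / sqrt (2 * pi * a)"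
  have s: "s > 0" using a by (simp add: s_def)
  have s2: "s^2 = 1 / (2 * pi * a)" using a by (simp add: s_def power_divide)
  define h where "h = (\<lambda>u. std_normal_density u *\<^sub>R iexp (- (2 * pi * k * s) * u))"
  have "integrable std_normal_distribution (\<lambda>u. iexp (- (2 * pi * k * s) * u))"
    by (intro prob_space.integrable_iexp real_distribution.axioms(1) real_dist_normal_dist) auto
  hence ih: "integrable lborel h" unfolding h_def
    by (subst (asm) integrable_density) auto
  have "char std_normal_distribution (- (2 * pi * k * s)) = (LINT u|lborel. h u)"
    unfolding char_def h_def by (subst integral_density) (auto intro!: Bochner_Integration.integral_cong)
  hence Ih: "(LINT u|lborel. h u) = exp (- (pi * k^2 / a))"
  proof -
    have "- ((- (2 * pi * k * s))^2) / 2 = - (pi * k^2 / a)"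
      using a unfolding power_mult_distrib s2 power2_minus by (simp add: field_simps power2_eq_square)
    with \<open>char _ _ = _\<close> show ?thesis
      by (simp only: char_std_normal_distribution)
  qed
  have eq: "exp (- (pi * a * (x + y)^2)) * exp (- (2 * pi * \<i> * k * x)) = 
      (sqrt (2 * pi) * exp (2 * pi * \<i> * k * y)) * h (y / s + (1 / s) * x)" for x
  proof -
    have 1: "y / s + (1 / s) * x = (x + y) / s" by (simp add: add_divide_distrib)
    have 2: "((x+y)/s)^2 / 2 = pi * a * (x+y)^2"
      using a by (simp add: power_divide s2 field_simps)
    have "2 * pi * \<i> * k * y + \<i> * (- (2 * pi * k * s) * ((x+y)/s)) = - (2 * pi * \<i> * k * x)"
      using s by (simp add: field_simps)
    hence 3: "exp (- (2 * pi * \<i> * k * x)) = exp (2 * pi * \<i> * k * y) * iexp (- (2 * pi * k * s) * ((x+y)/s))"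
      unfolding exp_add[symmetric] by (simp only: of_real_mult of_real_minus)
    have 4: "sqrt (2 * pi) * std_normal_density ((x+y)/s) = exp (- (pi * a * (x + y)^2))"
      unfolding std_normal_density_def 2[symmetric] by simp
    have "h (y / s + (1 / s) * x) = of_real (std_normal_density ((x+y)/s)) * iexp (- (2 * pi * k * s) * ((x+y)/s))"
      unfolding h_def 1 scaleR_conv_of_real by (rule refl)
    thus ?thesis
      unfolding 3 4[symmetric] by (simp only: of_real_mult mult_ac)
  qed
  have "integrable lborel (\<lambda>x. h (y / s + (1 / s) * x))"
    by (rule lborel_integrable_real_affine[OF ih]) (use s in auto)
  thus "integrable lborel (\<lambda>x::real. exp (- (pi * a * (x + y)^2)) * exp (- (2 * pi * \<i> * k * x)))"
    unfolding eq by (intro integrable_mult_right)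
  have "(LINT u|lborel. h u) = \<bar>1/s\<bar> *\<^sub>R (LINT x|lborel. h (y / s + (1 / s) * x))"
    by (rule lborel_integral_real_affine) (use s in auto)
  hence I: "(LINT x|lborel. h (y / s + (1 / s) * x)) = s * exp (- (pi * k^2 / a))"
    using s unfolding Ih by (simp add: scaleR_conv_of_real field_simps)
  have "sqrt (2*pi) * s = 1 / sqrt a"
    using a by (simp add: s_def real_sqrt_mult)
  hence II: "complex_of_real (sqrt (2*pi)) * complex_of_real s = 1 / complex_of_real (sqrt a)"
    by (metis of_real_mult of_real_1 of_real_divide)
  have "(LINT x::real|lborel. exp (- (pi * a * (x + y)^2)) * exp (- (2 * pi * \<i> * k * x))) =
      (sqrt (2 * pi) * exp (2 * pi * \<i> * k * y)) * (s * exp (- (pi * k^2 / a)))"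
    unfolding eq integral_mult_right_zero I ..
  also have "\<dots> = exp (2 * pi * \<i> * k * y) * exp (- (pi * k^2 / a)) * (complex_of_real (sqrt (2*pi)) * complex_of_real s)"
    by (simp only: mult_ac of_real_mult)
  finally show "(LINT x::real|lborel. exp (- (pi * a * (x + y)^2)) * exp (- (2 * pi * \<i> * k * x))) =
      exp (2 * pi * \<i> * k * y) * exp (- (pi * k^2 / a)) / sqrt a"
    unfolding II by simp
qed

text \<open>A majorant uniform on discs. By \<open>n^2 / 2 <= (n + x)^2 + x^2\<close> the real shift
  costs half of the quadratic decay, and the imaginary part only a constant factor.\<close>

lemma gaussian_series_bound:
  fixes z :: complex and n :: int
  assumes a: "a > 0" and z: "norm z \<le> R"
  shows "norm (exp (- (of_real (pi * a) * (of_int n + z)^2))) \<le> exp (2 * pi * a * R^2) * exp (- (pi * a / 2) * of_int n ^ 2)"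
proof -
  have "(of_int n)^2 / 2 \<le> (of_int n + Re z)^2 + (Re z)^2"
  proof -
    have "(of_int n + Re z)^2 + (Re z)^2 - (of_int n)^2 / 2 = (of_int n + 2 * Re z)^2 / 2"
      by (simp add: power2_eq_square field_simps)
    also have "\<dots> \<ge> 0" by simp
    finally show ?thesis by simp
  qed
  moreover have "(Re z)^2 \<le> R^2" "(Im z)^2 \<le> R^2"
    using abs_Re_le_cmod[of z] abs_Im_le_cmod[of z] z by (auto intro!: power2_le_iff_abs_le[THEN iffD2] simp: abs_le_square_iff[symmetric])
  ultimately have "- ((of_int n + Re z)^2 - (Im z)^2) \<le> 2 * R^2 - (of_int n)^2 / 2" by linarith
  hence "(pi * a) * (- ((of_int n + Re z)^2 - (Im z)^2)) \<le> (pi * a) * (2 * R^2 - (of_int n)^2 / 2)"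
    using a by (intro mult_left_mono) auto
  thus ?thesis
    unfolding norm_exp_eq_Re exp_add[symmetric] by (simp add: power2_eq_square algebra_simps)
qed

text \<open>Unfolding: the n-th summand on [-1/2, 1/2] is the Gaussian on the interval of length 1
  around n, so the Fourier coefficients of the periodisation are Fourier integrals over the line.
  The periodisation is entire as a locally uniform limit, which is what
  \<open>fourier_series_at_0\<close> asks for.\<close>

lemma poisson_gaussian_limit:
  fixes a y :: real
  assumes a: "a > 0"
  shows "(\<lambda>N. \<Sum>k\<in>{-int N..int N}. exp (2 * pi * \<i> * k * y) * exp (- (pi * k^2 / a)) / sqrt a)
     \<longlonglongrightarrow> (\<Sum>\<^sub>\<infinity>n::int. exp (- (of_real (pi * a) * (of_int n + of_real y)^2)))"
proof -
  define h where "h = (\<lambda>n::int. \<lambda>z::complex. exp (- (of_real (pi * a) * (of_int n + (z + of_real y))^2)))"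
  define f where "f = (\<lambda>z. \<Sum>\<^sub>\<infinity>n::int. h n z)"
  have ul: "uniform_limit (cball 0 R) (\<lambda>N z. \<Sum>n\<in>{-int N..int N}. h n z) f sequentially" for R
  proof -
    have "uniform_limit (cball 0 R) (\<lambda>X z. \<Sum>n\<in>X. h n z) f (finite_subsets_at_top UNIV)"
      unfolding f_def
    proof (rule Weierstrass_m_test_general)
      show "norm (h n z) \<le> exp (2 * pi * a * (R + \<bar>y\<bar>)^2) * exp (- (pi * a / 2) * of_int n ^ 2)"
        if "z \<in> cball 0 R" for n z
        unfolding h_def
        by (rule gaussian_series_bound[OF a]) (use that norm_triangle_ineq[of z "of_real y"] in auto)
      show "(\<lambda>n::int. exp (2 * pi * a * (R + \<bar>y\<bar>)^2) * exp (- (pi * a / 2) * of_int n ^ 2)) summable_on UNIV"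
        using a by (intro summable_on_cmult_right summable_on_int_gaussian) auto
    qed
    from filterlim_compose[OF this filterlim_symmetric_intervals] show ?thesis .
  qed
  have hol: "f holomorphic_on UNIV"
  proof (rule holomorphic_uniform_sequence)
    show "(\<lambda>z. \<Sum>n\<in>{-int N..int N}. h n z) holomorphic_on UNIV" for N
      unfolding h_def by (intro holomorphic_intros)
    show "\<exists>d. 0 < d \<and> cball x d \<subseteq> UNIV \<and> uniform_limit (cball x d) (\<lambda>N z. \<Sum>n\<in>{-int N..int N}. h n z) f sequentially" for x
    proof (intro exI[of _ 1] conjI uniform_limit_on_subset[OF ul[of "norm x + 1"]])
      show "cball x 1 \<subseteq> cball 0 (norm x + 1)"
        by (subst cball_subset_cball_iff) (auto simp: dist_norm)
    qed auto
  qed auto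
  have per: "f (z + 1) = f z" for z
  proof -
    have "f (z + 1) = (\<Sum>\<^sub>\<infinity>n::int. h (n + 1) z)"
      unfolding f_def h_def by (simp add: add_ac)
    also have "\<dots> = (\<Sum>\<^sub>\<infinity>n. h n z)"
      by (rule infsum_reindex_bij_betw[where g = "\<lambda>n. n + 1"]) 
         (auto intro!: bij_betwI[where g = "\<lambda>n. n - 1"])
    finally show ?thesis by (simp add: f_def)
  qed
  have coeff: "integral {-1/2..1/2} (\<lambda>x. f (of_real x) * exp (- (2 * pi * \<i> * k * x))) =
      exp (2 * pi * \<i> * k * y) * exp (- (pi * k^2 / a)) / sqrt a" for k :: int
  proof -
    define g where "g = (\<lambda>x::real. exp (- (pi * a * (x + y)^2)) * exp (- (2 * pi * \<i> * real_of_int k * x)))"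
    have ig: "integrable lborel g" and Ig: "(LINT x|lborel. g x) = exp (2 * pi * \<i> * k * y) * exp (- (pi * k^2 / a)) / sqrt a"
      using gaussian_fourier_transform[OF a, of y "real_of_int k"] by (simp_all add: g_def)
    have cg: "continuous_on UNIV g" unfolding g_def by (intro continuous_intros)
    have gi: "g integrable_on {u..v}" for u v
      by (intro integrable_continuous_real continuous_on_subset[OF cg]) auto
    have hg: "h n (of_real x) * exp (- (2 * pi * \<i> * k * x)) = g (x + of_int n)" for x :: real and n
    proof -
      have "exp (- (2 * pi * \<i> * real_of_int k * (x + of_int n))) = exp (- (2 * pi * \<i> * k * x))"
        unfolding exp_eq by (intro exI[of _ "- k * n"]) (simp add: algebra_simps)
      thus ?thesis by (simp add: g_def h_def exp_of_real[symmetric] add_ac)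
    qed
    have shift: "((\<lambda>x. g (x + of_int n)) has_integral integral {of_int n - 1/2..of_int n + 1/2} g) {-1/2..1/2}" for n :: int
    proof -
      have "(g has_integral integral {of_int n - 1/2..of_int n + 1/2} g) {of_int n - 1/2..of_int n + 1/2}"
        by (intro integrable_integral gi)
      from has_integral_affinity[where m = 1 and c = "of_int n", OF this[folded cbox_interval]]
      show ?thesis by simp
    qed
    have union: "(\<Sum>n\<in>{-int N..int N}. integral {of_int n - 1/2..of_int n + 1/2} g) = 
        integral {-real N - 1/2..real N + 1/2} g" for N
    proof (induction N)
      case (Suc N)
      have "{-int (Suc N)..int (Suc N)} = insert (- int N - 1) (insert (int N + 1) {-int N..int N})" by auto
      hence "(\<Sum>n\<in>{-int (Suc N)..int (Suc N)}. integral {of_int n - 1/2..of_int n + 1/2} g) = 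
        integral {-real N - 1 - 1/2..-real N - 1/2} g + integral {-real N - 1/2..real N + 1/2} g + 
        integral {real N + 1/2..real N + 1 + 1/2} g"
        using Suc by (simp add: algebra_simps)
      also have "integral {-real N - 1 - 1/2..-real N - 1/2} g + integral {-real N - 1/2..real N + 1/2} g = 
         integral {-real N - 1 - 1/2..real N + 1/2} g"
        by (rule Henstock_Kurzweil_Integration.integral_combine[OF _ _ gi]) auto
      also have "\<dots> + integral {real N + 1/2..real N + 1 + 1/2} g = integral {-real N - 1 - 1/2..real N + 1 + 1/2} g"
        by (rule Henstock_Kurzweil_Integration.integral_combine[OF _ _ gi]) auto
      finally show ?case by (simp add: algebra_simps)
    qed auto
    have l1: "(\<lambda>N. integral {-real N - 1/2..real N + 1/2} g) \<longlonglongrightarrow> (LINT x|lborel. g x)"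
    proof -
      have "(\<lambda>N. LINT x|lborel. indicator {-real N - 1/2..real N + 1/2} x *\<^sub>R g x) \<longlonglongrightarrow> (LINT x|lborel. g x)"
      proof (rule integral_dominated_convergence)
        show "integrable lborel (\<lambda>x. norm (g x))" using ig by auto
        show "AE x in lborel. (\<lambda>N. indicator {-real N - 1/2..real N + 1/2} x *\<^sub>R g x) \<longlonglongrightarrow> g x"
        proof (rule AE_I2, rule tendsto_eventually)
          fix x :: real
          show "\<forall>\<^sub>F N in sequentially. indicator {-real N - 1/2..real N + 1/2} x *\<^sub>R g x = g x"
            using eventually_ge_at_top[of "nat \<lceil>\<bar>x\<bar>\<rceil>"]
          proof eventually_elim
            case (elim N)
            hence "\<bar>x\<bar> \<le> real N" by linarith
            hence "x \<in> {-real N - 1/2..real N + 1/2}" by auto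
            thus ?case by simp
          qed
        qed
      qed (use ig in \<open>auto split: split_indicator\<close>)
      moreover have "(LINT x|lborel. indicator {u..v} x *\<^sub>R g x) = integral {u..v} g" for u v
        using set_borel_integral_eq_integral(2)[of "{u..v}" g] integrable_mult_indicator[OF _ ig, of "{u..v}"]
        by (simp add: set_lebesgue_integral_def set_integrable_def)
      ultimately show ?thesis by simp
    qed
    have l2: "(\<lambda>N. integral {-1/2..1/2} (\<lambda>x. (\<Sum>n\<in>{-int N..int N}. h n (of_real x)) * exp (- (2 * pi * \<i> * k * x)))) \<longlonglongrightarrow> 
         integral {-1/2..1/2} (\<lambda>x. f (of_real x) * exp (- (2 * pi * \<i> * k * x)))"
    proof -
      have ul': "uniform_limit {-1/2..1/2} (\<lambda>N x. (\<Sum>n\<in>{-int N..int N}. h n (of_real x)) * exp (- (2 * pi * \<i> * k * x)))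
          (\<lambda>x. f (of_real x) * exp (- (2 * pi * \<i> * k * x))) sequentially"
        unfolding uniform_limit_iff
      proof (intro allI impI)
        fix e :: real assume e: "e > 0"
        have "\<forall>\<^sub>F N in sequentially. \<forall>z\<in>cball 0 1. dist (\<Sum>n\<in>{-int N..int N}. h n z) (f z) < e"
          using ul[of 1] e unfolding uniform_limit_iff by blast
        thus "\<forall>\<^sub>F N in sequentially. \<forall>x::real\<in>{-1/2..1/2}. dist ((\<Sum>n\<in>{-int N..int N}. h n (of_real x)) * exp (- (2 * pi * \<i> * k * x)))
          (f (of_real x) * exp (- (2 * pi * \<i> * k * x))) < e"
        proof eventually_elim
          case (elim N)
          show ?case
          proof
            fix x :: real assume x: "x \<in> {-1/2..1/2}"
            hence "complex_of_real x \<in> cball 0 1" by auto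
            with elim have *: "dist (\<Sum>n\<in>{-int N..int N}. h n (of_real x)) (f (of_real x)) < e" by blast
            have "norm (exp (- (2 * pi * \<i> * k * x))) = 1" by simp
            thus "dist ((\<Sum>n\<in>{-int N..int N}. h n (of_real x)) * exp (- (2 * pi * \<i> * k * x)))
               (f (of_real x) * exp (- (2 * pi * \<i> * k * x))) < e"
              using * unfolding dist_norm left_diff_distrib[symmetric] norm_mult by simp
          qed
        qed
      qed
      have co: "continuous_on {-1/2..1/2} (\<lambda>x. (\<Sum>n\<in>{-int N..int N}. h n (of_real x)) * exp (- (2 * pi * \<i> * k * x)))" for N
        unfolding h_def by (intro continuous_intros)
      obtain I J where IJ: 
        "\<And>N. ((\<lambda>x. (\<Sum>n\<in>{-int N..int N}. h n (of_real x)) * exp (- (2 * pi * \<i> * k * x))) has_integral I N) {-1/2..1/2}"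
        "((\<lambda>x. f (of_real x) * exp (- (2 * pi * \<i> * k * x))) has_integral J) {-1/2..1/2}" "I \<longlonglongrightarrow> J"
        by (rule uniform_limit_integral[OF ul' co sequentially_bot]) (rule that)
      have "(\<lambda>N. integral {-1/2..1/2} (\<lambda>x. (\<Sum>n\<in>{-int N..int N}. h n (of_real x)) * exp (- (2 * pi * \<i> * k * x)))) = I"
        by (intro ext integral_unique IJ)
      with IJ(3) integral_unique[OF IJ(2)] show ?thesis by simp
    qed
    \<comment> \<open>For each N the truncated periodisation integrates to the Gaussian over a
      centred interval, so \<open>l1\<close> and \<open>l2\<close> are limits of one
      sequence.\<close>
    have "integral {-1/2..1/2} (\<lambda>x. (\<Sum>n\<in>{-int N..int N}. h n (of_real x)) * exp (- (2 * pi * \<i> * k * x))) = 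
        integral {-real N - 1/2..real N + 1/2} g" for N
      unfolding union[symmetric] sum_distrib_right hg
      by (intro integral_unique has_integral_sum shift) auto
    from l2[unfolded this] l1 have "integral {-1/2..1/2} (\<lambda>x. f (of_real x) * exp (- (2 * pi * \<i> * k * x))) = (LINT x|lborel. g x)"
      by (rule LIMSEQ_unique)
    thus ?thesis unfolding Ig .
  qed
  show ?thesis
    using fourier_series_at_0[OF hol per] unfolding coeff by (simp add: f_def h_def)
qed

section \<open>Theta inversion\<close>

text \<open>Absolute convergence turns the symmetric limit into an unordered sum, which can then be
  exchanged with other sums.\<close>

lemma poisson_gaussian:
  fixes a y :: real
  assumes a: "a > 0"
  shows "(\<Sum>\<^sub>\<infinity>n::int. exp (- (of_real (pi * a) * (of_int n + of_real y)^2))) =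
     (\<Sum>\<^sub>\<infinity>k::int. exp (2 * pi * \<i> * k * y) * exp (- (of_real (pi / a) * of_int k^2))) / sqrt a"
proof -
  have "(\<lambda>k::int. exp (2 * pi * \<i> * k * y) * exp (- (of_real (pi / a) * of_int k^2))) summable_on UNIV"
  proof (rule abs_summable_summable, rule summable_on_cong[THEN iffD1])
    show "(\<lambda>k::int. exp (- (pi / a) * of_int k ^ 2) :: real) summable_on UNIV"
      using a by (intro summable_on_int_gaussian) auto
    show "exp (- (pi / a) * of_int k ^ 2) = norm (exp (2 * pi * \<i> * k * y) * exp (- (of_real (pi / a) * of_int k^2)))" for k :: int
      unfolding norm_mult norm_exp_eq_Re by (simp add: power2_eq_square)
  qed
  hence "((\<lambda>X. \<Sum>k\<in>X. exp (2 * pi * \<i> * k * y) * exp (- (of_real (pi / a) * of_int k^2))) \<longlongrightarrow>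
     (\<Sum>\<^sub>\<infinity>k::int. exp (2 * pi * \<i> * k * y) * exp (- (of_real (pi / a) * of_int k^2)))) (finite_subsets_at_top UNIV)"
    by (simp add: summable_iff_has_sum_infsum has_sum_def)
  from filterlim_compose[OF this filterlim_symmetric_intervals]
  have "(\<lambda>N. (\<Sum>k\<in>{-int N..int N}. exp (2 * pi * \<i> * k * y) * exp (- (of_real (pi / a) * of_int k^2))) / sqrt a) \<longlonglongrightarrow>
     (\<Sum>\<^sub>\<infinity>k::int. exp (2 * pi * \<i> * k * y) * exp (- (of_real (pi / a) * of_int k^2))) / sqrt a"
    by (rule tendsto_divide[OF _ tendsto_const]) (use a in auto)
  moreover have "(\<lambda>N. (\<Sum>k\<in>{-int N..int N}. exp (2 * pi * \<i> * k * y) * exp (- (of_real (pi / a) * of_int k^2))) / sqrt a) =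
    (\<lambda>N. \<Sum>k\<in>{-int N..int N}. exp (2 * pi * \<i> * k * y) * exp (- (pi * k^2 / a)) / sqrt a)"
    by (simp add: sum_divide_distrib exp_of_real[symmetric])
  ultimately show ?thesis
    using LIMSEQ_unique[OF poisson_gaussian_limit[OF a, of y]] by simp
qed

section \<open>The quadratic form of the lattice and its lower bound\<close>

text \<open>A positive definite binary form of determinant 1, hence equivalent to its inverse form;
  this is why theta inversion leads back to the same \<open>quad z\<close>.\<close>

definition quad :: "complex \<Rightarrow> int \<times> int \<Rightarrow> real" where
  "quad z v = (cmod (of_int (fst v) * z + of_int (snd v)))\<^sup>2 / Im z"

text \<open>Large near the real line and near infinity, bounded on compact subsets of
  \<open>UHP\<close>: powers of it express local bounds and growth at the cusp at once.\<close>

definition hgt :: "complex \<Rightarrow> real" where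
  "hgt z = 1 + norm z + 1 / Im z"

lemma quad_altdef: "quad z (m, n) = ((of_int m * Im z)^2 + (of_int n + of_int m * Re z)^2) / Im z"
  by (simp add: quad_def cmod_power2 add_ac)

lemma hgt_bounds:
  assumes "z \<in> UHP"
  shows "hgt z \<ge> 1" "Im z \<le> hgt z" "1 / Im z \<le> hgt z" "norm z \<le> hgt z"
proof -
  have "Im z > 0" "Im z \<le> norm z" using assms abs_Im_le_cmod[of z] by (auto simp: UHP_def)
  moreover from this have "1 / Im z > 0" by simp
  ultimately show "hgt z \<ge> 1" "Im z \<le> hgt z" "1 / Im z \<le> hgt z" "norm z \<le> hgt z"
    unfolding hgt_def by linarith+
qed

text \<open>The imaginary part of mz + n controls m, and then the triangle inequality controls n.
  The constant 5 collects the coefficients 1, 2, 2 of \<open>1 / y\<close>, \<open>2 * P\<close> and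
  \<open>2 * (1 / y) * P^2\<close>, where \<open>P = hgt z\<close>; each monomial is at most
  \<open>P ^ 3\<close>.\<close>

lemma quad_lower_bound:
  assumes z: "z \<in> UHP"
  shows "(of_int m)\<^sup>2 + (of_int n)\<^sup>2 \<le> 5 * hgt z ^ 3 * quad z (m, n)"
proof -
  define N where "N = of_int m * z + of_int n"
  define y where "y = Im z"
  define P where "P = hgt z"
  have y: "y > 0" using z by (simp add: y_def UHP_def)
  have P: "P \<ge> 1" "y \<le> P" "1 / y \<le> P" "norm z \<le> P"
    using hgt_bounds[OF z] by (simp_all add: P_def y_def)
  have Q: "(norm N)^2 = y * quad z (m, n)"
    using y by (simp add: quad_def N_def y_def)
  have Q0: "quad z (m, n) \<ge> 0" using y by (simp add: quad_def y_def)
  have "\<bar>of_int m * y\<bar> \<le> norm N"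
    using abs_Im_le_cmod[of N] by (simp add: N_def y_def)
  hence "(of_int m * y)^2 \<le> (norm N)^2"
    by (metis abs_le_square_iff abs_norm_cancel)
  hence m: "(of_int m)^2 \<le> quad z (m, n) / y"
    unfolding Q using y by (simp add: power_mult_distrib power2_eq_square field_simps)
  have "norm (of_int n :: complex) \<le> norm N + norm (of_int m * z)"
    using norm_triangle_ineq4[of N "of_int m * z"] by (simp add: N_def)
  hence "\<bar>of_int n\<bar> \<le> norm N + \<bar>of_int m\<bar> * norm z" by (simp add: norm_mult)
  hence "\<bar>of_int n\<bar>^2 \<le> (norm N + \<bar>of_int m\<bar> * norm z)^2" by (intro power_mono) auto
  also have "\<dots> \<le> 2 * (norm N)^2 + 2 * (\<bar>of_int m\<bar> * norm z)^2"
    using sum_squares_bound[of "norm N" "\<bar>of_int m\<bar> * norm z"] by (simp add: power2_sum)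
  also have "\<dots> = 2 * (y * quad z (m, n)) + 2 * (of_int m)^2 * (norm z)^2"
    unfolding Q by (simp add: power_mult_distrib)
  also have "\<dots> \<le> 2 * (P * quad z (m, n)) + 2 * (quad z (m, n) / y) * P^2"
    using P y Q0 m by (intro add_mono mult_mono mult_left_mono mult_right_mono power_mono) auto
  finally have "(of_int m)^2 + (of_int n)^2 \<le> quad z (m,n) / y + (2 * (P * quad z (m, n)) + 2 * (quad z (m, n) / y) * P^2)"
    using m by simp
  also have "\<dots> = quad z (m,n) * (1 / y + 2 * P + 2 * (1 / y) * P^2)" by (simp add: algebra_simps)
  also have "\<dots> \<le> quad z (m,n) * (5 * P ^ 3)"
  proof (intro mult_left_mono Q0)
    have "(1 / y) * P^2 \<le> P * P^2" using P by (intro mult_right_mono) auto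
    moreover have "P \<le> P^3" using P power_increasing[of 1 3 P] by simp
    moreover have "P * P^2 = P^3" by (simp add: power3_eq_cube power2_eq_square)
    ultimately show "1 / y + 2 * P + 2 * (1 / y) * P^2 \<le> 5 * P ^ 3" using P by linarith
  qed
  finally show ?thesis by (simp add: P_def mult_ac)
qed

lemma quad_pos:
  assumes "z \<in> UHP" "v \<noteq> (0, 0)"
  shows "quad z v > 0"
proof -
  obtain m n where v: "v = (m, n)" by force
  have "0 < (of_int m :: real)\<^sup>2 + (of_int n)\<^sup>2"
    using assms(2) v by (auto simp: sum_power2_gt_zero_iff)
  also have "\<dots> \<le> 5 * hgt z ^ 3 * quad z (m, n)" by (rule quad_lower_bound[OF assms(1)])
  finally show ?thesis
    using hgt_bounds(1)[OF assms(1)] v by (simp add: zero_less_mult_iff)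
qed

lemma summable_on_mult_prod:
  fixes f :: "'a \<Rightarrow> real" and g :: "'b \<Rightarrow> real"
  assumes "f summable_on UNIV" "g summable_on UNIV" "\<And>x. f x \<ge> 0" "\<And>x. g x \<ge> 0"
  shows "(\<lambda>(x, y). f x * g y) summable_on UNIV"
proof -
  have "(\<lambda>p. norm (f (fst p) * g (snd p))) summable_on (UNIV \<times> UNIV)"
    unfolding Infinite_Sum.abs_summable_on_Sigma_iff using assms
    by (auto simp: abs_mult infsum_cmult_right' intro!: summable_on_cmult_right summable_on_cmult_left infsum_nonneg)
  thus ?thesis using assms(3,4) by (simp add: case_prod_unfold abs_mult)
qed

lemma summable_on_gaussian_prod:
  assumes "c > 0" "d > 0"
  shows "(\<lambda>(m, n). exp (- c * of_int m ^ 2) * exp (- d * of_int n ^ 2) :: real) summable_on (UNIV :: (int \<times> int) set)"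
  by (rule summable_on_mult_prod) (use assms summable_on_int_gaussian in auto)

lemma summable_on_theta:
  assumes z: "z \<in> UHP" and t: "t > 0"
  shows "(\<lambda>v. exp (- (pi * t * quad z v))) summable_on UNIV"
proof -
  define c where "c = pi * t / (5 * hgt z ^ 3)"
  have h: "hgt z > 0" using hgt_bounds(1)[OF z] by linarith
  have c: "c > 0" using t h by (simp add: c_def)
  show ?thesis
  proof (rule summable_on_comparison_test[OF summable_on_gaussian_prod[OF c c]])
    fix v :: "int \<times> int"
    obtain m n where v: "v = (m, n)" by force
    have "c * ((of_int m)^2 + (of_int n)^2) \<le> c * (5 * hgt z ^ 3 * quad z (m, n))"
      using c by (intro mult_left_mono quad_lower_bound z) auto
    also have "\<dots> = pi * t * quad z (m, n)" using h by (simp add: c_def)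
    finally show "exp (- (pi * t * quad z v)) \<le> (case v of (m, n) \<Rightarrow> exp (- c * of_int m ^ 2) * exp (- c * of_int n ^ 2))"
      unfolding v exp_add[symmetric] prod.case by (simp add: algebra_simps)
  qed auto
qed

text \<open>Poisson summation is used twice in one variable: the sum over n is transformed, the
  double sum is exchanged, and the sum over m is then already a Fourier side, which is transformed
  back. The new frequency k takes over the role of m.\<close>

lemma theta_inversion:
  assumes z: "z \<in> UHP" and t: "t > 0"
  shows "(\<Sum>\<^sub>\<infinity>v. exp (- (pi * t * quad z v))) = (\<Sum>\<^sub>\<infinity>v. exp (- (pi / t * quad z v))) / t"
proof -
  define x where "x = Re z"
  define y where "y = Im z"
  have y: "y > 0" using z by (simp add: UHP_def y_def)
  have split: "complex_of_real (\<Sum>\<^sub>\<infinity>v. exp (- (pi * t * quad z v))) = 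
     (\<Sum>\<^sub>\<infinity>m::int. exp (- (of_real (pi * t * y) * of_int m^2)) * 
        (\<Sum>\<^sub>\<infinity>n::int. exp (- (of_real (pi * (t / y)) * (of_int n + of_real (m * x))^2))))" if t: "t > 0" for t
  proof -
    have eq: "complex_of_real (exp (- (pi * t * quad z (m, n)))) = 
       exp (- (of_real (pi * t * y) * of_int m^2)) * exp (- (of_real (pi * (t / y)) * (of_int n + of_real (m * x))^2))" for m n :: int
    proof -
      have "- (pi * t * quad z (m, n)) = - (pi * t * y * m^2) + - (pi * (t / y) * (n + m * x)^2)"
        using y by (simp add: quad_altdef x_def[symmetric] y_def[symmetric] power_mult_distrib) (simp add: field_simps power2_eq_square)
      hence "exp (- (pi * t * quad z (m, n))) = exp (- (pi * t * y * m^2)) * exp (- (pi * (t / y) * (n + m * x)^2))"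
        by (simp only: exp_add)
      thus ?thesis by (simp add: exp_of_real[symmetric])
    qed
    have "complex_of_real (\<Sum>\<^sub>\<infinity>v. exp (- (pi * t * quad z v))) = (\<Sum>\<^sub>\<infinity>v. complex_of_real (exp (- (pi * t * quad z v))))"
      by (rule infsumI[symmetric], rule has_sum_of_real, rule has_sum_infsum, rule summable_on_theta[OF z t])
    also have "\<dots> = (\<Sum>\<^sub>\<infinity>m. \<Sum>\<^sub>\<infinity>n. complex_of_real (exp (- (pi * t * quad z (m, n)))))"
      using infsum_Sigma_banach[of "\<lambda>v. complex_of_real (exp (- (pi * t * quad z v)))" UNIV "\<lambda>_. UNIV"]
        summable_on_of_real[OF summable_on_theta[OF z t], where ?'a = complex] by simp
    finally show ?thesis unfolding eq infsum_cmult_right' .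
  qed
  define r where "r = complex_of_real (sqrt (t / y))"
  \<comment> \<open>This summand is symmetric under exchanging m with k and t with 1/t; the second
    application of Poisson summation exploits that.\<close>
  define u where "u = (\<lambda>m k::int. exp (- (of_real (pi * t * y) * of_int m^2)) * (exp (2 * pi * \<i> * k * of_real (m * x)) * exp (- (of_real (pi / (t / y)) * of_int k^2))))"
  have su: "(\<lambda>(m,k). u m k) summable_on UNIV \<times> UNIV"
  proof (rule abs_summable_summable, rule summable_on_cong[THEN iffD1])
    show "(\<lambda>(m, n). exp (- (pi * t * y) * of_int m ^ 2) * exp (- (pi / (t / y)) * of_int n ^ 2) :: real) summable_on (UNIV \<times> UNIV :: (int \<times> int) set)"
      using summable_on_gaussian_prod[of "pi * t * y" "pi / (t / y)"] t y by simp
    show "(case v of (m, n) \<Rightarrow> exp (- (pi * t * y) * of_int m ^ 2) * exp (- (pi / (t / y)) * of_int n ^ 2)) = norm (case v of (m, k) \<Rightarrow> u m k)" for v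
      unfolding u_def case_prod_unfold norm_mult norm_exp_eq_Re by (simp add: power2_eq_square)
  qed
  have "complex_of_real (\<Sum>\<^sub>\<infinity>v. exp (- (pi * t * quad z v))) = 
     (\<Sum>\<^sub>\<infinity>m::int. (\<Sum>\<^sub>\<infinity>k::int. u m k) / r)"
    unfolding split[OF t] u_def r_def infsum_cmult_right' poisson_gaussian[OF divide_pos_pos[OF t y]] by simp
  also have "\<dots> = (\<Sum>\<^sub>\<infinity>m::int. \<Sum>\<^sub>\<infinity>k::int. u m k) / r"
    by (simp add: divide_inverse infsum_cmult_left')
  also have "(\<Sum>\<^sub>\<infinity>m::int. \<Sum>\<^sub>\<infinity>k::int. u m k) = (\<Sum>\<^sub>\<infinity>k::int. \<Sum>\<^sub>\<infinity>m::int. u m k)"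
    by (rule infsum_swap_banach[OF su])
  also have "(\<lambda>k::int. \<Sum>\<^sub>\<infinity>m::int. u m k) = (\<lambda>k. exp (- (complex_of_real (pi * (1 / t) * y) * of_int k^2)) * 
        (\<Sum>\<^sub>\<infinity>n::int. exp (- (complex_of_real (pi * (1 / t / y)) * (of_int n + of_real (k * x))^2))) * complex_of_real (sqrt (1 / t / y)))"
  proof
    fix k :: int
    have 1: "u m k = exp (- (complex_of_real (pi * (1 / t) * y) * of_int k^2)) * 
       (exp (2 * pi * \<i> * m * of_real (k * x)) * exp (- (complex_of_real (pi / (1 / t / y)) * of_int m^2)))" for m
      using t y by (simp add: u_def mult_ac)
    have "(\<Sum>\<^sub>\<infinity>n::int. exp (- (complex_of_real (pi * (1 / t / y)) * (of_int n + of_real (k * x))^2))) * complex_of_real (sqrt (1 / t / y)) = 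
       (\<Sum>\<^sub>\<infinity>m::int. exp (2 * pi * \<i> * m * of_real (k * x)) * exp (- (complex_of_real (pi / (1 / t / y)) * of_int m^2)))"
      using t y by (subst poisson_gaussian) auto
    thus "(\<Sum>\<^sub>\<infinity>m::int. u m k) = exp (- (complex_of_real (pi * (1 / t) * y) * of_int k^2)) * 
        (\<Sum>\<^sub>\<infinity>n::int. exp (- (complex_of_real (pi * (1 / t / y)) * (of_int n + of_real (k * x))^2))) * complex_of_real (sqrt (1 / t / y))"
      unfolding 1 infsum_cmult_right' mult.assoc by (simp only:)
  qed
  also have "(\<Sum>\<^sub>\<infinity>k::int. exp (- (complex_of_real (pi * (1 / t) * y) * of_int k^2)) * 
        (\<Sum>\<^sub>\<infinity>n::int. exp (- (complex_of_real (pi * (1 / t / y)) * (of_int n + of_real (k * x))^2))) * complex_of_real (sqrt (1 / t / y))) = 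
       complex_of_real (\<Sum>\<^sub>\<infinity>v. exp (- (pi * (1 / t) * quad z v))) * complex_of_real (sqrt (1 / t / y))"
    using t by (subst split) (simp_all only: infsum_cmult_left' zero_less_divide_1_iff)
  also have "\<dots> / r = complex_of_real ((\<Sum>\<^sub>\<infinity>v. exp (- (pi * (1 / t) * quad z v))) * (sqrt (1 / t / y) / sqrt (t / y)))"
    by (simp add: r_def)
  also have "sqrt (1 / t / y) / sqrt (t / y) = 1 / t"
  proof -
    have "sqrt (1 / t / y) / sqrt (t / y) = sqrt ((1 / t)^2)"
      unfolding real_sqrt_divide[symmetric] using t y by (simp add: power2_eq_square field_simps)
    thus ?thesis using t by simp
  qed
  finally have "(\<Sum>\<^sub>\<infinity>v. exp (- (pi * t * quad z v))) = (\<Sum>\<^sub>\<infinity>v. exp (- (pi * (1 / t) * quad z v))) * (1 / t)"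
    unfolding of_real_eq_iff .
  thus ?thesis by simp
qed

section \<open>Wirtinger derivatives of lattice sums\<close>

text \<open>\<open>A\<close> and \<open>B\<close> are the Wirtinger derivatives d/dz and d/d(cnj z);
  every real-linear map of the plane has the form on the right. In these coordinates mz + n and its
  conjugate each have a single nonzero derivative.\<close>

definition wderiv :: "(complex \<Rightarrow> complex) \<Rightarrow> complex \<Rightarrow> complex \<Rightarrow> complex \<Rightarrow> bool" where
  "wderiv f A B z \<longleftrightarrow> (f has_derivative (\<lambda>h. A * h + B * cnj h)) (at z)"

lemma wderiv_Dx: "wderiv f A B z \<Longrightarrow> Dx f z = A + B"
  and wderiv_Dy: "wderiv f A B z \<Longrightarrow> Dy f z = \<i> * (A - B)"
  and wderiv_differentiable: "wderiv f A B z \<Longrightarrow> f differentiable (at z)"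
  unfolding wderiv_def Dx_def Dy_def
  by (auto simp: frechet_derivative_at[symmetric] algebra_simps intro: differentiableI)

lemma wderiv_eq: "wderiv f A' B' z \<Longrightarrow> A' = A \<Longrightarrow> B' = B \<Longrightarrow> wderiv f A B z"
  by simp

lemma wderiv_const: "wderiv (\<lambda>_. c) 0 0 z"
  by (simp add: wderiv_def)

lemma wderiv_ident: "wderiv (\<lambda>z. z) 1 0 z"
  by (simp add: wderiv_def)

lemma wderiv_cnj: "wderiv f A B z \<Longrightarrow> wderiv (\<lambda>z. cnj (f z)) (cnj B) (cnj A) z"
  unfolding wderiv_def
  by (drule bounded_linear.has_derivative[OF bounded_linear_cnj]) (simp add: add.commute)

lemma wderiv_add: "wderiv f A B z \<Longrightarrow> wderiv g A' B' z \<Longrightarrow> wderiv (\<lambda>z. f z + g z) (A + A') (B + B') z"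
  unfolding wderiv_def by (drule (1) has_derivative_add) (simp add: algebra_simps)

lemma wderiv_mult: 
  "wderiv f A B z \<Longrightarrow> wderiv g A' B' z \<Longrightarrow> wderiv (\<lambda>z. f z * g z) (A * g z + f z * A') (B * g z + f z * B') z"
  unfolding wderiv_def by (drule (1) has_derivative_mult) (simp add: algebra_simps)

lemma wderiv_cmult: "wderiv f A B z \<Longrightarrow> wderiv (\<lambda>z. c * f z) (c * A) (c * B) z"
  using wderiv_mult[OF wderiv_const] by simp

lemma wderiv_compose_field:
  assumes "wderiv f A B z" "(g has_field_derivative g') (at (f z))"
  shows "wderiv (\<lambda>z. g (f z)) (g' * A) (g' * B) z"
  using has_derivative_compose[OF assms(1)[unfolded wderiv_def] assms(2)[unfolded has_field_derivative_def]]
  by (simp add: wderiv_def algebra_simps)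

text \<open>Since \<open>q\<close> is real valued, \<open>A * h + B * cnj h\<close> is real for
  every h, so that a \<open>\<phi>\<close> differentiable along the real line only can still be
  composed with it.\<close>

lemma wderiv_compose_real:
  fixes q :: "complex \<Rightarrow> real"
  assumes "wderiv (\<lambda>z. of_real (q z)) A B z" "(\<phi> has_vector_derivative c) (at (q z))"
  shows "wderiv (\<lambda>z. \<phi> (q z)) (c * A) (c * B) z"
proof -
  have d: "((\<lambda>z. complex_of_real (q z)) has_derivative (\<lambda>h. A * h + B * cnj h)) (at z)"
    using assms(1) by (simp add: wderiv_def)
  have re: "(q has_derivative (\<lambda>h. Re (A * h + B * cnj h))) (at z)"
    using bounded_linear.has_derivative[OF bounded_linear_Re d] by simp
  have "((\<lambda>z. complex_of_real (q z)) has_derivative (\<lambda>h. complex_of_real (Re (A * h + B * cnj h)))) (at z)"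
    by (rule has_derivative_of_real[OF re])
  with d have "(\<lambda>h. A * h + B * cnj h) = (\<lambda>h. complex_of_real (Re (A * h + B * cnj h)))"
    by (rule has_derivative_unique)
  hence e: "complex_of_real (Re (A * h + B * cnj h)) = A * h + B * cnj h" for h by metis
  have "((\<lambda>z. \<phi> (q z)) has_derivative (\<lambda>h. Re (A * h + B * cnj h) *\<^sub>R c)) (at z)"
    using has_derivative_compose[OF re assms(2)[unfolded has_vector_derivative_def]] by simp
  thus ?thesis
    unfolding wderiv_def scaleR_conv_of_real e by (simp add: algebra_simps)
qed

lemma wderiv_Im: "wderiv (\<lambda>z. of_real (Im z)) (1 / (2 * \<i>)) (- (1 / (2 * \<i>))) z"
proof -
  have "wderiv (\<lambda>z. (1 / (2 * \<i>)) * (z + (-1) * cnj z)) (1 / (2 * \<i>)) (- (1 / (2 * \<i>))) z"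
    by (rule wderiv_eq[OF wderiv_cmult[OF wderiv_add[OF wderiv_ident wderiv_cmult[OF wderiv_cnj[OF wderiv_ident]]]]]) auto
  also have "(\<lambda>z. (1 / (2 * \<i>)) * (z + (-1) * cnj z)) = (\<lambda>z. of_real (Im z))"
    by (auto simp: fun_eq_iff complex_diff_cnj mult.left_commute[of \<i>])
  finally show ?thesis .
qed

lemma open_UHP: "open UHP"
  unfolding UHP_def by (intro open_Collect_less continuous_intros)

lemma wderiv_transform:
  assumes "wderiv f A B z" "z \<in> UHP" "\<And>z. z \<in> UHP \<Longrightarrow> f z = g z"
  shows "wderiv g A B z"
  using assms open_UHP unfolding wderiv_def by (blast intro: has_derivative_transform_within_open)

text \<open>Serves both for partial sums of lattice sums and for difference quotients in the
  parameter w.\<close>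

lemma wderiv_sequence:
  fixes f :: "nat \<Rightarrow> complex \<Rightarrow> complex"
  assumes r: "r > 0"
    and d: "\<And>n z. z \<in> ball z0 r \<Longrightarrow> wderiv (f n) (A n z) (B n z) z"
    and A: "uniform_limit (ball z0 r) A A' sequentially"
    and B: "uniform_limit (ball z0 r) B B' sequentially"
    and l: "\<And>z. z \<in> ball z0 r \<Longrightarrow> (\<lambda>n. f n z) \<longlonglongrightarrow> f' z"
  shows "wderiv f' (A' z0) (B' z0) z0"
proof -
  have z0: "z0 \<in> ball z0 r" using r by simp
  have "\<exists>g. \<forall>z\<in>ball z0 r. (\<lambda>n. f n z) \<longlonglongrightarrow> g z \<and> 
     (g has_derivative (\<lambda>h. A' z * h + B' z * cnj h)) (at z within ball z0 r)"
  proof (rule has_derivative_sequence)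
    show "(f n has_derivative (\<lambda>h. A n z * h + B n z * cnj h)) (at z within ball z0 r)" if "z \<in> ball z0 r" for n z
      using d[OF that] unfolding wderiv_def by (rule has_derivative_at_withinI)
    show "z0 \<in> ball z0 r" by (rule z0)
    show "(\<lambda>n. f n z0) \<longlonglongrightarrow> f' z0" by (rule l[OF z0])
    fix e :: real assume e: "e > 0"
    hence "e / 2 > 0" by simp
    from uniform_limitD[OF A this] uniform_limitD[OF B this]
    show "\<forall>\<^sub>F n in sequentially. \<forall>z\<in>ball z0 r. \<forall>h. 
       norm ((A n z * h + B n z * cnj h) - (A' z * h + B' z * cnj h)) \<le> e * norm h"
    proof eventually_elim
      case (elim n)
      show ?case
      proof (intro ballI allI)
        fix z h assume z: "z \<in> ball z0 r"
        have "(A n z * h + B n z * cnj h) - (A' z * h + B' z * cnj h) = (A n z - A' z) * h + (B n z - B' z) * cnj h"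
          by (simp add: algebra_simps)
        also have "norm \<dots> \<le> (e / 2) * norm h + (e / 2) * norm (cnj h)"
        proof (intro norm_triangle_le add_mono)
          have "norm (A n z - A' z) \<le> e / 2" "norm (B n z - B' z) \<le> e / 2"
            using elim z by (auto simp: dist_norm intro: less_imp_le)
          thus "norm ((A n z - A' z) * h) \<le> e / 2 * norm h" "norm ((B n z - B' z) * cnj h) \<le> e / 2 * norm (cnj h)"
            unfolding norm_mult by (simp_all only: mult_right_mono norm_ge_zero)
        qed
        finally show "norm ((A n z * h + B n z * cnj h) - (A' z * h + B' z * cnj h)) \<le> e * norm h"
          by simp
      qed
    qed
  qed auto
  then obtain g where g: "\<And>z. z \<in> ball z0 r \<Longrightarrow> (\<lambda>n. f n z) \<longlonglongrightarrow> g z"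
     "\<And>z. z \<in> ball z0 r \<Longrightarrow> (g has_derivative (\<lambda>h. A' z * h + B' z * cnj h)) (at z within ball z0 r)"
    by blast
  have "(g has_derivative (\<lambda>h. A' z0 * h + B' z0 * cnj h)) (at z0)"
    using g(2)[OF z0] at_within_open[OF z0 open_ball] by simp
  thus ?thesis unfolding wderiv_def
    by (rule has_derivative_transform_within_open[OF _ open_ball z0]) (rule LIMSEQ_unique[OF g(1) l])
qed

lemma wderiv_sum:
  "(\<And>i. i \<in> I \<Longrightarrow> wderiv (f i) (A i) (B i) z) \<Longrightarrow>
    wderiv (\<lambda>z. \<Sum>i\<in>I. f i z) (\<Sum>i\<in>I. A i) (\<Sum>i\<in>I. B i) z"
proof (induction I rule: infinite_finite_induct)
  case (insert i I)
  thus ?case by (auto intro: wderiv_add)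
qed (simp_all add: wderiv_const)

lemma wderiv_suminf:
  fixes f :: "nat \<Rightarrow> complex \<Rightarrow> complex"
  assumes r: "r > 0"
    and d: "\<And>i z. z \<in> ball z0 r \<Longrightarrow> wderiv (f i) (A i z) (B i z) z"
    and A: "\<And>i z. z \<in> ball z0 r \<Longrightarrow> norm (A i z) \<le> M i"
    and B: "\<And>i z. z \<in> ball z0 r \<Longrightarrow> norm (B i z) \<le> M i"
    and M: "summable M" and s: "\<And>z. z \<in> ball z0 r \<Longrightarrow> summable (\<lambda>i. f i z)"
  shows "wderiv (\<lambda>z. \<Sum>i. f i z) (\<Sum>i. A i z0) (\<Sum>i. B i z0) z0"
proof (rule wderiv_sequence[OF r])
  show "uniform_limit (ball z0 r) (\<lambda>n z. \<Sum>i<n. A i z) (\<lambda>z. \<Sum>i. A i z) sequentially"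
    by (rule Weierstrass_m_test[OF A M])
  show "uniform_limit (ball z0 r) (\<lambda>n z. \<Sum>i<n. B i z) (\<lambda>z. \<Sum>i. B i z) sequentially"
    by (rule Weierstrass_m_test[OF B M])
  fix z assume z: "z \<in> ball z0 r"
  show "wderiv (\<lambda>z. \<Sum>i<n. f i z) (\<Sum>i<n. A i z) (\<Sum>i<n. B i z) z" for n
    by (rule wderiv_sum) (rule d[OF z])
  show "(\<lambda>n. \<Sum>i<n. f i z) \<longlonglongrightarrow> (\<Sum>i. f i z)"
    by (rule summable_LIMSEQ[OF s[OF z]])
qed

section \<open>Enumerated lattice sums: convergence, bounds, termwise differentiation\<close>

text \<open>An arbitrary enumeration of the nonzero vectors. All sums over it converge absolutely,
  so its order is immaterial, and the theory of ordinary series becomes available.\<close>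

definition lat :: "nat \<Rightarrow> int \<times> int" where
  "lat = from_nat_into (UNIV - {(0, 0)})"

lemma infinite_int_pairs: "infinite (UNIV - {(0::int, 0::int)})"
  by (simp add: finite_prod)

lemma bij_betw_lat: "bij_betw lat UNIV (UNIV - {(0, 0)})"
  unfolding lat_def by (rule bij_betw_from_nat_into[OF _ infinite_int_pairs]) simp

lemma lat_nonzero: "lat i \<noteq> (0, 0)"
  using bij_betwE[OF bij_betw_lat] by blast

definition lsize :: "nat \<Rightarrow> real" where
  "lsize i = (of_int (fst (lat i)))\<^sup>2 + (of_int (snd (lat i)))\<^sup>2"

lemma lsize_ge_1: "lsize i \<ge> 1"
proof -
  obtain m n where v: "lat i = (m, n)" by force
  have "0 < m\<^sup>2 + n\<^sup>2" using lat_nonzero[of i] v by (auto simp: sum_power2_gt_zero_iff)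
  hence "1 \<le> m\<^sup>2 + n\<^sup>2" by simp
  hence "real_of_int 1 \<le> real_of_int (m\<^sup>2 + n\<^sup>2)" by (subst of_int_le_iff)
  thus ?thesis by (simp add: lsize_def v)
qed

text \<open>Comparison with a product: \<open>(1 + m^2) * (1 + n^2)\<close> is at most the square of
  \<open>2 + m^2 + n^2\<close>, and \<open>2 + m^2 + n^2 <= 3 * (m^2 + n^2)\<close> for nonzero
  vectors. Half of the exponent goes to each coordinate, and both one-dimensional sums converge for
  s > 1.\<close>

lemma summable_lsize:
  assumes s: "s > 1"
  shows "summable (\<lambda>i. lsize i powr (-s))"
proof -
  define g where "g = (\<lambda>n::nat. (1 + (real n)\<^sup>2) powr (-s/2))"
  have "summable g"
  proof (rule summable_comparison_test_ev)
    show "summable (\<lambda>n. real n powr (-s))" using s by (simp add: summable_real_powr_iff)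
    show "\<forall>\<^sub>F n in sequentially. norm (g n) \<le> real n powr (-s)"
      using eventually_gt_at_top[of 0]
    proof eventually_elim
      case (elim n)
      have "g n \<le> ((real n)\<^sup>2) powr (-s/2)"
        unfolding g_def using s elim by (intro powr_mono2') auto
      also have "(real n)\<^sup>2 = real n powr 2" using elim by simp
      also have "(real n powr 2) powr (-s/2) = real n powr (-s)" by (simp only: powr_powr) simp
      finally show ?case by (simp add: g_def)
    qed
  qed
  from summable_on_int_of_nat[OF this] have "(\<lambda>n::int. (1 + (real_of_int n)\<^sup>2) powr (-s/2)) summable_on UNIV"
    by (simp add: g_def)
  from summable_on_mult_prod[OF this this]
  have "(\<lambda>v::int\<times>int. 3 powr s * (case v of (m, n) \<Rightarrow> (1 + (real_of_int m)\<^sup>2) powr (-s/2) * (1 + (real_of_int n)\<^sup>2) powr (-s/2))) summable_on UNIV"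
    by (intro summable_on_cmult_right) simp
  hence "(\<lambda>v::int\<times>int. 3 powr s * (case v of (m, n) \<Rightarrow> (1 + (real_of_int m)\<^sup>2) powr (-s/2) * (1 + (real_of_int n)\<^sup>2) powr (-s/2))) summable_on (UNIV - {(0, 0)})"
    by (rule summable_on_subset_banach) auto
  hence 1: "(\<lambda>i. 3 powr s * (case lat i of (m, n) \<Rightarrow> (1 + (real_of_int m)\<^sup>2) powr (-s/2) * (1 + (real_of_int n)\<^sup>2) powr (-s/2))) summable_on UNIV"
    by (subst summable_on_reindex_bij_betw[OF bij_betw_lat])
  show ?thesis
  proof (rule summable_comparison_test_ev[OF _ summable_on_imp_summable[OF 1]], intro always_eventually allI)
    fix i
    obtain m n where v: "lat i = (m, n)" by force
    define a where "a = 1 + (real_of_int m)\<^sup>2"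
    define b where "b = 1 + (real_of_int n)\<^sup>2"
    have ab: "a \<ge> 1" "b \<ge> 1" by (auto simp: a_def b_def)
    have "a * b \<le> (a + b)^2" using ab by (simp add: power2_sum)
    also have "a + b \<le> 3 * lsize i"
      using lsize_ge_1[of i] by (simp add: a_def b_def v lsize_def)
    hence "(a + b)^2 \<le> (3 * lsize i)^2" using ab by (intro power_mono) auto
    finally have "(3 * lsize i)^2 \<ge> a * b" .
    hence "((3 * lsize i)^2) powr (-s/2) \<le> (a * b) powr (-s/2)"
      using s ab by (intro powr_mono2') (auto intro!: mult_pos_pos)
    also have "(3 * lsize i)^2 = (3 * lsize i) powr 2" using lsize_ge_1[of i] by simp
    also have "((3 * lsize i) powr 2) powr (-s/2) = (3 * lsize i) powr (-s)"
      by (simp only: powr_powr) simp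
    also have "(3 * lsize i) powr (-s) = 3 powr (-s) * lsize i powr (-s)"
      using lsize_ge_1[of i] by (simp add: powr_mult)
    finally have "3 powr s * (3 powr (-s) * lsize i powr (-s)) \<le> 3 powr s * (a powr (-s/2) * b powr (-s/2))"
      using ab by (intro mult_left_mono) (auto simp: powr_mult)
    also have "3 powr s * (3 powr (-s) * lsize i powr (-s)) = lsize i powr (-s)"
      by (simp add: powr_minus)
    finally show "norm (lsize i powr (-s)) \<le> 3 powr s * (case lat i of (m, n) \<Rightarrow> (1 + (real_of_int m)\<^sup>2) powr (-s/2) * (1 + (real_of_int n)\<^sup>2) powr (-s/2))"
      by (simp add: v a_def b_def)
  qed
qed

lemma quad_lat_pos: "z \<in> UHP \<Longrightarrow> quad z (lat i) > 0"
  by (rule quad_pos[OF _ lat_nonzero])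

lemma lsize_le_quad: "z \<in> UHP \<Longrightarrow> lsize i \<le> 5 * hgt z ^ 3 * quad z (lat i)"
  unfolding lsize_def by (metis quad_lower_bound prod.collapse)

definition lin :: "complex \<Rightarrow> int \<times> int \<Rightarrow> complex" where
  "lin z v = of_int (fst v) * z + of_int (snd v)"

lemma of_real_quad: "of_real (quad z v) = lin z v * cnj (lin z v) * inverse (of_real (Im z))"
  unfolding quad_def lin_def[symmetric] complex_norm_square[symmetric] by (simp add: divide_inverse)

lemma lin_nonzero: "z \<in> UHP \<Longrightarrow> v \<noteq> (0, 0) \<Longrightarrow> lin z v \<noteq> 0"
  using quad_pos[of z v] by (auto simp: quad_def lin_def)

text \<open>The three parameters make the family closed under both Wirtinger derivatives:
  \<open>a\<close> counts powers of the imaginary part, \<open>j\<close> is half the weight, and the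
  profile \<open>\<phi>\<close> only changes by an Euler operator. Powers give the Eisenstein
  series, incomplete Gamma functions its continuation.\<close>

definition lterm :: "int \<Rightarrow> int \<Rightarrow> (real \<Rightarrow> complex) \<Rightarrow> complex \<Rightarrow> int \<times> int \<Rightarrow> complex" where
  "lterm a j \<phi> z v = of_real (Im z) powi a * (cnj (lin z v) / lin z v) powi j * \<phi> (quad z v)"

definition lsum :: "int \<Rightarrow> int \<Rightarrow> (real \<Rightarrow> complex) \<Rightarrow> complex \<Rightarrow> complex" where
  "lsum a j \<phi> z = (\<Sum>i. lterm a j \<phi> z (lat i))"

text \<open>
  The argument is the derivative of the function to which the operator \<open>q * d/dq\<close> is applied.
\<close>
definition euler_op :: "(real \<Rightarrow> complex) \<Rightarrow> real \<Rightarrow> complex" where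
  "euler_op \<phi>' q = of_real q * \<phi>' q"

text \<open>Differentiation brings down the coordinate m of the vector, which would leave the
  family. Since N - cnj N equals m times twice the imaginary part times i, m / N is expressed
  through U = cnj N / N and the imaginary part, and m disappears.\<close>

lemma wderiv_lterm:
  assumes z: "z \<in> UHP" and v: "v \<noteq> (0, 0)"
    and d: "(\<phi> has_vector_derivative \<phi>' (quad z v)) (at (quad z v))"
  shows "wderiv (\<lambda>z. lterm a j \<phi> z v)
    (1 / (2 * \<i>) * (of_int (a - j) * lterm (a - 1) j \<phi> z v + of_int j * lterm (a - 1) (j + 1) \<phi> z v - lterm (a - 1) (j + 1) (euler_op \<phi>') z v))
    (1 / (2 * \<i>) * (lterm (a - 1) (j - 1) (euler_op \<phi>') z v - of_int (a + j) * lterm (a - 1) j \<phi> z v + of_int j * lterm (a - 1) (j - 1) \<phi> z v)) z"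
proof -
  define N where "N = lin z v"
  define Y where "Y = complex_of_real (Im z)"
  define m where "m = complex_of_int (fst v)"
  have N0: "N \<noteq> 0" using lin_nonzero[OF z v] by (simp add: N_def)
  have Y0: "Y \<noteq> 0" using z by (simp add: Y_def UHP_def)
  have c0: "cnj N \<noteq> 0" using N0 by simp
  have mY: "2 * \<i> * Y * m = N - cnj N"
    by (simp add: N_def lin_def Y_def m_def complex_eq_iff)
  hence m: "m = (N - cnj N) / (2 * \<i> * Y)" using Y0 by (simp add: field_simps)
  have wN: "wderiv (\<lambda>z. lin z v) m 0 z"
    unfolding lin_def m_def by (rule wderiv_eq[OF wderiv_add[OF wderiv_cmult[OF wderiv_ident] wderiv_const]]) auto
  have wcN: "wderiv (\<lambda>z. cnj (lin z v)) 0 m z"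
    by (rule wderiv_eq[OF wderiv_cnj[OF wN]]) (auto simp: m_def)
  have inv: "(inverse has_field_derivative - (inverse w * inverse w)) (at w)" if "w \<noteq> 0" for w :: complex
    using DERIV_inverse[OF that] by (simp add: power2_eq_square)
  have pow: "((\<lambda>w. w powi a) has_field_derivative of_int a * w powi (a - 1)) (at w)" if "w \<noteq> 0" for w :: complex and a
    using that by (auto intro!: derivative_eq_intros)
  have wiN: "wderiv (\<lambda>z. inverse (lin z v)) (- (inverse N * inverse N) * m) (- (inverse N * inverse N) * 0) z"
    using wderiv_compose_field[OF wN inv] N0 by (simp add: N_def)
  have wiY: "wderiv (\<lambda>z. inverse (of_real (Im z))) (- (inverse Y * inverse Y) * (1 / (2 * \<i>))) (- (inverse Y * inverse Y) * - (1 / (2 * \<i>))) z"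
    using wderiv_compose_field[OF wderiv_Im inv, of z] Y0 by (simp add: Y_def)
  define U where "U = cnj N * inverse N"
  have U0: "U \<noteq> 0" using N0 by (simp add: U_def)
  have "wderiv (\<lambda>z. cnj (lin z v) * inverse (lin z v)) (- U * m / N) (m / N) z"
    by (rule wderiv_eq[OF wderiv_mult[OF wcN wiN]]) (auto simp: N_def[symmetric] U_def field_simps)
  hence wU: "wderiv (\<lambda>z. (cnj (lin z v) / lin z v) powi j) (of_int j * U powi (j - 1) * (- U * m / N)) (of_int j * U powi (j - 1) * (m / N)) z"
    unfolding divide_inverse[of "cnj _"]
    by (rule wderiv_compose_field) (use pow[OF U0] in \<open>simp add: U_def N_def\<close>)
  have wY: "wderiv (\<lambda>z. of_real (Im z) powi a) (of_int a * Y powi (a - 1) * (1 / (2 * \<i>))) (of_int a * Y powi (a - 1) * - (1 / (2 * \<i>))) z"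
    by (rule wderiv_compose_field[OF wderiv_Im]) (use pow[OF Y0] in \<open>simp add: Y_def\<close>)
  define Q where "Q = complex_of_real (quad z v)"
  have Q: "Q = N * cnj N * inverse Y"
    unfolding Q_def N_def Y_def by (rule of_real_quad)
  have mN: "m / N = (1 - U) / (2 * \<i> * Y)"
    unfolding m U_def using N0 Y0 by (simp add: field_simps)
  \<comment> \<open>\<open>A1\<close> to \<open>A4\<close> are the rational identities behind the
    derivatives of \<open>quad\<close> and of the whole term, isolated over free variables.\<close>
  have A1: "((N - c) / (k * Y) * c + N * 0) * inverse Y + N * c * (- (inverse Y * inverse Y) * (1 / k)) = - (N * c * inverse Y * (c * inverse N) / (k * Y))"
    if "N \<noteq> 0" "Y \<noteq> 0" "k \<noteq> 0" for N c Y k :: complex using that by (simp add: field_simps)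
  have A2: "(0 * c + N * ((N - c) / (k * Y))) * inverse Y + N * c * (- (inverse Y * inverse Y) * - (1 / k)) = N * c * inverse Y / (c * inverse N) / (k * Y)"
    if "N \<noteq> 0" "c \<noteq> 0" "Y \<noteq> 0" "k \<noteq> 0" for N c Y k :: complex using that by (simp add: field_simps)
  have "wderiv (\<lambda>z. lin z v * cnj (lin z v) * inverse (of_real (Im z))) (- (Q * U / (2 * \<i> * Y))) (Q / U / (2 * \<i> * Y)) z"
  proof (rule wderiv_eq[OF wderiv_mult[OF wderiv_mult[OF wN wcN] wiY]], unfold N_def[symmetric])
    show "(m * cnj N + N * 0) * inverse (of_real (Im z)) + N * cnj N * (- (inverse Y * inverse Y) * (1 / (2 * \<i>))) = - (Q * U / (2 * \<i> * Y))"
      unfolding Q U_def m Y_def[symmetric] using N0 Y0 by (rule A1) simp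
    show "(0 * cnj N + N * m) * inverse (of_real (Im z)) + N * cnj N * (- (inverse Y * inverse Y) * - (1 / (2 * \<i>))) = Q / U / (2 * \<i> * Y)"
      unfolding Q U_def m Y_def[symmetric] using N0 c0 Y0 by (rule A2) simp
  qed
  also have "(\<lambda>z. lin z v * cnj (lin z v) * inverse (of_real (Im z))) = (\<lambda>z. of_real (quad z v))"
    by (simp only: of_real_quad)
  finally have wQ: "wderiv (\<lambda>z. \<phi> (quad z v)) (\<phi>' (quad z v) * (- (Q * U / (2 * \<i> * Y)))) (\<phi>' (quad z v) * (Q / U / (2 * \<i> * Y))) z"
    by (rule wderiv_compose_real) (rule d)
  have A3: "(a * p * (1 / k) * (u * U) + p * Y * (j * u * (- U * ((1 - U) / (k * Y))))) * c + p * Y * (u * U) * (d * - (Q * U / (k * Y))) =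
      1 / k * ((a - j) * (p * (u * U) * c) + j * (p * (u * U * U) * c) - p * (u * U * U) * (Q * d))"
    if "Y \<noteq> 0" "k \<noteq> 0" for a j p k u U Y c d Q :: complex using that by (simp add: field_simps)
  have A4: "(a * p * - (1 / k) * (u * U) + p * Y * (j * u * ((1 - U) / (k * Y)))) * c + p * Y * (u * U) * (d * (Q / U / (k * Y))) =
      1 / k * (p * u * (Q * d) - (a + j) * (p * (u * U) * c) + j * (p * u * c))"
    if "Y \<noteq> 0" "U \<noteq> 0" "k \<noteq> 0" for a j p k u U Y c d Q :: complex using that by (simp add: field_simps)
  define p where "p = Y powi (a - 1)"
  define u where "u = U powi (j - 1)"
  have pa: "Y powi a = p * Y" using Y0 power_int_add_1[of Y "a - 1"] by (simp add: p_def)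
  have uj: "U powi j = u * U" using U0 power_int_add_1[of U "j - 1"] by (simp add: u_def)
  have uj1: "U powi (j + 1) = u * U * U" using U0 power_int_add_1[of U j] uj by simp
  have Uv: "cnj (lin z v) / lin z v = U" by (simp add: U_def N_def divide_inverse)
  show ?thesis
    unfolding lterm_def
  proof (rule wderiv_eq[OF wderiv_mult[OF wderiv_mult[OF wY wU] wQ]], unfold Uv Y_def[symmetric] p_def[symmetric] u_def[symmetric] pa uj uj1 euler_op_def Q_def[symmetric])
    show "(of_int a * p * (1 / (2 * \<i>)) * (u * U) + p * Y * (of_int j * u * (- U * m / N))) * \<phi> (quad z v) +
       p * Y * (u * U) * (\<phi>' (quad z v) * - (Q * U / (2 * \<i> * Y))) =
      1 / (2 * \<i>) * (of_int (a - j) * (p * (u * U) * \<phi> (quad z v)) + of_int j * (p * (u * U * U) * \<phi> (quad z v)) - p * (u * U * U) * (Q * \<phi>' (quad z v)))"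
      unfolding times_divide_eq_right[of "-U", symmetric] mN of_int_diff using Y0 by (rule A3) simp
    show "(of_int a * p * - (1 / (2 * \<i>)) * (u * U) + p * Y * (of_int j * u * (m / N))) * \<phi> (quad z v) +
       p * Y * (u * U) * (\<phi>' (quad z v) * (Q / U / (2 * \<i> * Y))) =
      1 / (2 * \<i>) * (p * u * (Q * \<phi>' (quad z v)) - of_int (a + j) * (p * (u * U) * \<phi> (quad z v)) + of_int j * (p * u * \<phi> (quad z v)))"
      unfolding mN of_int_add using Y0 U0 by (rule A4) simp
  qed
qed

text \<open>The bound holds on all of q > 0, also near 0, because \<open>quad z v\<close> becomes
  arbitrarily small as z varies. Lattice sums converge once M > 1.\<close>

definition decays :: "(real \<Rightarrow> complex) \<Rightarrow> real \<Rightarrow> bool" where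
  "decays \<phi> M \<longleftrightarrow> (\<exists>C. \<forall>q>0. norm (\<phi> q) \<le> C * q powr (-M))"

lemma quad_powr_bound:
  assumes z: "z \<in> UHP" and B: "hgt z \<le> B" and M: "M \<ge> 0"
  shows "quad z (lat i) powr (-M) \<le> (5 * B ^ 3) powr M * lsize i powr (-M)"
proof -
  have q: "quad z (lat i) > 0" by (rule quad_lat_pos[OF z])
  have B1: "B \<ge> 1" using hgt_bounds(1)[OF z] B by linarith
  have l: "lsize i > 0" using lsize_ge_1[of i] by linarith
  have "lsize i \<le> 5 * hgt z ^ 3 * quad z (lat i)" by (rule lsize_le_quad[OF z])
  also have "\<dots> \<le> 5 * B ^ 3 * quad z (lat i)"
    using q B hgt_bounds(1)[OF z] by (intro mult_right_mono mult_left_mono power_mono) auto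
  finally have "lsize i / (5 * B ^ 3) \<le> quad z (lat i)" using B1 by (simp add: field_simps)
  hence "quad z (lat i) powr (-M) \<le> (lsize i / (5 * B ^ 3)) powr (-M)"
    using l B1 M by (intro powr_mono2') auto
  also have "\<dots> = (5 * B ^ 3) powr M * lsize i powr (-M)"
    using l B1 by (simp add: powr_divide powr_minus divide_simps)
  finally show ?thesis .
qed

lemma powi_Im_bound:
  assumes z: "z \<in> UHP" and B: "hgt z \<le> B"
  shows "norm (complex_of_real (Im z) powi a) \<le> B powr \<bar>of_int a\<bar>"
proof -
  have y: "Im z > 0" using z by (simp add: UHP_def)
  have B1: "B \<ge> 1" "Im z \<le> B" "1 / Im z \<le> B" using hgt_bounds[OF z] B by linarith+
  have "norm (complex_of_real (Im z) powi a) = Im z powr of_int a"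
    using y by (simp add: norm_power_int powr_real_of_int')
  also have "\<dots> \<le> B powr \<bar>of_int a\<bar>"
  proof (cases "a \<ge> 0")
    case True
    thus ?thesis using y B1 by (auto intro: powr_mono2)
  next
    case False
    have "Im z powr of_int a = (1 / Im z) powr (- of_int a)"
      using y by (simp add: powr_divide powr_minus divide_simps)
    also have "\<dots> \<le> B powr (- of_int a)" using y B1 False by (intro powr_mono2) auto
    finally show ?thesis using False by simp
  qed
  finally show ?thesis .
qed

lemma lterm_bound:
  assumes z: "z \<in> UHP" and B: "hgt z \<le> B" and M: "M \<ge> 0" and C: "\<And>q. q > 0 \<Longrightarrow> norm (\<phi> q) \<le> C * q powr (-M)"
  shows "norm (lterm a j \<phi> z (lat i)) \<le> B powr \<bar>of_int a\<bar> * (C * ((5 * B ^ 3) powr M * lsize i powr (-M)))"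
proof -
  have N: "lin z (lat i) \<noteq> 0" by (rule lin_nonzero[OF z lat_nonzero])
  have C0: "C \<ge> 0" using order_trans[OF norm_ge_zero C[of 1]] by simp
  have "norm (lterm a j \<phi> z (lat i)) = norm (complex_of_real (Im z) powi a) * norm (\<phi> (quad z (lat i)))"
    using N by (simp add: lterm_def norm_mult norm_power_int norm_divide)
  also have "\<dots> \<le> B powr \<bar>of_int a\<bar> * (C * ((5 * B ^ 3) powr M * lsize i powr (-M)))"
  proof (rule mult_mono[OF powi_Im_bound[OF z B]])
    have "norm (\<phi> (quad z (lat i))) \<le> C * quad z (lat i) powr (-M)"
      by (rule C[OF quad_lat_pos[OF z]])
    also have "\<dots> \<le> C * ((5 * B ^ 3) powr M * lsize i powr (-M))"
      by (intro mult_left_mono quad_powr_bound z B M C0)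
    finally show "norm (\<phi> (quad z (lat i))) \<le> C * ((5 * B ^ 3) powr M * lsize i powr (-M))" .
  qed auto
  finally show ?thesis .
qed

lemma summable_lterm_bound:
  "M > 1 \<Longrightarrow> summable (\<lambda>i. B' * (C * (D * lsize i powr (-M))))"
  by (intro summable_mult summable_lsize)

lemma summable_norm_lterm:
  assumes z: "z \<in> UHP" and M: "M > 1" and d: "decays \<phi> M"
  shows "summable (\<lambda>i. norm (lterm a j \<phi> z (lat i)))"
proof -
  obtain C where C: "\<And>q. q > 0 \<Longrightarrow> norm (\<phi> q) \<le> C * q powr (-M)"
    using d by (auto simp: decays_def)
  have "M \<ge> 0" using M by simp
  show ?thesis
    by (rule summable_comparison_test[OF _ summable_lterm_bound[OF M]], intro exI[of _ 0] allI impI)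
       (use lterm_bound[OF z order.refl \<open>M \<ge> 0\<close> C] in auto)
qed

lemma summable_lterm: "z \<in> UHP \<Longrightarrow> M > 1 \<Longrightarrow> decays \<phi> M \<Longrightarrow> summable (\<lambda>i. lterm a j \<phi> z (lat i))"
  by (rule summable_norm_cancel[OF summable_norm_lterm])

text \<open>The constant of \<open>\<phi>\<close> enters linearly and nothing else depends on
  \<open>\<phi>\<close>, so bounds uniform in a parameter are inherited by the lattice sum. The 3 in
  the exponent is the cube in \<open>quad_lower_bound\<close>.\<close>

lemma lsum_bound:
  assumes z: "z \<in> UHP" and M: "M > 1" and C: "\<And>q. q > 0 \<Longrightarrow> norm (\<phi> q) \<le> C * q powr (-M)"
  shows "norm (lsum a j \<phi> z) \<le> C * (5 powr M * (\<Sum>i. lsize i powr (-M))) * hgt z powr (\<bar>of_int a\<bar> + 3 * M)"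
proof -
  have h: "hgt z \<ge> 1" using hgt_bounds(1)[OF z] .
  have d: "decays \<phi> M" using C by (auto simp: decays_def)
  have M0: "M \<ge> 0" using M by simp
  have "norm (lsum a j \<phi> z) \<le> (\<Sum>i. norm (lterm a j \<phi> z (lat i)))"
    unfolding lsum_def by (rule summable_norm[OF summable_norm_lterm[OF z M d]])
  also have "\<dots> \<le> (\<Sum>i. hgt z powr \<bar>of_int a\<bar> * (C * ((5 * hgt z ^ 3) powr M * lsize i powr (-M))))"
    by (intro suminf_le lterm_bound z M0 C order.refl summable_norm_lterm[OF z M d] summable_lterm_bound[OF M])
  also have "\<dots> = hgt z powr \<bar>of_int a\<bar> * (C * ((5 * hgt z ^ 3) powr M * (\<Sum>i. lsize i powr (-M))))"
    using summable_lsize[OF M] by (simp add: suminf_mult summable_mult)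
  also have "(5 * hgt z ^ 3) powr M = 5 powr M * hgt z powr (3 * M)"
  proof -
    have "hgt z ^ 3 = hgt z powr 3" using h by simp
    hence "(hgt z ^ 3) powr M = hgt z powr (3 * M)" by (simp only: powr_powr)
    thus ?thesis using h by (simp add: powr_mult)
  qed
  finally show ?thesis by (simp add: powr_add mult_ac)
qed

lemma hgt_ball:
  assumes z0: "z0 \<in> UHP" and z: "z \<in> ball z0 (Im z0 / 2)"
  shows "z \<in> UHP" "hgt z \<le> 1 + norm z0 + Im z0 + 2 / Im z0"
proof -
  have y0: "Im z0 > 0" using z0 by (simp add: UHP_def)
  have d: "norm (z - z0) < Im z0 / 2" using z by (simp add: dist_norm norm_minus_commute)
  have "\<bar>Im z - Im z0\<bar> \<le> norm (z - z0)" using abs_Im_le_cmod[of "z - z0"] by simp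
  with d have y: "Im z > Im z0 / 2" by linarith
  thus "z \<in> UHP" using y0 by (simp add: UHP_def)
  have "1 / Im z \<le> 1 / (Im z0 / 2)" using y y0 by (intro divide_left_mono) auto
  moreover have "norm z \<le> norm z0 + Im z0"
    using norm_triangle_sub[of z z0] d y0 by simp
  ultimately show "hgt z \<le> 1 + norm z0 + Im z0 + 2 / Im z0" by (simp add: hgt_def)
qed

lemma suminf_lin3:
  fixes f g h :: "nat \<Rightarrow> complex"
  assumes "summable f" "summable g" "summable h"
  shows "(\<Sum>i. c * (a * f i + b * g i - h i)) = c * (a * suminf f + b * suminf g - suminf h)"
  using assms by (simp add: suminf_mult suminf_add[symmetric] suminf_diff[symmetric] summable_add summable_diff summable_mult)

lemma suminf_lin3':
  fixes f g h :: "nat \<Rightarrow> complex"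
  assumes "summable f" "summable g" "summable h"
  shows "(\<Sum>i. c * (h i - a * f i + b * g i)) = c * (suminf h - a * suminf f + b * suminf g)"
  using assms by (simp add: suminf_mult suminf_add[symmetric] suminf_diff[symmetric] summable_add summable_diff summable_mult)

lemma wderiv_lsum:
  assumes z: "z0 \<in> UHP" and M: "M > 1" and d: "\<And>q. q > 0 \<Longrightarrow> (\<phi> has_vector_derivative \<phi>' q) (at q)"
    and b: "decays \<phi> M" and b': "decays (euler_op \<phi>') M"
  shows "wderiv (lsum a j \<phi>)
    (1 / (2 * \<i>) * (of_int (a - j) * lsum (a - 1) j \<phi> z0 + of_int j * lsum (a - 1) (j + 1) \<phi> z0 - lsum (a - 1) (j + 1) (euler_op \<phi>') z0))
    (1 / (2 * \<i>) * (lsum (a - 1) (j - 1) (euler_op \<phi>') z0 - of_int (a + j) * lsum (a - 1) j \<phi> z0 + of_int j * lsum (a - 1) (j - 1) \<phi> z0)) z0"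
proof -
  obtain C where C: "\<And>q. q > 0 \<Longrightarrow> norm (\<phi> q) \<le> C * q powr (-M)"
    using b by (auto simp: decays_def)
  obtain C' where C': "\<And>q. q > 0 \<Longrightarrow> norm (euler_op \<phi>' q) \<le> C' * q powr (-M)"
    using b' by (auto simp: decays_def)
  have M0: "M \<ge> 0" using M by simp
  \<comment> \<open>Bounds \<open>hgt\<close> on the ball of radius \<open>Im z0 / 2\<close>, so
    that one summable majorant serves for all points of the ball.\<close>
  define B where "B = 1 + norm z0 + Im z0 + 2 / Im z0"
  define K where "K = (\<lambda>C i. B powr \<bar>of_int (a - 1)\<bar> * (C * ((5 * B ^ 3) powr M * lsize i powr (-M))))"
  have K1: "norm (lterm (a - 1) j' \<phi> z (lat i)) \<le> K C i" if "z \<in> ball z0 (Im z0 / 2)" for z i j'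
    unfolding K_def by (rule lterm_bound[OF hgt_ball(1)[OF z that] _ M0 C]) (use hgt_ball(2)[OF z that] in \<open>auto simp: B_def\<close>)
  have K2: "norm (lterm (a - 1) j' (euler_op \<phi>') z (lat i)) \<le> K C' i" if "z \<in> ball z0 (Im z0 / 2)" for z i j'
    unfolding K_def by (rule lterm_bound[OF hgt_ball(1)[OF z that] _ M0 C']) (use hgt_ball(2)[OF z that] in \<open>auto simp: B_def\<close>)
  define L where "L = (\<lambda>i. (\<bar>of_int (a - j)\<bar> + \<bar>of_int (a + j)\<bar> + \<bar>of_int j\<bar>) * K C i + K C' i)"
  have L: "summable L" unfolding L_def K_def
    by (intro summable_add summable_mult summable_lsize M)
  have K0: "K C i \<ge> 0" for i
    using order_trans[OF norm_ge_zero K1[of z0 0 i]] z by (simp add: UHP_def)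
  have sl: "summable (\<lambda>i. lterm a j \<phi> z0 (lat i))" for a j
    by (rule summable_lterm[OF z M b])
  have sl': "summable (\<lambda>i. lterm a j (euler_op \<phi>') z0 (lat i))" for a j
    by (rule summable_lterm[OF z M b'])
  have n2: "norm (1 / (2 * \<i>)) \<le> 1" by (simp add: norm_divide norm_mult)
  have "wderiv (\<lambda>z. \<Sum>i. lterm a j \<phi> z (lat i))
    (\<Sum>i. 1 / (2 * \<i>) * (of_int (a - j) * lterm (a - 1) j \<phi> z0 (lat i) + of_int j * lterm (a - 1) (j + 1) \<phi> z0 (lat i) - lterm (a - 1) (j + 1) (euler_op \<phi>') z0 (lat i)))
    (\<Sum>i. 1 / (2 * \<i>) * (lterm (a - 1) (j - 1) (euler_op \<phi>') z0 (lat i) - of_int (a + j) * lterm (a - 1) j \<phi> z0 (lat i) + of_int j * lterm (a - 1) (j - 1) \<phi> z0 (lat i))) z0"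
  proof (rule wderiv_suminf[where M = L and r = "Im z0 / 2"])
    fix i z assume zb: "z \<in> ball z0 (Im z0 / 2)"
    note zU = hgt_ball(1)[OF z zb]
    show "wderiv (\<lambda>z. lterm a j \<phi> z (lat i))
      (1 / (2 * \<i>) * (of_int (a - j) * lterm (a - 1) j \<phi> z (lat i) + of_int j * lterm (a - 1) (j + 1) \<phi> z (lat i) - lterm (a - 1) (j + 1) (euler_op \<phi>') z (lat i)))
      (1 / (2 * \<i>) * (lterm (a - 1) (j - 1) (euler_op \<phi>') z (lat i) - of_int (a + j) * lterm (a - 1) j \<phi> z (lat i) + of_int j * lterm (a - 1) (j - 1) \<phi> z (lat i))) z"
      by (rule wderiv_lterm, rule zU, rule lat_nonzero, rule d, rule quad_lat_pos, rule zU)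
    have "norm (1 / (2 * \<i>) * (of_int (a - j) * lterm (a - 1) j \<phi> z (lat i) + of_int j * lterm (a - 1) (j + 1) \<phi> z (lat i) - lterm (a - 1) (j + 1) (euler_op \<phi>') z (lat i)))
       \<le> 1 * (\<bar>of_int (a - j)\<bar> * K C i + \<bar>of_int j\<bar> * K C i + K C' i)"
      unfolding norm_mult
      by (intro mult_mono n2 norm_triangle_le_diff norm_triangle_le add_mono K2 zb)
         (auto simp: norm_mult simp del: of_int_diff of_int_add intro!: mult_left_mono K1 zb)
    also have "\<dots> \<le> L i"
      using K0[of i] by (simp add: L_def algebra_simps)
    finally show "norm (1 / (2 * \<i>) * (of_int (a - j) * lterm (a - 1) j \<phi> z (lat i) + of_int j * lterm (a - 1) (j + 1) \<phi> z (lat i) - lterm (a - 1) (j + 1) (euler_op \<phi>') z (lat i))) \<le> L i" .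
    have "norm (1 / (2 * \<i>) * (lterm (a - 1) (j - 1) (euler_op \<phi>') z (lat i) - of_int (a + j) * lterm (a - 1) j \<phi> z (lat i) + of_int j * lterm (a - 1) (j - 1) \<phi> z (lat i)))
       \<le> 1 * (K C' i + \<bar>of_int (a + j)\<bar> * K C i + \<bar>of_int j\<bar> * K C i)"
      unfolding norm_mult
      by (intro mult_mono n2 norm_triangle_le_diff norm_triangle_le add_mono K2 zb)
         (auto simp: norm_mult simp del: of_int_diff of_int_add intro!: mult_left_mono K1 zb)
    also have "\<dots> \<le> L i"
      using K0[of i] by (simp add: L_def algebra_simps)
    finally show "norm (1 / (2 * \<i>) * (lterm (a - 1) (j - 1) (euler_op \<phi>') z (lat i) - of_int (a + j) * lterm (a - 1) j \<phi> z (lat i) + of_int j * lterm (a - 1) (j - 1) \<phi> z (lat i))) \<le> L i" .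
    show "summable (\<lambda>i. lterm a j \<phi> z (lat i))"
      by (rule summable_lterm[OF zU M b])
  qed (use z L in \<open>auto simp: UHP_def\<close>)
  thus ?thesis
    unfolding suminf_lin3[OF sl sl sl'] suminf_lin3'[OF sl sl sl'] lsum_def[symmetric] 
    by (simp add: lsum_def[abs_def])
qed

lemma lsum_cong:
  assumes "z \<in> UHP" "\<And>q. q > 0 \<Longrightarrow> \<phi> q = \<phi>' q"
  shows "lsum a j \<phi> z = lsum a j \<phi>' z"
  unfolding lsum_def lterm_def using assms(2) quad_lat_pos[OF assms(1)] by simp

lemma lsum_lin:
  assumes "z \<in> UHP" "M > 1" "decays \<phi> M" "decays \<phi>' M"
  shows "lsum a j (\<lambda>q. c * \<phi> q + d * \<phi>' q) z = c * lsum a j \<phi> z + d * lsum a j \<phi>' z"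
proof -
  have "lsum a j (\<lambda>q. c * \<phi> q + d * \<phi>' q) z = (\<Sum>i. c * lterm a j \<phi> z (lat i) + d * lterm a j \<phi>' z (lat i))"
    by (simp add: lsum_def lterm_def algebra_simps)
  also have "\<dots> = c * lsum a j \<phi> z + d * lsum a j \<phi>' z"
    using summable_lterm[OF assms(1,2,3), of a j] summable_lterm[OF assms(1,2,4), of a j]
    by (simp add: lsum_def suminf_add[symmetric] suminf_mult summable_mult)
  finally show ?thesis .
qed

lemma lsum_cmult:
  assumes "z \<in> UHP" "M > 1" "decays \<phi> M"
  shows "lsum a j (\<lambda>q. c * \<phi> q) z = c * lsum a j \<phi> z"
  using lsum_lin[OF assms(1,2,3,3), of a j c 0] by simp

lemma lsum_Im_mult:
  assumes "z \<in> UHP" "M > 1" "decays \<phi> M"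
  shows "of_real (Im z) powi b * lsum a j \<phi> z = lsum (b + a) j \<phi> z"
proof -
  have y: "Im z \<noteq> 0" using assms(1) by (simp add: UHP_def)
  have "of_real (Im z) powi b * lsum a j \<phi> z = (\<Sum>i. of_real (Im z) powi b * lterm a j \<phi> z (lat i))"
    unfolding lsum_def using summable_lterm[OF assms, of a j] by (simp add: suminf_mult)
  also have "\<dots> = lsum (b + a) j \<phi> z"
    using y by (simp add: lsum_def lterm_def power_int_add mult_ac)
  finally show ?thesis .
qed

section \<open>Incomplete Gamma integrals and the Mellin transform of theta\<close>

text \<open>The mean value inequality on the ball bounds the difference quotients by the majorant of
  the derivative, and dominated convergence applies along every sequence tending to 0.\<close>

lemma has_field_derivative_LINT:
  fixes f :: "complex \<Rightarrow> 'a \<Rightarrow> complex"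
  assumes r: "r > 0"
    and d: "\<And>x t. x \<in> ball x0 r \<Longrightarrow> t \<in> space M \<Longrightarrow> ((\<lambda>x. f x t) has_field_derivative f' x t) (at x)"
    and b: "\<And>x t. x \<in> ball x0 r \<Longrightarrow> t \<in> space M \<Longrightarrow> norm (f' x t) \<le> B t"
    and B: "integrable M B"
    and i: "\<And>x. x \<in> ball x0 r \<Longrightarrow> integrable M (f x)"
    and m: "f' x0 \<in> borel_measurable M"
  shows "((\<lambda>x. LINT t|M. f x t) has_field_derivative (LINT t|M. f' x0 t)) (at x0)"
  unfolding DERIV_def
proof (subst tendsto_at_iff_sequentially, intro allI impI)
  fix X :: "nat \<Rightarrow> complex"
  assume X: "\<forall>i. X i \<in> UNIV - {0}" and X0: "X \<longlonglongrightarrow> 0"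
  have x0: "x0 \<in> ball x0 r" using r by simp
  have ev: "\<forall>\<^sub>F n in sequentially. x0 + X n \<in> ball x0 r"
    using tendstoD[OF X0 r] by eventually_elim (simp add: dist_norm)
  then obtain n0 where n0: "\<And>n. n \<ge> n0 \<Longrightarrow> x0 + X n \<in> ball x0 r"
    by (auto simp: eventually_sequentially)
  have "(\<lambda>n. LINT t|M. (f (x0 + X (n + n0)) t - f x0 t) / X (n + n0)) \<longlonglongrightarrow> (LINT t|M. f' x0 t)"
  proof (rule integral_dominated_convergence)
    show "integrable M B" by (rule B)
    show "f' x0 \<in> borel_measurable M" by (rule m)
    show "(\<lambda>t. (f (x0 + X (n + n0)) t - f x0 t) / X (n + n0)) \<in> borel_measurable M" for n
      using i[OF n0[of "n + n0"]] i[OF x0] by (intro borel_measurable_divide borel_measurable_diff) auto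
    have XX: "(\<lambda>n. X (n + n0)) \<longlonglongrightarrow> 0" using X0 by (rule LIMSEQ_ignore_initial_segment)
    show "AE t in M. (\<lambda>n. (f (x0 + X (n + n0)) t - f x0 t) / X (n + n0)) \<longlonglongrightarrow> f' x0 t"
    proof (rule AE_I2)
      fix t assume t: "t \<in> space M"
      have "((\<lambda>h. (f (x0 + h) t - f x0 t) / h) \<longlongrightarrow> f' x0 t) (at 0)"
        using d[OF x0 t] by (simp add: DERIV_def)
      thus "(\<lambda>n. (f (x0 + X (n + n0)) t - f x0 t) / X (n + n0)) \<longlonglongrightarrow> f' x0 t"
        unfolding tendsto_at_iff_sequentially using X XX by (auto simp: o_def)
    qed
    show "AE t in M. norm ((f (x0 + X (n + n0)) t - f x0 t) / X (n + n0)) \<le> B t" for n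
    proof (rule AE_I2)
      fix t assume t: "t \<in> space M"
      have "norm (f (x0 + X (n + n0)) t - f x0 t) \<le> B t * norm (x0 + X (n + n0) - x0)"
      proof (rule field_differentiable_bound[of "ball x0 r" _ "\<lambda>x. f' x t"])
        show "((\<lambda>x. f x t) has_field_derivative f' x t) (at x within ball x0 r)" if "x \<in> ball x0 r" for x
          by (rule has_field_derivative_at_within[OF d[OF that t]])
        show "norm (f' x t) \<le> B t" if "x \<in> ball x0 r" for x
          by (rule b[OF that t])
      qed (use n0[of "n + n0"] x0 in auto)
      thus "norm ((f (x0 + X (n + n0)) t - f x0 t) / X (n + n0)) \<le> B t"
        using X by (simp add: norm_divide divide_simps)
    qed
  qed
  also have "(\<lambda>n. LINT t|M. (f (x0 + X (n + n0)) t - f x0 t) / X (n + n0)) = 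
     (\<lambda>n. ((LINT t|M. f (x0 + X (n + n0)) t) - (LINT t|M. f x0 t)) / X (n + n0))"
    using i[OF n0] i[OF x0] by (intro ext) (simp add: Bochner_Integration.integral_diff)
  finally have "(\<lambda>n. ((LINT t|M. f (x0 + X n) t) - (LINT t|M. f x0 t)) / X n) \<longlonglongrightarrow> (LINT t|M. f' x0 t)"
    by (rule LIMSEQ_offset)
  thus "((\<lambda>h. ((LINT t|M. f (x0 + h) t) - (LINT t|M. f x0 t)) / h) \<circ> X) \<longlonglongrightarrow> (LINT t|M. f' x0 t)"
    by (simp add: o_def)
qed

text \<open>
  The substitution \<open>t = exp u\<close> turns the integral of \<open>t powr (w - 1) * exp (- \<pi> q t)\<close> over \<open>t > 1\<close>
  into one over \<open>u > 0\<close>; the integrand becomes entire in both \<open>w\<close> and \<open>q\<close>, and \<open>t \<mapsto> 1 / t\<close> becomes \<open>u \<mapsto> - u\<close>.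
\<close>
definition Mpos :: "real measure" where "Mpos = restrict_space lborel {0..}"

definition kern :: "complex \<Rightarrow> complex \<Rightarrow> real \<Rightarrow> complex" where
  "kern w q u = exp (w * of_real u - of_real pi * q * of_real (exp u))"

text \<open>For q > 0, (pi q)^w times this is the upper incomplete Gamma function of order w at pi
  q.\<close>

definition psi :: "complex \<Rightarrow> complex \<Rightarrow> complex" where
  "psi w q = (LINT u|Mpos. kern w q u)"

lemma space_Mpos: "space Mpos = {0..}"
  by (simp add: Mpos_def space_restrict_space)

lemma integrable_exp_minus_Mpos: "integrable Mpos (\<lambda>u. exp (- u))" "(LINT u|Mpos. exp (- u)) = 1"
proof -
  have "(\<integral>\<^sup>+ x. ennreal (exp (-x)) * indicator {0..} x \<partial>lborel) = ennreal (0 - (- exp (-0)))"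
  proof (rule nn_integral_FTC_atLeast)
    show "((\<lambda>x. - exp (- x :: real)) \<longlongrightarrow> 0) at_top"
      using tendsto_minus[OF filterlim_compose[OF exp_at_bot filterlim_uminus_at_bot_at_top]] by simp
  qed (auto intro!: derivative_eq_intros)
  also have "(\<integral>\<^sup>+ x. ennreal (exp (-x)) * indicator {0..} x \<partial>lborel) = (\<integral>\<^sup>+ x. ennreal (indicator {0..} x *\<^sub>R exp (-x)) \<partial>lborel)"
    by (intro nn_integral_cong) (auto split: split_indicator)
  finally have I: "(\<integral>\<^sup>+ x. ennreal (indicator {0..} x *\<^sub>R exp (-x)) \<partial>lborel) = ennreal 1" by simp
  have "has_bochner_integral lborel (\<lambda>x. indicator {0..} x *\<^sub>R exp (-x)) (1::real)"
    by (rule has_bochner_integral_nn_integral[OF _ _ _ I]) auto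
  thus "integrable Mpos (\<lambda>u. exp (- u :: real))" "(LINT u|Mpos. exp (- u :: real)) = 1"
    unfolding Mpos_def 
    by (simp_all add: integrable_restrict_space integral_restrict_space has_bochner_integral_iff)
qed

lemma exp_minus_le_fact:
  fixes x :: real
  assumes "x > 0"
  shows "exp (- x) \<le> fact n / x ^ n"
proof -
  have "x ^ n / fact n \<le> exp x"
  proof -
    have s: "(\<lambda>k. x ^ k /\<^sub>R fact k) sums exp x" by (rule exp_converges)
    have "(\<Sum>k\<in>{n}. x ^ k /\<^sub>R fact k) \<le> (\<Sum>k. x ^ k /\<^sub>R fact k)"
      by (rule sum_le_suminf[OF sums_summable[OF s]]) (use assms in auto)
    thus ?thesis using sums_unique[OF s] by (simp add: field_simps)
  qed
  thus ?thesis using assms by (simp add: exp_minus field_simps)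
qed

text \<open>One term of the exponential series turns the doubly exponential decay into
  \<open>exp (- n * u)\<close>; the assumption on Re w leaves exactly \<open>exp (- u)\<close> to
  integrate. The power of \<open>d\<close> in the denominator becomes the decay of
  \<open>psi\<close> in q, of any order n allowed by Re w.\<close>

lemma kern_bound:
  assumes u: "u \<ge> 0" and w: "Re w \<le> real n - 1" and d: "d > 0" "Re q \<ge> d"
  shows "norm (kern w q u) \<le> fact n / (pi * d) ^ n * exp (- u)"
proof -
  have "norm (kern w q u) = exp (Re w * u) * exp (- (pi * Re q * exp u))"
    by (simp add: kern_def norm_exp_eq_Re exp_add[symmetric])
  also have "\<dots> \<le> exp ((real n - 1) * u) * exp (- (pi * d * exp u))"
    using u w d by (intro mult_mono) (auto intro!: mult_right_mono mult_left_mono)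
  also have "\<dots> \<le> exp ((real n - 1) * u) * (fact n / (pi * d * exp u) ^ n)"
    using d by (intro mult_left_mono exp_minus_le_fact) auto
  also have "(pi * d * exp u) ^ n = (pi * d) ^ n * exp (real n * u)"
    by (simp add: power_mult_distrib exp_of_nat_mult)
  also have "exp ((real n - 1) * u) * (fact n / ((pi * d) ^ n * exp (real n * u))) = fact n / (pi * d) ^ n * exp ((real n - 1) * u - real n * u)"
    unfolding exp_diff by simp
  also have "(real n - 1) * u - real n * u = - u" by (simp add: algebra_simps)
  finally show ?thesis .
qed

lemma kern_measurable: "kern w q \<in> borel_measurable Mpos"
  unfolding Mpos_def kern_def
  by (intro measurable_restrict_space1 borel_measurable_continuous_onI continuous_intros) auto

lemma kern_integrable:
  assumes "Re q > 0"
  shows "integrable Mpos (kern w q)"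
proof -
  obtain n where "Re w + 1 \<le> real n"
    using real_arch_simple by blast
  hence n: "Re w \<le> real n - 1" by simp
  show ?thesis
  proof (rule Bochner_Integration.integrable_bound)
    show "integrable Mpos (\<lambda>u. fact n / (pi * Re q) ^ n * exp (- u))"
      by (intro integrable_mult_right integrable_exp_minus_Mpos)
    show "AE u in Mpos. norm (kern w q u) \<le> norm (fact n / (pi * Re q) ^ n * exp (- u))"
    proof (rule AE_I2)
      fix u assume "u \<in> space Mpos"
      hence "u \<ge> 0" by (simp add: space_Mpos)
      from kern_bound[OF this n assms order.refl] 
      show "norm (kern w q u) \<le> norm (fact n / (pi * Re q) ^ n * exp (- u))"
        unfolding real_norm_def by (rule order_trans[OF _ abs_ge_self])
    qed
  qed (rule kern_measurable)
qed

lemma psi_bound: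
  assumes w: "Re w \<le> real n - 1" and q: "Re q > 0"
  shows "(LINT u|Mpos. norm (kern w q u)) \<le> fact n / (pi * Re q) ^ n"
    and "norm (psi w q) \<le> fact n / (pi * Re q) ^ n"
proof -
  have "(LINT u|Mpos. norm (kern w q u)) \<le> (LINT u|Mpos. fact n / (pi * Re q) ^ n * exp (- u))"
  proof (rule integral_mono)
    show "integrable Mpos (\<lambda>u. norm (kern w q u))" using kern_integrable[OF q] by auto
    show "integrable Mpos (\<lambda>u. fact n / (pi * Re q) ^ n * exp (- u))"
      by (intro integrable_mult_right integrable_exp_minus_Mpos)
    show "norm (kern w q u) \<le> fact n / (pi * Re q) ^ n * exp (- u)" if "u \<in> space Mpos" for u
      by (rule kern_bound[OF _ w q]) (use that in \<open>auto simp: space_Mpos\<close>)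
  qed
  also have "\<dots> = fact n / (pi * Re q) ^ n" by (simp add: integrable_exp_minus_Mpos)
  finally show 1: "(LINT u|Mpos. norm (kern w q u)) \<le> fact n / (pi * Re q) ^ n" .
  have "norm (psi w q) \<le> (LINT u|Mpos. norm (kern w q u))"
    unfolding psi_def by (rule integral_norm_bound)
  with 1 show "norm (psi w q) \<le> fact n / (pi * Re q) ^ n" by linarith
qed

text \<open>The factor \<open>exp u\<close> from the chain rule raises w by one, so the functions
  \<open>psi\<close> are closed under d/dq. Complex q makes the criterion for complex parameters
  applicable.\<close>

lemma psi_deriv_q:
  assumes q: "Re q > 0"
  shows "((\<lambda>q. psi w q) has_field_derivative (- pi * psi (w + 1) q)) (at q)"
proof -
  define r where "r = Re q / 2"
  have r: "r > 0" using q by (simp add: r_def)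
  have re: "Re x \<ge> r" if "x \<in> ball q r" for x
    using that abs_Re_le_cmod[of "q - x"] by (simp add: dist_norm r_def)
  obtain n where "Re (w + 1) + 1 \<le> real n"
    using real_arch_simple by blast
  hence n: "Re (w + 1) \<le> real n - 1" by simp
  have "((\<lambda>q. LINT u|Mpos. kern w q u) has_field_derivative (LINT u|Mpos. - pi * kern (w + 1) q u)) (at q)"
  proof (rule has_field_derivative_LINT[OF r, where f' = "\<lambda>q u. - pi * kern (w + 1) q u"])
    fix x u assume x: "x \<in> ball q r" and u: "u \<in> space Mpos"
    show "((\<lambda>q. kern w q u) has_field_derivative - pi * kern (w + 1) x u) (at x)"
      unfolding kern_def
      by (auto intro!: derivative_eq_intros simp: ring_distribs exp_add exp_diff exp_of_real)
    have "norm (kern (w + 1) x u) \<le> fact n / (pi * r) ^ n * exp (- u)"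
      by (rule kern_bound[OF _ n r re[OF x]]) (use u in \<open>simp add: space_Mpos\<close>)
    thus "norm (- pi * kern (w + 1) x u) \<le> pi * (fact n / (pi * r) ^ n * exp (- u))"
      by (simp add: norm_mult del: times_divide_eq_left)
  next
    show "integrable Mpos (kern w x)" if "x \<in> ball q r" for x
      using re[OF that] r by (intro kern_integrable) auto
  qed (intro integrable_mult_right integrable_exp_minus_Mpos borel_measurable_times borel_measurable_const kern_measurable)+
  thus ?thesis unfolding psi_def by simp
qed

lemma psi_holomorphic:
  assumes q: "Re q > 0"
  shows "(\<lambda>w. psi w q) holomorphic_on UNIV"
proof -
  have "\<exists>f'. ((\<lambda>w. psi w q) has_field_derivative f') (at w)" for w
  proof -
    obtain n where "Re w + 3 \<le> real n"
      using real_arch_simple by blast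
    hence n: "Re w + 2 \<le> real n - 1" by simp
    have "((\<lambda>w. LINT u|Mpos. kern w q u) has_field_derivative (LINT u|Mpos. of_real u * kern w q u)) (at w)"
    proof (rule has_field_derivative_LINT[where r = 1 and f' = "\<lambda>w u. of_real u * kern w q u"])
      fix x u assume x: "x \<in> ball w 1" and u: "u \<in> space Mpos"
      show "((\<lambda>w. kern w q u) has_field_derivative of_real u * kern x q u) (at x)"
        unfolding kern_def by (auto intro!: derivative_eq_intros)
      have u0: "u \<ge> 0" using u by (simp add: space_Mpos)
      have "Re x \<le> Re w + 1" using x abs_Re_le_cmod[of "w - x"] by (simp add: dist_norm)
      hence x1: "Re (x + 1) \<le> real n - 1" using n by simp
      \<comment> \<open>The factor u produced by differentiating in w is absorbed by raising w by
        one.\<close>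
      have "u \<le> exp u" using exp_ge_add_one_self[of u] by linarith
      hence "norm (of_real u * kern x q u) \<le> exp u * norm (kern x q u)"
        using u0 by (simp add: norm_mult mult_right_mono)
      also have "\<dots> = norm (kern (x + 1) q u)"
        by (simp add: kern_def norm_exp_eq_Re exp_add[symmetric] algebra_simps)
      also have "\<dots> \<le> fact n / (pi * Re q) ^ n * exp (- u)"
        by (rule kern_bound[OF u0 x1 q order.refl])
      finally show "norm (of_real u * kern x q u) \<le> fact n / (pi * Re q) ^ n * exp (- u)" .
    next
      show "(\<lambda>u. of_real u * kern w q u) \<in> borel_measurable Mpos"
        unfolding Mpos_def kern_def
        by (intro measurable_restrict_space1 borel_measurable_continuous_onI continuous_intros) auto
    qed (auto intro!: integrable_mult_right integrable_exp_minus_Mpos kern_integrable q simp del: times_divide_eq_left)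
    thus ?thesis unfolding psi_def by blast
  qed
  thus ?thesis
    by (auto simp: holomorphic_on_def field_differentiable_def)
qed

lemma integrable_complex_iff_Re_Im:
  fixes f :: "'a \<Rightarrow> complex"
  assumes "integrable M (\<lambda>x. Re (f x))" "integrable M (\<lambda>x. Im (f x))"
  shows "integrable M f" "(LINT x|M. f x) = Complex (LINT x|M. Re (f x)) (LINT x|M. Im (f x))"
proof -
  have eq: "f = (\<lambda>x. of_real (Re (f x)) + \<i> * of_real (Im (f x)))"
    by (simp add: fun_eq_iff complex_eq)
  show i: "integrable M f"
    by (subst eq) (intro Bochner_Integration.integrable_add integrable_mult_right integrable_of_real assms)
  show "(LINT x|M. f x) = Complex (LINT x|M. Re (f x)) (LINT x|M. Im (f x))"
    using i by (simp add: complex_eq_iff)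
qed

section \<open>The full Mellin integral and Riemann's splitting\<close>

text \<open>The substitution t = pi q exp u turns the integral over the whole line into Euler's
  integral; only here is Re w > 0 required for convergence at minus infinity.\<close>

lemma LINT_kern_lborel:
  assumes w: "Re w > 0" and q: "q > 0"
  shows "integrable lborel (kern w (of_real q))"
    and "(LINT u|lborel. kern w (of_real q) u) = Gamma w * of_real (pi * q) powr (-w)"
proof -
  define c where "c = pi * q"
  have c: "c > 0" using q by (simp add: c_def)
  define f where "f = (\<lambda>t::real. of_real t powr (w - 1) / of_real (exp t) :: complex)"
  define K where "K = (\<lambda>u. of_real c powr w * kern w (of_real q) u)"
  have K: "K u = of_real (c * exp u) * f (c * exp u)" for u
  proof -
    have "complex_of_real (c * exp u) powr (w - 1) = of_real (c * exp u) powr w / of_real (c * exp u)"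
      using c by (simp add: powr_diff)
    moreover have "complex_of_real (c * exp u) powr w = of_real c powr w * exp (w * of_real u)"
    proof -
      have "complex_of_real (c * exp u) powr w = of_real c powr w * of_real (exp u) powr w"
        using c by (simp add: powr_times_real)
      also have "complex_of_real (exp u) powr w = exp (w * of_real u)"
        by (simp add: powr_def Ln_of_real)
      finally show ?thesis .
    qed
    ultimately have "of_real (c * exp u) * f (c * exp u) = of_real c powr w * exp (w * of_real u) / of_real (exp (c * exp u))"
      using c by (simp add: f_def)
    also have "\<dots> = K u"
      by (simp add: K_def kern_def exp_diff c_def exp_of_real[symmetric])
    finally show ?thesis ..
  qed
  have "range (\<lambda>u. c * exp u) = {0<..}"
  proof (intro equalityI subsetI)
    fix x :: real assume "x \<in> {0<..}"
    hence "x = c * exp (ln (x / c))" using c by simp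
    thus "x \<in> range (\<lambda>u. c * exp u)" by blast
  qed (use c in auto)
  note ran = this
  \<comment> \<open>The change of variables is carried out for a real-linear functional
    \<open>h\<close> and used for \<open>Re\<close> and \<open>Im\<close>.\<close>
  have main: "integrable lborel (\<lambda>u. h (K u)) \<and> (LINT u|lborel. h (K u)) = h (Gamma w)"
    if h: "bounded_linear h" for h :: "complex \<Rightarrow> real"
  proof -
    have "(\<lambda>t. h (f t)) absolutely_integrable_on {0<..}"
      using absolutely_integrable_linear[OF absolutely_integrable_Gamma_integral'[OF w] h] by (simp add: o_def f_def)
    moreover have "integral {0<..} (\<lambda>t. h (f t)) = h (Gamma w)"
      using has_integral_linear[OF Gamma_integral_complex'[OF w] h] by (simp add: o_def f_def integral_unique)
    ultimately have *: "(\<lambda>u. \<bar>c * exp u\<bar> * h (f (c * exp u))) absolutely_integrable_on UNIV \<and>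
       integral UNIV (\<lambda>u. \<bar>c * exp u\<bar> * h (f (c * exp u))) = h (Gamma w)"
      using c by (subst has_absolute_integral_change_of_variables_1'[of UNIV "\<lambda>u. c * exp u"])
        (auto simp: ran inj_on_def intro!: derivative_eq_intros)
    have hK: "\<bar>c * exp u\<bar> * h (f (c * exp u)) = h (K u)" for u
      using c linear_scale[OF bounded_linear.linear[OF h], of "c * exp u" "f (c * exp u)"]
      by (simp add: K scaleR_conv_of_real)
    have "continuous_on UNIV (\<lambda>u. h (K u))"
      unfolding K_def kern_def by (intro bounded_linear.continuous_on[OF h] continuous_intros)
    hence m: "(\<lambda>u. h (K u)) \<in> borel_measurable lborel"
      by (simp add: borel_measurable_continuous_onI)
    have "integrable lebesgue (\<lambda>u. h (K u))"
      using * unfolding hK by (simp add: set_integrable_def)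
    hence i: "integrable lborel (\<lambda>u. h (K u))"
      using integrable_completion[OF m] by simp
    with * show ?thesis unfolding hK using integral_lborel[OF i] by simp
  qed
  have iK: "integrable lborel K" "(LINT u|lborel. K u) = Gamma w"
    using integrable_complex_iff_Re_Im[of lborel K] main[OF bounded_linear_Re] main[OF bounded_linear_Im] by auto
  have c0: "of_real c powr w \<noteq> (0 :: complex)" using c by (simp add: powr_def)
  have kK: "kern w (of_real q) = (\<lambda>u. of_real c powr (-w) * K u)"
    using c0 by (simp add: K_def fun_eq_iff powr_minus)
  show "integrable lborel (kern w (of_real q))"
    unfolding kK using iK by simp
  show "(LINT u|lborel. kern w (of_real q) u) = Gamma w * of_real (pi * q) powr (-w)"
    unfolding kK using iK by (simp add: c_def mult.commute)
qed

text \<open>Splitting at u = 0 is the splitting of the Mellin integral at t = 1.\<close>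

lemma LINT_lborel_split:
  fixes h :: "real \<Rightarrow> complex"
  assumes h: "integrable lborel h"
  shows "integrable Mpos h" "integrable Mpos (\<lambda>u. h (- u))" 
    "(LINT u|lborel. h u) = (LINT u|Mpos. h u) + (LINT u|Mpos. h (- u))"
proof -
  have h': "integrable lborel (\<lambda>u. h (- u))" using lborel_integrable_real_affine[OF h, of "-1" 0] by simp
  show i1: "integrable Mpos h" and i2: "integrable Mpos (\<lambda>u. h (- u))"
    using integrable_mult_indicator[OF _ h, of "{0..}"] integrable_mult_indicator[OF _ h', of "{0..}"]
    by (simp_all add: Mpos_def integrable_restrict_space)
  have "(LINT u|lborel. h u) = (LINT u|lborel. indicator {0..} u *\<^sub>R h u + indicator {..<0} u *\<^sub>R h u)"
    by (intro Bochner_Integration.integral_cong) (auto split: split_indicator)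
  also have "\<dots> = (LINT u|lborel. indicator {0..} u *\<^sub>R h u) + (LINT u|lborel. indicator {..<0} u *\<^sub>R h u)"
    by (intro Bochner_Integration.integral_add integrable_mult_indicator h) auto
  also have "(LINT u|lborel. indicator {..<0} u *\<^sub>R h u) = (LINT u|lborel. indicator {..<0} (- u) *\<^sub>R h (- u))"
    using lborel_integral_real_affine[of "-1" "\<lambda>u. indicator {..<0} u *\<^sub>R h u" 0] by simp
  also have "\<dots> = (LINT u|lborel. indicator {0..} u *\<^sub>R h (- u))"
  proof (rule integral_cong_AE)
    show "AE u in lborel. indicator {..<0} (- u) *\<^sub>R h (- u) = indicator {0..} u *\<^sub>R h (- u)"
      using AE_lborel_singleton[of "0::real"] by eventually_elim (auto split: split_indicator)
    show "(\<lambda>u. indicator {0..} u *\<^sub>R h (- u)) \<in> borel_measurable lborel"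
      using h' by measurable
    have "integrable lborel (\<lambda>u. indicator {..<0} (0 + (-1) * u) *\<^sub>R h (0 + (-1) * u))"
      by (rule lborel_integrable_real_affine) (auto intro: integrable_mult_indicator h)
    thus "(\<lambda>u. indicator {..<0} (- u) *\<^sub>R h (- u)) \<in> borel_measurable lborel"
      by (auto dest: borel_measurable_integrable)
  qed
  finally show "(LINT u|lborel. h u) = (LINT u|Mpos. h u) + (LINT u|Mpos. h (- u))"
    by (simp add: Mpos_def integral_restrict_space)
qed

lemma LINT_Mpos_exp:
  fixes c :: complex
  assumes c: "Re c > 0"
  shows "integrable Mpos (\<lambda>u. exp (- c * of_real u))" "(LINT u|Mpos. exp (- c * of_real u)) = 1 / c"
proof -
  have c0: "c \<noteq> 0" using c by auto
  have "(\<integral>\<^sup>+ x. ennreal (exp (- Re c * x)) * indicator {0..} x \<partial>lborel) = ennreal (0 - (- exp (- Re c * 0) / Re c))"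
  proof (rule nn_integral_FTC_atLeast)
    have "((\<lambda>x. exp (- (Re c * x :: real))) \<longlongrightarrow> 0) at_top"
      using c by (intro filterlim_compose[OF exp_at_bot] filterlim_compose[OF filterlim_uminus_at_bot_at_top] filterlim_tendsto_pos_mult_at_top[OF tendsto_const c filterlim_ident])
    from tendsto_divide[OF tendsto_minus[OF this] tendsto_const[of "Re c"]]
    show "((\<lambda>x. - exp (- Re c * x :: real) / Re c) \<longlongrightarrow> 0) at_top" using c by simp
  qed (use c in \<open>auto intro!: derivative_eq_intros\<close>)
  also have "(\<integral>\<^sup>+ x. ennreal (exp (- Re c * x)) * indicator {0..} x \<partial>lborel) = (\<integral>\<^sup>+ x. ennreal (indicator {0..} x *\<^sub>R exp (- Re c * x)) \<partial>lborel)"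
    by (intro nn_integral_cong) (auto split: split_indicator)
  finally have I: "(\<integral>\<^sup>+ x. ennreal (indicator {0..} x *\<^sub>R exp (- Re c * x)) \<partial>lborel) = ennreal (1 / Re c)" by simp
  have "has_bochner_integral lborel (\<lambda>x. indicator {0..} x *\<^sub>R exp (- Re c * x)) (1 / Re c)"
    by (rule has_bochner_integral_nn_integral[OF _ _ _ I]) (use c in auto)
  hence ib: "integrable lborel (\<lambda>x. indicator {0..} x *\<^sub>R exp (- Re c * x))"
    by (simp add: has_bochner_integral_iff)
  have nb: "norm (indicator A x *\<^sub>R exp (- c * of_real x)) = indicator A x *\<^sub>R exp (- Re c * x)" for A and x :: real
    by (auto simp: norm_exp_eq_Re split: split_indicator)
  have i: "integrable lborel (\<lambda>x. indicator {0..} x *\<^sub>R exp (- c * of_real x))"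
    by (rule Bochner_Integration.integrable_bound[OF ib])
       (auto simp: nb intro!: borel_measurable_scaleR borel_measurable_continuous_onI continuous_intros)
  thus "integrable Mpos (\<lambda>u. exp (- c * of_real u))"
    by (simp add: Mpos_def integrable_restrict_space)
  have "(\<lambda>N. LINT x|lborel. indicator {0..real N} x *\<^sub>R exp (- c * of_real x)) \<longlonglongrightarrow> (LINT x|lborel. indicator {0..} x *\<^sub>R exp (- c * of_real x))"
  proof (rule integral_dominated_convergence[OF _ _ ib])
    show "AE x in lborel. (\<lambda>N. indicator {0..real N} x *\<^sub>R exp (- c * of_real x)) \<longlonglongrightarrow> indicator {0..} x *\<^sub>R exp (- c * of_real x)"
    proof (rule AE_I2, rule tendsto_eventually)
      fix x :: real
      show "\<forall>\<^sub>F N in sequentially. indicator {0..real N} x *\<^sub>R exp (- c * of_real x) = indicator {0..} x *\<^sub>R exp (- c * of_real x)"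
        using eventually_ge_at_top[of "nat \<lceil>x\<rceil>"] by eventually_elim (auto split: split_indicator)
    qed
    show "AE x in lborel. norm (indicator {0..real N} x *\<^sub>R exp (- c * of_real x)) \<le> indicator {0..} x *\<^sub>R exp (- Re c * x)" for N
      unfolding nb by (auto split: split_indicator)
  qed (intro borel_measurable_scaleR borel_measurable_indicator borel_measurable_continuous_onI continuous_intros; simp)+
  moreover have "(LINT x|lborel. indicator {0..real N} x *\<^sub>R exp (- c * of_real x)) = - exp (- c * of_real (real N)) / c - (- exp (- c * of_real 0) / c)" for N
  proof (rule integral_FTC_Icc)
    show "((\<lambda>x. - exp (- c * of_real x) / c) has_vector_derivative exp (- c * of_real x)) (at x within {0..real N})" for x
      using c0 by (intro has_vector_derivative_real_field) (auto intro!: derivative_eq_intros)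
  qed (auto intro!: continuous_intros)
  moreover have "(\<lambda>N. - exp (- c * of_real (real N)) / c - (- exp (- c * of_real 0) / c)) \<longlonglongrightarrow> - 0 / c - (- 1 / c)"
  proof (intro tendsto_intros c0)
    show "(\<lambda>N. exp (- c * complex_of_real (real N))) \<longlonglongrightarrow> 0"
    proof (rule tendsto_norm_zero_cancel)
      have "(\<lambda>N. exp (- (Re c * real N))) \<longlonglongrightarrow> 0"
        using c by (intro filterlim_compose[OF exp_at_bot] filterlim_compose[OF filterlim_uminus_at_bot_at_top] filterlim_tendsto_pos_mult_at_top[OF tendsto_const c filterlim_real_sequentially])
      thus "(\<lambda>N. norm (exp (- c * complex_of_real (real N)))) \<longlonglongrightarrow> 0" by (simp add: norm_exp_eq_Re)
    qed
  qed simp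
  ultimately have "(LINT x|lborel. indicator {0..} x *\<^sub>R exp (- c * of_real x)) = 1 / c"
    using LIMSEQ_unique by fastforce
  thus "(LINT u|Mpos. exp (- c * of_real u)) = 1 / c"
    by (simp add: Mpos_def integral_restrict_space)
qed

lemma summable_theta_lat:
  assumes z: "z \<in> UHP" and t: "t > 0"
  shows "summable (\<lambda>i. exp (- (pi * t * quad z (lat i))))"
    and "(\<Sum>\<^sub>\<infinity>v. exp (- (pi * t * quad z v))) = 1 + (\<Sum>i. exp (- (pi * t * quad z (lat i))))"
proof -
  have s: "(\<lambda>v. exp (- (pi * t * quad z v))) summable_on (UNIV - {(0,0)})"
    by (rule summable_on_subset_banach[OF summable_on_theta[OF z t]]) auto
  hence s': "(\<lambda>i. exp (- (pi * t * quad z (lat i)))) summable_on UNIV"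
    by (subst summable_on_reindex_bij_betw[OF bij_betw_lat])
  thus s'': "summable (\<lambda>i. exp (- (pi * t * quad z (lat i))))"
    by (rule summable_on_imp_summable)
  have "(\<Sum>\<^sub>\<infinity>v. exp (- (pi * t * quad z v))) = infsum (\<lambda>v. exp (- (pi * t * quad z v))) (insert (0,0) (UNIV - {(0,0)}))"
    by (rule arg_cong[where f = "infsum _"]) auto
  also have "\<dots> = 1 + infsum (\<lambda>v. exp (- (pi * t * quad z v))) (UNIV - {(0,0)})"
    by (subst infsum_insert[OF s]) (auto simp: quad_def)
  also have "infsum (\<lambda>v. exp (- (pi * t * quad z v))) (UNIV - {(0,0)}) = (\<Sum>\<^sub>\<infinity>i. exp (- (pi * t * quad z (lat i))))"
    by (rule infsum_reindex_bij_betw[OF bij_betw_lat, symmetric])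
  also have "\<dots> = (\<Sum>i. exp (- (pi * t * quad z (lat i))))"
    by (rule infsumI, rule norm_summable_imp_has_sum) (use s'' summable_sums in auto)
  finally show "(\<Sum>\<^sub>\<infinity>v. exp (- (pi * t * quad z v))) = 1 + (\<Sum>i. exp (- (pi * t * quad z (lat i))))" .
qed

text \<open>The zero vector contributes 1 to each theta series. Its removal leaves the extra
  \<open>exp u - 1\<close>, the origin of the polar terms 1/(w - 1) and 1/w.\<close>

lemma theta_inversion_lat:
  assumes z: "z \<in> UHP"
  shows "(\<Sum>i. exp (- (pi * exp (- u) * quad z (lat i)))) = exp u * (\<Sum>i. exp (- (pi * exp u * quad z (lat i)))) + exp u - 1"
proof -
  have e: "pi / exp (- u) = pi * exp u" "\<And>x. x / exp (- u) = x * exp u"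
    by (simp_all add: exp_minus divide_inverse)
  have "1 + (\<Sum>i. exp (- (pi * exp (- u) * quad z (lat i)))) = (1 + (\<Sum>i. exp (- (pi * exp u * quad z (lat i))))) * exp u"
    using theta_inversion[OF z, of "exp (- u)"] unfolding e summable_theta_lat(2)[OF z exp_gt_zero] by simp
  thus ?thesis by (simp only: algebra_simps)
qed

lemma summable_norm_kern_lat:
  assumes z: "z \<in> UHP"
  shows "summable (\<lambda>i. norm (kern w (of_real (quad z (lat i))) u))"
    and "(\<Sum>i. kern w (of_real (quad z (lat i))) u) = exp (w * of_real u) * of_real (\<Sum>i. exp (- (pi * exp u * quad z (lat i))))"
proof -
  note s = summable_theta_lat(1)[OF z exp_gt_zero, of u]
  have "norm (kern w (of_real (quad z (lat i))) u) = exp (Re w * u) * exp (- (pi * exp u * quad z (lat i)))" for i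
    by (simp add: kern_def norm_exp_eq_Re exp_add[symmetric] mult_ac)
  thus "summable (\<lambda>i. norm (kern w (of_real (quad z (lat i))) u))"
    using s by (simp add: summable_mult)
  have "kern w (of_real (quad z (lat i))) u = exp (w * of_real u) * of_real (exp (- (pi * exp u * quad z (lat i))))" for i
    by (simp add: kern_def exp_diff exp_minus divide_inverse exp_of_real[symmetric] mult_ac)
  thus "(\<Sum>i. kern w (of_real (quad z (lat i))) u) = exp (w * of_real u) * of_real (\<Sum>i. exp (- (pi * exp u * quad z (lat i))))"
    using s by (simp add: suminf_mult summable_of_real suminf_of_real[symmetric])
qed

lemma decays_psi: "decays (\<lambda>q. psi w (of_real q)) M" if "Re w \<le> real n - 1" "M = real n"
  unfolding decays_def
proof (intro exI[of _ "fact n / pi ^ n"] allI impI)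
  fix q :: real assume q: "q > 0"
  have "norm (psi w (of_real q)) \<le> fact n / (pi * q) ^ n" using psi_bound(2)[OF that(1), of "of_real q"] q by simp
  also have "\<dots> = fact n / pi ^ n * q powr (-M)"
    using q that(2) by (simp add: powr_minus powr_realpow power_mult_distrib divide_simps)
  finally show "norm (psi w (of_real q)) \<le> fact n / pi ^ n * q powr (-M)" .
qed

lemma decays_powr: "decays (\<lambda>q. of_real q powr (-w)) (Re w)"
  unfolding decays_def by (intro exI[of _ 1]) (simp add: norm_powr_real_powr)

text \<open>For each vector, the Mellin integral minus the two incomplete ones is the integral of
  \<open>D\<close>. Individually these are not elementary, but summed over the lattice theta
  inversion collapses \<open>D\<close> to two exponentials.\<close>

lemma lsum_mellin:
  assumes z: "z \<in> UHP" and w: "Re w > 1"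
  shows "Gamma w * of_real pi powr (-w) * lsum 0 0 (\<lambda>q. of_real q powr (-w)) z =
    lsum 0 0 (\<lambda>q. psi w (of_real q)) z + lsum 0 0 (\<lambda>q. psi (1 - w) (of_real q)) z + 1 / (w - 1) - 1 / w"
proof -
  define Q where "Q = (\<lambda>i. quad z (lat i))"
  have Q: "Q i > 0" for i unfolding Q_def by (rule quad_lat_pos[OF z])
  have w0: "Re w > 0" using w by simp
  \<comment> \<open>The bound is taken with n = 2 although Re (1 - w) < 0 would allow n = 1: the
    resulting decay must be summable over the lattice.\<close>
  have w1: "Re (1 - w) \<le> real 2 - 1" using w by simp
  define D where "D = (\<lambda>i u. kern w (of_real (Q i)) (- u) - kern (1 - w) (of_real (Q i)) u)"
  have ik: "integrable lborel (kern w (of_real (Q i)))" for i by (rule LINT_kern_lborel(1)[OF w0 Q])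
  have ik': "integrable Mpos (kern (1 - w) (of_real (Q i)))" for i by (rule kern_integrable) (use Q in simp)
  have iD: "integrable Mpos (D i)" for i
    unfolding D_def by (intro Bochner_Integration.integrable_diff LINT_lborel_split(2)[OF ik] ik')
  have ID: "(LINT u|Mpos. D i u) = Gamma w * of_real (pi * Q i) powr (-w) - psi w (of_real (Q i)) - psi (1 - w) (of_real (Q i))" for i
    using LINT_lborel_split(3)[OF ik[of i]] LINT_kern_lborel(2)[OF w0 Q[of i]] LINT_lborel_split(2)[OF ik[of i]] ik'[of i]
    by (simp add: D_def psi_def Bochner_Integration.integral_diff)
  \<comment> \<open>The theta series cancel; the contribution of the removed zero vector is all that
    remains.\<close>
  have SD: "(\<Sum>i. D i u) = exp (- (w - 1) * of_real u) - exp (- w * of_real u)" for u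
  proof -
    note s1 = summable_norm_kern_lat[OF z, of w "-u"] and s2 = summable_norm_kern_lat[OF z, of "1-w" u]
    have "(\<Sum>i. D i u) = exp (w * of_real (-u)) * of_real (\<Sum>i. exp (- (pi * exp (-u) * quad z (lat i)))) - 
        exp ((1 - w) * of_real u) * of_real (\<Sum>i. exp (- (pi * exp u * quad z (lat i))))"
      unfolding s1(2)[symmetric] s2(2)[symmetric] D_def Q_def
      by (rule suminf_diff[symmetric, OF summable_norm_cancel[OF s1(1)] summable_norm_cancel[OF s2(1)]])
    also have "\<dots> = exp ((1 - w) * of_real u) - exp (w * of_real (-u))"
    proof -
      have *: "exp (w * of_real (-u)) * complex_of_real (exp u) = exp ((1 - w) * of_real u)"
        unfolding exp_of_real[symmetric] exp_add[symmetric] by (rule arg_cong[where f = exp]) (simp add: algebra_simps)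
      have "a * of_real (E * S + E - 1) - b * of_real S = b - a" if "a * of_real E = b" for a b :: complex and E S :: real
        unfolding that[symmetric] by (simp add: algebra_simps)
      from this[OF *] show ?thesis unfolding theta_inversion_lat[OF z] .
    qed
    finally show ?thesis by (simp add: algebra_simps)
  qed
  have sd: "summable (\<lambda>i. norm (D i u))" for u
  proof (rule summable_comparison_test[OF _ summable_add[OF summable_norm_kern_lat(1)[OF z, of w "-u"] summable_norm_kern_lat(1)[OF z, of "1-w" u]]])
    show "\<exists>N. \<forall>n\<ge>N. norm (norm (D n u)) \<le> norm (kern w (of_real (quad z (lat n))) (- u)) + norm (kern (1 - w) (of_real (quad z (lat n))) u)"
      unfolding D_def Q_def by (auto intro: norm_triangle_ineq4)
  qed
  obtain C1 where C1: "\<And>i. Q i powr (- Re w) \<le> C1 * lsize i powr (- Re w)"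
    using quad_powr_bound[OF z order.refl, of "Re w"] w unfolding Q_def by (metis less_eq_real_def order_trans zero_le_one)
  obtain C2 where C2: "\<And>i. Q i powr (-2) \<le> C2 * lsize i powr (-2)"
    using quad_powr_bound[OF z order.refl, of 2] unfolding Q_def by (metis zero_le_numeral)
  \<comment> \<open>Summability of the L1 norms justifies exchanging sum and integral. The first
    part integrates to the real Gamma integral with exponent Re w, so Re w > 1 enters here; the
    reflected part is bounded by the square of 1 / \<open>quad\<close>.\<close>
  have sn: "summable (\<lambda>i. LINT u|Mpos. norm (D i u))"
  proof (rule summable_comparison_test)
    show "summable (\<lambda>i. Gamma (Re w) * pi powr (- Re w) * (C1 * lsize i powr (- Re w)) + 2 / pi ^ 2 * (C2 * lsize i powr (-2)))"
      by (intro summable_add summable_mult summable_lsize w) simp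
    have "(LINT u|Mpos. norm (D i u)) \<le> Gamma (Re w) * pi powr (- Re w) * (C1 * lsize i powr (- Re w)) + 2 / pi ^ 2 * (C2 * lsize i powr (-2))" for i
    proof -
      have i1: "integrable Mpos (\<lambda>u. norm (kern w (of_real (Q i)) (- u)))"
        by (intro integrable_norm LINT_lborel_split(2)[OF ik])
      have "(LINT u|Mpos. norm (D i u)) \<le> (LINT u|Mpos. norm (kern w (of_real (Q i)) (- u)) + norm (kern (1 - w) (of_real (Q i)) u))"
        unfolding D_def by (intro integral_mono norm_triangle_ineq4 Bochner_Integration.integrable_add i1 integrable_norm iD[unfolded D_def] ik')
      also have "\<dots> = (LINT u|Mpos. norm (kern w (of_real (Q i)) (- u))) + (LINT u|Mpos. norm (kern (1 - w) (of_real (Q i)) u))"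
        by (intro Bochner_Integration.integral_add i1 integrable_norm ik')
      also have "(LINT u|Mpos. norm (kern (1 - w) (of_real (Q i)) u)) \<le> 2 / (pi * Q i) ^ 2"
        using psi_bound(1)[OF w1, of "of_real (Q i)"] Q[of i] by (simp add: fact_numeral)
      also have "2 / (pi * Q i) ^ 2 = 2 / pi ^ 2 * Q i powr (-2)"
        using Q[of i] by (simp add: powr_minus power_mult_distrib divide_simps)
      also have "2 / pi ^ 2 * Q i powr (-2) \<le> 2 / pi ^ 2 * (C2 * lsize i powr (-2))"
        by (intro mult_left_mono C2) auto
      also have "(LINT u|Mpos. norm (kern w (of_real (Q i)) (- u))) \<le> (LINT u|lborel. norm (kern w (of_real (Q i)) u))"
      proof -
        have ic: "integrable lborel (\<lambda>u. complex_of_real (norm (kern w (of_real (Q i)) u)))"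
          by (intro integrable_of_real integrable_norm ik)
        have "complex_of_real (LINT u|lborel. norm (kern w (of_real (Q i)) u)) = 
          of_real ((LINT u|Mpos. norm (kern w (of_real (Q i)) u)) + (LINT u|Mpos. norm (kern w (of_real (Q i)) (- u))))"
          using LINT_lborel_split(3)[OF ic] by simp
        hence "(LINT u|lborel. norm (kern w (of_real (Q i)) u)) = 
          (LINT u|Mpos. norm (kern w (of_real (Q i)) u)) + (LINT u|Mpos. norm (kern w (of_real (Q i)) (- u)))"
          unfolding of_real_eq_iff .
        moreover have "(LINT u|Mpos. norm (kern w (of_real (Q i)) u)) \<ge> 0" by (rule Bochner_Integration.integral_nonneg) auto
        ultimately show ?thesis by linarith
      qed
      also have "(LINT u|lborel. norm (kern w (of_real (Q i)) u)) = Gamma (Re w) * (pi * Q i) powr (- Re w)"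
      proof -
        have "complex_of_real (LINT u|lborel. norm (kern w (of_real (Q i)) u)) = (LINT u|lborel. complex_of_real (norm (kern w (of_real (Q i)) u)))"
          by simp
        also have "\<dots> = (LINT u|lborel. kern (of_real (Re w)) (of_real (Q i)) u)"
          by (intro Bochner_Integration.integral_cong) (auto simp: kern_def norm_exp_eq_Re exp_of_real[symmetric])
        also have "\<dots> = Gamma (of_real (Re w)) * of_real (pi * Q i) powr (- of_real (Re w))"
          by (rule LINT_kern_lborel(2)) (use w0 Q in auto)
        also have "\<dots> = of_real (Gamma (Re w) * (pi * Q i) powr (- Re w))"
        proof -
          have "complex_of_real (pi * Q i) powr of_real (- Re w) = of_real ((pi * Q i) powr (- Re w))"
            using Q[of i] by (intro powr_of_real) auto
          thus ?thesis by (simp only: Gamma_complex_of_real of_real_minus[symmetric] of_real_mult)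
        qed
        finally show ?thesis unfolding of_real_eq_iff .
      qed
      also have "(pi * Q i) powr (- Re w) = pi powr (- Re w) * Q i powr (- Re w)" using Q[of i] by (simp add: powr_mult)
      also have "Gamma (Re w) * (pi powr (- Re w) * Q i powr (- Re w)) \<le> Gamma (Re w) * (pi powr (- Re w) * (C1 * lsize i powr (- Re w)))"
        using w0 by (intro mult_left_mono C1) (auto intro: less_imp_le Gamma_real_pos)
      finally show ?thesis by (simp add: mult.assoc)
    qed
    thus "\<exists>N. \<forall>i\<ge>N. norm (LINT u|Mpos. norm (D i u)) \<le> Gamma (Re w) * pi powr (- Re w) * (C1 * lsize i powr (- Re w)) + 2 / pi ^ 2 * (C2 * lsize i powr (-2))"
      by (intro exI[of _ 0] allI impI) (simp add: abs_of_nonneg Bochner_Integration.integral_nonneg)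
  qed
  have "(LINT u|Mpos. (\<Sum>i. D i u)) = (\<Sum>i. LINT u|Mpos. D i u)"
    by (rule integral_suminf[OF iD _ sn]) (use sd in auto)
  moreover have "(LINT u|Mpos. (\<Sum>i. D i u)) = 1 / (w - 1) - 1 / w"
    unfolding SD using LINT_Mpos_exp[of "w - 1"] LINT_Mpos_exp[of w] w
    by (subst Bochner_Integration.integral_diff) auto
  ultimately have 1: "(\<Sum>i. LINT u|Mpos. D i u) = 1 / (w - 1) - 1 / w" by simp
  obtain n where "Re w + 2 \<le> real n" using real_arch_simple by blast
  hence n: "Re w \<le> real n - 1" "real n > 1" using w by auto
  have t: "lterm 0 0 \<phi> z (lat i) = \<phi> (Q i)" for \<phi> i by (simp add: lterm_def Q_def)
  have sw: "summable (\<lambda>i. complex_of_real (Q i) powr (-w))"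
    using summable_lterm[OF z w decays_powr, of 0 0] by (simp add: t)
  have sp: "summable (\<lambda>i. psi w (of_real (Q i)))"
    using summable_lterm[OF z n(2) decays_psi[OF n(1) refl], of 0 0] by (simp add: t)
  have sp': "summable (\<lambda>i. psi (1 - w) (of_real (Q i)))"
    using summable_lterm[OF z _ decays_psi[OF w1 refl], of 0 0] by (simp add: t)
  have "(\<Sum>i. LINT u|Mpos. D i u) = (\<Sum>i. Gamma w * of_real pi powr (-w) * of_real (Q i) powr (-w) - psi w (of_real (Q i)) - psi (1 - w) (of_real (Q i)))"
    unfolding ID using Q by (simp add: powr_times_real less_imp_le mult.assoc)
  also have "\<dots> = Gamma w * of_real pi powr (-w) * (\<Sum>i. of_real (Q i) powr (-w)) - (\<Sum>i. psi w (of_real (Q i))) - (\<Sum>i. psi (1 - w) (of_real (Q i)))"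
    using sw sp sp' by (simp add: suminf_diff[symmetric] suminf_mult summable_mult summable_diff)
  finally show ?thesis
    using 1 by (simp add: lsum_def t algebra_simps)
qed

section \<open>Smooth families of entire functions\<close>

text \<open>
  A single bound by a power of \<open>hgt\<close> gives both local boundedness, which makes \<open>z\<close>-derivatives commute
  with \<open>w\<close>-derivatives, and moderate growth at the cusp.
\<close>
definition hbase :: "(complex \<Rightarrow> complex \<Rightarrow> complex) \<Rightarrow> bool" where
  "hbase g \<longleftrightarrow> (\<forall>z\<in>UHP. g z holomorphic_on UNIV) \<and>
     (\<forall>R. \<exists>C r. r \<ge> 0 \<and> (\<forall>z\<in>UHP. \<forall>w. norm w \<le> R \<longrightarrow> norm (g z w) \<le> C * hgt z powr r))"

text \<open>Derivatives are required to be families of the same kind in w, not merely to exist for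
  each w, because d/dw is to be exchanged with them. Counting the order n lets closure properties be
  proved by plain induction.\<close>

primrec hfam :: "nat \<Rightarrow> (complex \<Rightarrow> complex \<Rightarrow> complex) \<Rightarrow> bool" where
  "hfam 0 g \<longleftrightarrow> hbase g"
| "hfam (Suc n) g \<longleftrightarrow> hbase g \<and> (\<exists>A B. hfam n A \<and> hfam n B \<and> (\<forall>w. \<forall>z\<in>UHP. wderiv (\<lambda>z. g z w) (A z w) (B z w) z))"

definition HF :: "(complex \<Rightarrow> complex \<Rightarrow> complex) \<Rightarrow> bool" where
  "HF g \<longleftrightarrow> (\<forall>n. hfam n g)"

lemma hbaseI:
  assumes "\<And>z. z \<in> UHP \<Longrightarrow> g z holomorphic_on UNIV"
    and "\<And>R. \<exists>C r. r \<ge> 0 \<and> (\<forall>z\<in>UHP. \<forall>w. norm w \<le> R \<longrightarrow> norm (g z w) \<le> C * hgt z powr r)"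
  shows "hbase g"
  using assms by (simp add: hbase_def)

lemma hbase_bound:
  assumes "hbase g"
  obtains C r where "r \<ge> 0" "C \<ge> 0" "\<And>z w. z \<in> UHP \<Longrightarrow> norm w \<le> R \<Longrightarrow> norm (g z w) \<le> C * hgt z powr r"
proof -
  obtain C r where r: "r \<ge> 0" and C: "\<And>z w. z \<in> UHP \<Longrightarrow> norm w \<le> R \<Longrightarrow> norm (g z w) \<le> C * hgt z powr r"
    using assms unfolding hbase_def by meson
  have "norm (g z w) \<le> \<bar>C\<bar> * hgt z powr r" if "z \<in> UHP" "norm w \<le> R" for z w
    using C[OF that] by (rule order_trans) (intro mult_right_mono, auto)
  with r show ?thesis by (intro that[of r "\<bar>C\<bar>"]) auto
qed

lemma hbase_cong:
  assumes "hbase g" "\<And>z w. z \<in> UHP \<Longrightarrow> g z w = h z w"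
  shows "hbase h"
proof -
  have "g z = h z" if "z \<in> UHP" for z using assms(2)[OF that] by blast
  with assms(1) show ?thesis unfolding hbase_def by (auto)
qed

lemma hfam_cong:
  assumes "hfam n g" "\<And>z w. z \<in> UHP \<Longrightarrow> g z w = h z w"
  shows "hfam n h"
proof (cases n)
  case 0
  thus ?thesis using assms by (auto intro: hbase_cong)
next
  case (Suc m)
  then obtain A B where AB: "hfam m A" "hfam m B" "\<And>z w. z \<in> UHP \<Longrightarrow> wderiv (\<lambda>z. g z w) (A z w) (B z w) z"
    using assms(1) by auto
  have "wderiv (\<lambda>z. h z w) (A z w) (B z w) z" if "z \<in> UHP" for z w
    by (rule wderiv_transform[OF AB(3)[OF that] that]) (rule assms(2))
  moreover have "hbase h" using assms Suc by (auto intro: hbase_cong)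
  ultimately show ?thesis using AB Suc by auto
qed

lemma hfam_imp_hbase: "hfam n g \<Longrightarrow> hbase g"
  by (cases n) auto

lemma hfam_SucI:
  "hbase g \<Longrightarrow> hfam n A \<Longrightarrow> hfam n B \<Longrightarrow> (\<And>z w. z \<in> UHP \<Longrightarrow> wderiv (\<lambda>z. g z w) (A z w) (B z w) z) \<Longrightarrow> hfam (Suc n) g"
  unfolding hfam.simps(2) by (intro conjI exI[of _ A] exI[of _ B]) auto

lemma hfam_SucE:
  assumes "hfam (Suc n) g"
  obtains A B where "hbase g" "hfam n A" "hfam n B" "\<And>z w. z \<in> UHP \<Longrightarrow> wderiv (\<lambda>z. g z w) (A z w) (B z w) z"
  using assms unfolding hfam.simps(2) by auto

lemma hfam_SucD: "hfam (Suc n) g \<Longrightarrow> hfam n g"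
proof (induction n arbitrary: g)
  case (Suc n)
  from Suc.prems obtain A B where AB: "hbase g" "hfam (Suc n) A" "hfam (Suc n) B" 
    "\<And>z w. z \<in> UHP \<Longrightarrow> wderiv (\<lambda>z. g z w) (A z w) (B z w) z"
    by (rule hfam_SucE) (rule that)
  have IH: "hfam n A" "hfam n B" by (rule Suc.IH, rule AB)+
  show ?case by (rule hfam_SucI[of g n A B, OF AB(1) IH AB(4)])
next
  case 0
  thus ?case unfolding hfam.simps by (rule conjunct1)
qed

lemma hbase_add: "hbase g \<Longrightarrow> hbase h \<Longrightarrow> hbase (\<lambda>z w. g z w + h z w)"
proof (rule hbaseI)
  fix R assume gh: "hbase g" "hbase h"
  obtain C r where C: "r \<ge> 0" "C \<ge> 0" "\<And>z w. z \<in> UHP \<Longrightarrow> norm w \<le> R \<Longrightarrow> norm (g z w) \<le> C * hgt z powr r"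
    by (rule hbase_bound[OF gh(1), where R = R]) (rule that)
  obtain C' r' where C': "r' \<ge> 0" "C' \<ge> 0" "\<And>z w. z \<in> UHP \<Longrightarrow> norm w \<le> R \<Longrightarrow> norm (h z w) \<le> C' * hgt z powr r'"
    by (rule hbase_bound[OF gh(2), where R = R]) (rule that)
  have "norm (g z w + h z w) \<le> (C + C') * hgt z powr (max r r')" if zw: "z \<in> UHP" "norm w \<le> R" for z w
  proof -
    have "norm (g z w + h z w) \<le> C * hgt z powr r + C' * hgt z powr r'"
      using C(3)[OF zw] C'(3)[OF zw] by (rule norm_triangle_mono)
    also have "\<dots> \<le> C * hgt z powr (max r r') + C' * hgt z powr (max r r')"
      using hgt_bounds(1)[OF zw(1)] C(2) C'(2) by (intro add_mono mult_left_mono powr_mono) auto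
    finally show ?thesis by (simp add: algebra_simps)
  qed
  thus "\<exists>C r. r \<ge> 0 \<and> (\<forall>z\<in>UHP. \<forall>w. norm w \<le> R \<longrightarrow> norm (g z w + h z w) \<le> C * hgt z powr r)"
    using C(1) by (intro exI[of _ "C + C'"] exI[of _ "max r r'"]) auto
qed (auto intro!: holomorphic_intros simp: hbase_def)

lemma hbase_mult: "hbase g \<Longrightarrow> hbase h \<Longrightarrow> hbase (\<lambda>z w. g z w * h z w)"
proof (rule hbaseI)
  fix R assume gh: "hbase g" "hbase h"
  obtain C r where C: "r \<ge> 0" "C \<ge> 0" "\<And>z w. z \<in> UHP \<Longrightarrow> norm w \<le> R \<Longrightarrow> norm (g z w) \<le> C * hgt z powr r"
    by (rule hbase_bound[OF gh(1), where R = R]) (rule that)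
  obtain C' r' where C': "r' \<ge> 0" "C' \<ge> 0" "\<And>z w. z \<in> UHP \<Longrightarrow> norm w \<le> R \<Longrightarrow> norm (h z w) \<le> C' * hgt z powr r'"
    by (rule hbase_bound[OF gh(2), where R = R]) (rule that)
  have "norm (g z w * h z w) \<le> (C * C') * hgt z powr (r + r')" if zw: "z \<in> UHP" "norm w \<le> R" for z w
  proof -
    have "norm (g z w * h z w) \<le> (C * hgt z powr r) * (C' * hgt z powr r')"
      unfolding norm_mult using C(2) by (intro mult_mono C(3)[OF zw] C'(3)[OF zw]) auto
    thus ?thesis by (simp add: powr_add mult_ac)
  qed
  thus "\<exists>C r. r \<ge> 0 \<and> (\<forall>z\<in>UHP. \<forall>w. norm w \<le> R \<longrightarrow> norm (g z w * h z w) \<le> C * hgt z powr r)"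
    using C(1) C'(1) by (intro exI[of _ "C * C'"] exI[of _ "r + r'"]) auto
qed (auto intro!: holomorphic_intros simp: hbase_def)

lemma hfam_add: "hfam n g \<Longrightarrow> hfam n h \<Longrightarrow> hfam n (\<lambda>z w. g z w + h z w)"
proof (induction n arbitrary: g h)
  case (Suc n)
  obtain A B where AB: "hfam n A" "hfam n B" "\<And>z w. z \<in> UHP \<Longrightarrow> wderiv (\<lambda>z. g z w) (A z w) (B z w) z"
    using Suc.prems(1) by (rule hfam_SucE) (rule that)
  obtain A' B' where AB': "hfam n A'" "hfam n B'" "\<And>z w. z \<in> UHP \<Longrightarrow> wderiv (\<lambda>z. h z w) (A' z w) (B' z w) z"
    using Suc.prems(2) by (rule hfam_SucE) (rule that)
  have "hbase (\<lambda>z w. g z w + h z w)"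
    using Suc.prems by (auto intro: hbase_add)
  thus ?case
    by (rule hfam_SucI[OF _ Suc.IH[OF AB(1) AB'(1)] Suc.IH[OF AB(2) AB'(2)] wderiv_add[OF AB(3) AB'(3)]])
qed (auto intro: hbase_add)

lemma hfam_mult: "hfam n g \<Longrightarrow> hfam n h \<Longrightarrow> hfam n (\<lambda>z w. g z w * h z w)"
proof (induction n arbitrary: g h)
  case (Suc n)
  obtain A B where AB: "hfam n A" "hfam n B" "\<And>z w. z \<in> UHP \<Longrightarrow> wderiv (\<lambda>z. g z w) (A z w) (B z w) z"
    using Suc.prems(1) by (rule hfam_SucE) (rule that)
  obtain A' B' where AB': "hfam n A'" "hfam n B'" "\<And>z w. z \<in> UHP \<Longrightarrow> wderiv (\<lambda>z. h z w) (A' z w) (B' z w) z"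
    using Suc.prems(2) by (rule hfam_SucE) (rule that)
  note gh = Suc.prems[THEN hfam_SucD]
  have 1: "hbase (\<lambda>z w. g z w * h z w)"
    using Suc.prems by (auto intro: hbase_mult)
  have 2: "hfam n (\<lambda>z w. A z w * h z w + g z w * A' z w)" "hfam n (\<lambda>z w. B z w * h z w + g z w * B' z w)"
    by (intro hfam_add Suc.IH AB AB' gh)+
  show ?case by (rule hfam_SucI[OF 1 2 wderiv_mult[OF AB(3) AB'(3)]])
qed (auto intro: hbase_mult)

lemma hfam_entire:
  assumes "f holomorphic_on UNIV"
  shows "hfam n (\<lambda>z w. f w)"
  using assms
proof (induction n arbitrary: f)
  case base: 0
  have "hbase (\<lambda>z w. f w)"
  proof (rule hbaseI)
    fix R
    have "compact (f ` cball 0 R)"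
      by (intro compact_continuous_image continuous_on_subset[OF holomorphic_on_imp_continuous_on[OF base]]) auto
    hence "bounded (f ` cball 0 R)" by (rule compact_imp_bounded)
    then obtain C where C: "\<forall>x\<in>f ` cball 0 R. norm x \<le> C" unfolding bounded_iff by blast
    hence "norm (f w) \<le> C" if "norm w \<le> R" for w using that by simp
    thus "\<exists>C r. r \<ge> 0 \<and> (\<forall>z\<in>UHP. \<forall>w. norm w \<le> R \<longrightarrow> norm (f w) \<le> C * hgt z powr r)"
      using hgt_bounds(1) by (intro exI[of _ C] exI[of _ 0]) force
  qed (rule base)
  thus ?case by simp
next
  case (Suc n)
  have "hfam n (\<lambda>z w. 0)" by (rule Suc.IH) simp
  moreover have "hbase (\<lambda>z w. f w)" using Suc.IH[OF Suc.prems] by (rule hfam_imp_hbase)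
  ultimately show ?case by (intro hfam_SucI[of _ _ "\<lambda>z w. 0" "\<lambda>z w. 0"] wderiv_const)
qed

lemma hfam_cmult: "hfam n g \<Longrightarrow> hfam n (\<lambda>z w. c * g z w)"
  by (rule hfam_mult[OF hfam_entire]) auto

lemma wderiv_Im_powi:
  assumes z: "z \<in> UHP"
  shows "wderiv (\<lambda>z. of_real (Im z) powi a) (of_int a / (2 * \<i>) * of_real (Im z) powi (a - 1)) (- of_int a / (2 * \<i>) * of_real (Im z) powi (a - 1)) z"
proof -
  have "of_real (Im z) \<noteq> (0::complex)" using z by (simp add: UHP_def)
  hence "((\<lambda>w. w powi a) has_field_derivative of_int a * of_real (Im z) powi (a - 1)) (at (of_real (Im z)))"
    by (auto intro!: derivative_eq_intros)
  from wderiv_eq[OF wderiv_compose_field[OF wderiv_Im this]] show ?thesis by simp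
qed

lemma hfam_Im_powi: "hfam n (\<lambda>z w. of_real (Im z) powi a)"
proof (induction n arbitrary: a)
  case 0
  have "hbase (\<lambda>z w. complex_of_real (Im z) powi a)"
  proof (rule hbaseI)
    show "\<exists>C r. r \<ge> 0 \<and> (\<forall>z\<in>UHP. \<forall>w. norm w \<le> R \<longrightarrow> norm (complex_of_real (Im z) powi a) \<le> C * hgt z powr r)" for R :: real
      using powi_Im_bound[OF _ order.refl, of _ a] by (intro exI[of _ 1] exI[of _ "\<bar>of_int a\<bar>"]) auto
  qed auto
  thus ?case by simp
next
  case (Suc n)
  have 1: "hfam n (\<lambda>z w. of_int a / (2 * \<i>) * of_real (Im z) powi (a - 1))" "hfam n (\<lambda>z w. - of_int a / (2 * \<i>) * of_real (Im z) powi (a - 1))"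
    by (intro hfam_cmult Suc.IH)+
  have 2: "hbase (\<lambda>z w. complex_of_real (Im z) powi a)" by (rule hfam_imp_hbase[OF Suc.IH])
  show ?case by (rule hfam_SucI[OF 2 1 wderiv_Im_powi])
qed

text \<open>Needed for the shift w = s + j and for the reflection 1 - w.\<close>

lemma hfam_compose_affine: "hfam n g \<Longrightarrow> hfam n (\<lambda>z w. g z (a * w + b))"
proof (induction n arbitrary: g)
  case 0
  hence g: "hbase g" by simp
  have "hbase (\<lambda>z w. g z (a * w + b))"
  proof (rule hbaseI)
    show "(\<lambda>w. g z (a * w + b)) holomorphic_on UNIV" if "z \<in> UHP" for z
    proof -
      have "g z holomorphic_on UNIV" using g that by (simp add: hbase_def)
      hence "(g z \<circ> (\<lambda>w. a * w + b)) holomorphic_on UNIV"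
        by (rule holomorphic_on_compose_gen[rotated]) (auto intro!: holomorphic_intros)
      thus ?thesis by (simp add: o_def)
    qed
    fix R
    obtain C r where C: "r \<ge> 0" "C \<ge> 0" "\<And>z w. z \<in> UHP \<Longrightarrow> norm w \<le> norm a * R + norm b \<Longrightarrow> norm (g z w) \<le> C * hgt z powr r"
      by (rule hbase_bound[OF g, where R = "norm a * R + norm b"]) (rule that)
    have "norm (g z (a * w + b)) \<le> C * hgt z powr r" if "z \<in> UHP" "norm w \<le> R" for z w
      using that by (intro C norm_triangle_le add_right_mono) (auto simp: norm_mult mult_left_mono)
    thus "\<exists>C r. r \<ge> 0 \<and> (\<forall>z\<in>UHP. \<forall>w. norm w \<le> R \<longrightarrow> norm (g z (a * w + b)) \<le> C * hgt z powr r)"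
      using C(1) by blast
  qed
  thus ?case by simp
next
  case (Suc n)
  obtain A B where AB: "hfam n A" "hfam n B" "\<And>z w. z \<in> UHP \<Longrightarrow> wderiv (\<lambda>z. g z w) (A z w) (B z w) z"
    using Suc.prems(1) by (rule hfam_SucE) (rule that)
  have "hbase (\<lambda>z w. g z (a * w + b))"
    by (rule hfam_imp_hbase[OF Suc.IH[OF hfam_SucD[OF Suc.prems]]])
  thus ?case by (rule hfam_SucI[OF _ Suc.IH[OF AB(1)] Suc.IH[OF AB(2)] AB(3)])
qed

section \<open>Exchanging d/dw with derivatives in z\<close>

text \<open>Cauchy's estimate on unit circles bounds the second derivative near w by 2! C, and two
  mean value estimates give the error. It depends on f only through its supremum on a disc, hence is
  uniform over families bounded in z; the radius exceeds |w| by 2 because a unit circle around a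
  point at distance 1 must fit.\<close>

lemma difference_quotient_bound:
  assumes f: "f holomorphic_on UNIV" and C: "\<And>x. norm x \<le> norm w + 2 \<Longrightarrow> norm (f x) \<le> C"
    and h: "h \<noteq> 0" "norm h \<le> 1"
  shows "norm ((f (w + h) - f w) / h - deriv f w) \<le> 2 * C * norm h"
proof -
  have f1: "deriv f holomorphic_on UNIV" by (rule holomorphic_deriv[OF f open_UNIV])
  have C0: "C \<ge> 0" using order_trans[OF norm_ge_zero C[of w]] by simp
  have d2: "norm (deriv (deriv f) x) \<le> 2 * C" if x: "x \<in> cball w 1" for x
  proof -
    have "norm ((deriv ^^ 2) f x) \<le> fact 2 * C / 1 ^ 2"
    proof (rule Cauchy_inequality)
      show "norm (f y) \<le> C" if "norm (x - y) = 1" for y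
      proof (rule C)
        have "norm y \<le> norm w + norm (x - w) + norm (y - x)"
          using norm_triangle_le[of w "x - w"] norm_triangle_sub[of y x] norm_triangle_sub[of x w] by linarith
        thus "norm y \<le> norm w + 2" using that x by (simp add: dist_norm norm_minus_commute)
      qed
      show "continuous_on (cball x 1) f"
        using holomorphic_on_imp_continuous_on[OF f] by (rule continuous_on_subset) auto
    qed (use f in \<open>auto intro: holomorphic_on_subset\<close>)
    thus ?thesis by (simp add: numeral_2_eq_2)
  qed
  have d1: "norm (deriv f x - deriv f w) \<le> 2 * C * norm (x - w)" if x: "x \<in> cball w 1" for x
  proof (rule field_differentiable_bound[of "cball w 1" _ "deriv (deriv f)"])
    show "(deriv f has_field_derivative deriv (deriv f) y) (at y within cball w 1)" for y
      by (rule has_field_derivative_at_within[OF holomorphic_derivI[OF f1 open_UNIV UNIV_I]])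
  qed (use x d2 in auto)
  have "norm ((f (w + h) - deriv f w * (w + h)) - (f w - deriv f w * w)) \<le> 2 * C * norm h * norm (w + h - w)"
  proof (rule field_differentiable_bound[of "cball w (norm h)" _ "\<lambda>x. deriv f x - deriv f w"])
    show "((\<lambda>x. f x - deriv f w * x) has_field_derivative deriv f y - deriv f w) (at y within cball w (norm h))" for y
    proof (rule has_field_derivative_at_within)
      note [derivative_intros] = holomorphic_derivI[OF f open_UNIV UNIV_I, of y]
      show "((\<lambda>x. f x - deriv f w * x) has_field_derivative deriv f y - deriv f w) (at y)"
        by (rule derivative_eq_intros refl)+ simp
    qed
    show "norm (deriv f y - deriv f w) \<le> 2 * C * norm h" if y: "y \<in> cball w (norm h)" for y
    proof -
      have "norm (deriv f y - deriv f w) \<le> 2 * C * norm (y - w)"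
        using y h by (intro d1) (auto simp: dist_norm)
      also have "\<dots> \<le> 2 * C * norm h"
        using y C0 by (intro mult_left_mono) (auto simp: dist_norm norm_minus_commute)
      finally show ?thesis .
    qed
  qed (auto simp: dist_norm)
  also have "(f (w + h) - deriv f w * (w + h)) - (f w - deriv f w * w) = ((f (w + h) - f w) / h - deriv f w) * h"
    using h by (simp add: field_simps)
  finally have "norm ((f (w + h) - f w) / h - deriv f w) * norm h \<le> 2 * C * norm h * norm h"
    by (simp add: norm_mult)
  thus ?thesis using h by simp
qed

lemma uniform_limit_difference_quotient:
  assumes A: "hbase A" and z0: "z0 \<in> UHP"
  shows "uniform_limit (ball z0 (Im z0 / 2)) (\<lambda>n z. (A z (w + of_real (inverse (real (Suc n)))) - A z w) / of_real (inverse (real (Suc n)))) (\<lambda>z. deriv (A z) w) sequentially"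
proof (rule uniform_limitI)
  fix e :: real assume e: "e > 0"
  obtain C r where C: "r \<ge> 0" "C \<ge> 0" "\<And>z x. z \<in> UHP \<Longrightarrow> norm x \<le> norm w + 2 \<Longrightarrow> norm (A z x) \<le> C * hgt z powr r"
    by (rule hbase_bound[OF A, where R = "norm w + 2"]) (rule that)
  define B where "B = 1 + norm z0 + Im z0 + 2 / Im z0"
  define K where "K = C * B powr r"
  have K: "norm (A z x) \<le> K" if "z \<in> ball z0 (Im z0 / 2)" "norm x \<le> norm w + 2" for z x
  proof -
    note z = hgt_ball[OF z0 that(1)]
    have "norm (A z x) \<le> C * hgt z powr r" by (rule C(3)[OF z(1) that(2)])
    also have "\<dots> \<le> K" unfolding K_def using C z hgt_bounds(1)[OF z(1)]
      by (intro mult_left_mono powr_mono2) (auto simp: B_def)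
    finally show ?thesis .
  qed
  have "(\<lambda>n. 2 * K * inverse (real (Suc n))) \<longlonglongrightarrow> 0"
    by (rule tendsto_mult_right_zero[OF LIMSEQ_inverse_real_of_nat])
  hence "\<forall>\<^sub>F n in sequentially. 2 * K * inverse (real (Suc n)) < e"
    using e by (rule order_tendstoD)
  thus "\<forall>\<^sub>F n in sequentially. \<forall>z\<in>ball z0 (Im z0 / 2). dist ((A z (w + of_real (inverse (real (Suc n)))) - A z w) / of_real (inverse (real (Suc n)))) (deriv (A z) w) < e"
  proof eventually_elim
    case (elim n)
    show ?case
    proof
      fix z assume z: "z \<in> ball z0 (Im z0 / 2)"
      have "norm ((A z (w + of_real (inverse (real (Suc n)))) - A z w) / of_real (inverse (real (Suc n))) - deriv (A z) w) \<le> 2 * K * norm (complex_of_real (inverse (real (Suc n))))"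
        using A hgt_ball(1)[OF z0 z] K[OF z] by (intro difference_quotient_bound) (auto simp: hbase_def norm_inverse inverse_le_1_iff simp del: of_nat_Suc)
      also have "norm (complex_of_real (inverse (real (Suc n)))) = inverse (real (Suc n))"
        unfolding norm_of_real by (rule abs_of_pos) simp
      finally show "dist ((A z (w + of_real (inverse (real (Suc n)))) - A z w) / of_real (inverse (real (Suc n)))) (deriv (A z) w) < e"
        using elim by (simp add: dist_norm)
    qed
  qed
qed

text \<open>d/dw is the limit of difference quotients, and those of \<open>A\<close> and
  \<open>B\<close> converge uniformly near z0 because \<open>hbase\<close> bounds them uniformly
  there. No mixed derivatives have to be examined directly.\<close>

lemma wderiv_deriv:
  assumes g: "hbase g" "hbase A" "hbase B" "\<And>z w. z \<in> UHP \<Longrightarrow> wderiv (\<lambda>z. g z w) (A z w) (B z w) z"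
    and z: "z0 \<in> UHP"
  shows "wderiv (\<lambda>z. deriv (g z) w) (deriv (A z0) w) (deriv (B z0) w) z0"
proof (rule wderiv_sequence[where f = "\<lambda>n z. (g z (w + of_real (inverse (real (Suc n)))) - g z w) / of_real (inverse (real (Suc n)))"])
  show "Im z0 / 2 > 0" using z by (simp add: UHP_def)
  fix z assume zb: "z \<in> ball z0 (Im z0 / 2)"
  note zU = hgt_ball(1)[OF z zb]
  show "wderiv (\<lambda>z. (g z (w + of_real (inverse (real (Suc n)))) - g z w) / of_real (inverse (real (Suc n))))
    ((A z (w + of_real (inverse (real (Suc n)))) - A z w) / of_real (inverse (real (Suc n)))) 
    ((B z (w + of_real (inverse (real (Suc n)))) - B z w) / of_real (inverse (real (Suc n)))) z" for n
    using wderiv_cmult[OF wderiv_add[OF g(4)[OF zU] wderiv_cmult[OF g(4)[OF zU]]], of "1 / of_real (inverse (real (Suc n)))" "w + of_real (inverse (real (Suc n)))" "-1" w]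
    by (simp add: divide_inverse mult.commute)
  show "(\<lambda>n. (g z (w + of_real (inverse (real (Suc n)))) - g z w) / of_real (inverse (real (Suc n)))) \<longlonglongrightarrow> deriv (g z) w"
    by (rule tendsto_uniform_limitI[OF uniform_limit_difference_quotient[OF g(1) z] zb])
qed (rule uniform_limit_difference_quotient[OF g(2) z] uniform_limit_difference_quotient[OF g(3) z])+

text \<open>Cauchy's estimate on a unit circle enlarges the disc in w by 1 and keeps the exponent of
  \<open>hgt\<close>.\<close>

lemma hbase_deriv:
  assumes g: "hbase g"
  shows "hbase (\<lambda>z. deriv (g z))"
proof (rule hbaseI)
  show "deriv (g z) holomorphic_on UNIV" if "z \<in> UHP" for z
    using g that by (auto simp: hbase_def intro!: holomorphic_deriv)
  fix R
  obtain C r where C: "r \<ge> 0" "C \<ge> 0" "\<And>z x. z \<in> UHP \<Longrightarrow> norm x \<le> R + 1 \<Longrightarrow> norm (g z x) \<le> C * hgt z powr r"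
    by (rule hbase_bound[OF g, where R = "R + 1"]) (rule that)
  have "norm (deriv (g z) w) \<le> C * hgt z powr r" if z: "z \<in> UHP" and w: "norm w \<le> R" for z w
  proof -
    have hol: "g z holomorphic_on UNIV" using g z by (simp add: hbase_def)
    have "norm ((deriv ^^ 1) (g z) w) \<le> fact 1 * (C * hgt z powr r) / 1 ^ 1"
    proof (rule Cauchy_inequality)
      show "norm (g z y) \<le> C * hgt z powr r" if "norm (w - y) = 1" for y
        using that w norm_triangle_sub[of y w] by (intro C z) (simp add: norm_minus_commute)
      show "continuous_on (cball w 1) (g z)"
        using holomorphic_on_imp_continuous_on[OF hol] by (rule continuous_on_subset) auto
    qed (use hol in \<open>auto intro: holomorphic_on_subset\<close>)
    thus ?thesis by simp
  qed
  thus "\<exists>C r. r \<ge> 0 \<and> (\<forall>z\<in>UHP. \<forall>w. norm w \<le> R \<longrightarrow> norm (deriv (g z) w) \<le> C * hgt z powr r)"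
    using C(1) by blast
qed

lemma hfam_deriv: "hfam n g \<Longrightarrow> hfam n (\<lambda>z. deriv (g z))"
proof (induction n arbitrary: g)
  case (Suc n)
  obtain A B where AB: "hfam n A" "hfam n B" "\<And>z w. z \<in> UHP \<Longrightarrow> wderiv (\<lambda>z. g z w) (A z w) (B z w) z"
    using Suc.prems(1) by (rule hfam_SucE) (rule that)
  show ?case
    by (rule hfam_SucI[OF hbase_deriv[OF hfam_imp_hbase[OF Suc.prems]] Suc.IH[OF AB(1)] Suc.IH[OF AB(2)]
        wderiv_deriv[OF hfam_imp_hbase[OF Suc.prems] hfam_imp_hbase[OF AB(1)] hfam_imp_hbase[OF AB(2)] AB(3)]])
qed (auto intro: hbase_deriv)

section \<open>Differential operators on smooth families\<close>

text \<open>Formulas are known on \<open>UHP\<close> only; since it is open, derivatives at its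
  points see nothing else.\<close>

lemma Dx_cong: "z \<in> UHP \<Longrightarrow> (\<And>z. z \<in> UHP \<Longrightarrow> f z = g z) \<Longrightarrow> Dx f z = Dx g z"
  and Dy_cong: "z \<in> UHP \<Longrightarrow> (\<And>z. z \<in> UHP \<Longrightarrow> f z = g z) \<Longrightarrow> Dy f z = Dy g z"
proof -
  assume z: "z \<in> UHP" and eq: "\<And>z. z \<in> UHP \<Longrightarrow> f z = g z"
  have "(f has_derivative D) (at z) \<longleftrightarrow> (g has_derivative D) (at z)" for D
    using has_derivative_transform_within_open[OF _ open_UHP z, of f D UNIV g]
      has_derivative_transform_within_open[OF _ open_UHP z, of g D UNIV f] eq by auto
  hence "frechet_derivative f (at z) = frechet_derivative g (at z)"
    unfolding frechet_derivative_def by simp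
  thus "Dx f z = Dx g z" "Dy f z = Dy g z" by (simp_all add: Dx_def Dy_def)
qed

lemma Delta_cong:
  assumes "z \<in> UHP" "\<And>z. z \<in> UHP \<Longrightarrow> f z = g z"
  shows "Delta k f z = Delta k g z"
proof -
  have 1: "Dx f z = Dx g z" "Dy f z = Dy g z" if "z \<in> UHP" for z
    using Dx_cong[OF that assms(2)] Dy_cong[OF that assms(2)] by auto
  have 2: "Dx (Dx f) z = Dx (Dx g) z" "Dy (Dy f) z = Dy (Dy g) z"
    by (rule Dx_cong[OF assms(1) 1(1)], assumption) (rule Dy_cong[OF assms(1) 1(2)])
  show ?thesis unfolding Delta_def 2 1[OF assms(1)] ..
qed

text \<open>The coinductive invariant is agreement on \<open>UHP\<close> with some smooth function;
  it passes to \<open>Dx\<close> and \<open>Dy\<close> by the congruence rules.\<close>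

lemma smooth_on_UHP_cong:
  assumes "smooth_on UHP f" "\<And>z. z \<in> UHP \<Longrightarrow> f z = g z"
  shows "smooth_on UHP g"
proof -
  define X where "X = (\<lambda>g. \<exists>f. smooth_on UHP f \<and> (\<forall>z\<in>UHP. f z = g z))"
  have "X g" using assms by (auto simp: X_def)
  thus ?thesis
  proof (coinduction arbitrary: g rule: smooth_on.coinduct)
    case (smooth_on g)
    then obtain f where f: "smooth_on UHP f" "\<And>z. z \<in> UHP \<Longrightarrow> f z = g z" by (auto simp: X_def)
    from f(1) have f': "\<forall>z\<in>UHP. f differentiable (at z)" "smooth_on UHP (Dx f)" "smooth_on UHP (Dy f)"
      by (auto elim: smooth_on.cases)
    have "g differentiable (at z)" if "z \<in> UHP" for z
    proof -
      obtain D where "(f has_derivative D) (at z)" using f'(1) \<open>z \<in> UHP\<close> by (auto simp: differentiable_def)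
      hence "(g has_derivative D) (at z)"
        by (rule has_derivative_transform_within_open[OF _ open_UHP \<open>z \<in> UHP\<close>]) (rule f(2))
      thus ?thesis by (auto simp: differentiable_def)
    qed
    moreover have "X (Dx g)" unfolding X_def
      by (intro exI[of _ "Dx f"] conjI f'(2) ballI Dx_cong f(2))
    moreover have "X (Dy g)" unfolding X_def
      by (intro exI[of _ "Dy f"] conjI f'(3) ballI Dy_cong f(2))
    ultimately show ?case by simp
  qed
qed

lemma HFI: "(\<And>n. hfam n g) \<Longrightarrow> HF g"
  and HFD: "HF g \<Longrightarrow> hfam n g"
  by (simp_all add: HF_def)

lemma HF_cong: "HF g \<Longrightarrow> (\<And>z w. z \<in> UHP \<Longrightarrow> g z w = h z w) \<Longrightarrow> HF h"
  by (rule HFI, rule hfam_cong[OF HFD])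

lemma HF_add: "HF g \<Longrightarrow> HF h \<Longrightarrow> HF (\<lambda>z w. g z w + h z w)"
  by (rule HFI, rule hfam_add; rule HFD)

lemma HF_mult: "HF g \<Longrightarrow> HF h \<Longrightarrow> HF (\<lambda>z w. g z w * h z w)"
  by (rule HFI, rule hfam_mult; rule HFD)

lemma HF_cmult: "HF g \<Longrightarrow> HF (\<lambda>z w. c * g z w)"
  by (rule HFI, rule hfam_cmult, rule HFD)

lemma HF_entire: "f holomorphic_on UNIV \<Longrightarrow> HF (\<lambda>z w. f w)"
  by (rule HFI, rule hfam_entire)

lemma HF_Im_powi: "HF (\<lambda>z w. of_real (Im z) powi a)"
  by (rule HFI, rule hfam_Im_powi)

lemma HF_compose_affine: "HF g \<Longrightarrow> HF (\<lambda>z w. g z (b * w + c))"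
  by (rule HFI, rule hfam_compose_affine, rule HFD)

lemma HF_deriv: "HF g \<Longrightarrow> HF (\<lambda>z. deriv (g z))"
  by (rule HFI, rule hfam_deriv, rule HFD)

lemma HF_higher_deriv: "HF g \<Longrightarrow> HF (\<lambda>z. (deriv ^^ n) (g z))"
proof (induction n)
  case (Suc n)
  from HF_deriv[OF Suc.IH[OF Suc.prems]] show ?case by simp
qed simp

lemma HF_hbase: "HF g \<Longrightarrow> hbase g"
  by (rule hfam_imp_hbase[OF HFD])

lemma HF_holomorphic: "HF g \<Longrightarrow> z \<in> UHP \<Longrightarrow> g z holomorphic_on UNIV"
  using HF_hbase[of g] by (simp add: hbase_def)

lemma HF_wderiv:
  assumes "HF g"
  obtains A B where "hbase A" "hbase B" "\<And>z w. z \<in> UHP \<Longrightarrow> wderiv (\<lambda>z. g z w) (A z w) (B z w) z"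
proof -
  have "hfam (Suc 0) g" by (rule HFD[OF assms])
  then obtain A B where "hbase g" "hfam 0 A" "hfam 0 B" "\<And>z w. z \<in> UHP \<Longrightarrow> wderiv (\<lambda>z. g z w) (A z w) (B z w) z"
    by (rule hfam_SucE) (rule that)
  thus ?thesis using that[of A B] by simp
qed

lemma HF_differentiable: "HF g \<Longrightarrow> z \<in> UHP \<Longrightarrow> (\<lambda>z. g z w) differentiable (at z)"
  by (rule HF_wderiv) (auto intro: wderiv_differentiable)

lemma HF_Dx: "HF g \<Longrightarrow> HF (\<lambda>z w. Dx (\<lambda>z. g z w) z)"
  and HF_Dy: "HF g \<Longrightarrow> HF (\<lambda>z w. Dy (\<lambda>z. g z w) z)"
proof -
  assume g: "HF g"
  have "hfam n (\<lambda>z w. Dx (\<lambda>z. g z w) z) \<and> hfam n (\<lambda>z w. Dy (\<lambda>z. g z w) z)" for n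
  proof -
    have "hfam (Suc n) g" by (rule HFD[OF g])
    then obtain A B where AB: "hbase g" "hfam n A" "hfam n B" "\<And>z w. z \<in> UHP \<Longrightarrow> wderiv (\<lambda>z. g z w) (A z w) (B z w) z"
      by (rule hfam_SucE) (rule that)
    have x: "A z w + B z w = Dx (\<lambda>z. g z w) z" and y: "\<i> * (A z w + (- 1) * B z w) = Dy (\<lambda>z. g z w) z" 
      if "z \<in> UHP" for z w
      using wderiv_Dx[OF AB(4)[OF that]] wderiv_Dy[OF AB(4)[OF that]] by simp_all
    show ?thesis
      by (rule conjI, rule hfam_cong[OF hfam_add[OF AB(2,3)] x], assumption, 
          rule hfam_cong[OF hfam_cmult[OF hfam_add[OF AB(2) hfam_cmult[OF AB(3)]]] y], assumption)
  qed
  thus "HF (\<lambda>z w. Dx (\<lambda>z. g z w) z)" "HF (\<lambda>z w. Dy (\<lambda>z. g z w) z)" unfolding HF_def by auto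
qed

text \<open>The slices of \<open>HF\<close> families at a fixed w are closed under \<open>Dx\<close>
  and \<open>Dy\<close>, which is the invariant for the coinduction.\<close>

lemma HF_smooth: 
  assumes "HF g"
  shows "smooth_on UHP (\<lambda>z. g z w)"
proof -
  define X where "X = (\<lambda>f. \<exists>g. HF g \<and> f = (\<lambda>z. g z w))"
  have "X (\<lambda>z. g z w)" using assms by (auto simp: X_def)
  thus ?thesis
  proof (coinduction arbitrary: g rule: smooth_on.coinduct)
    case (smooth_on g)
    then obtain h where h: "HF h" "(\<lambda>z. g z w) = (\<lambda>z. h z w)" by (auto simp: X_def)
    have "X (Dx (\<lambda>z. h z w))" unfolding X_def using HF_Dx[OF h(1)] by (intro exI conjI) auto
    moreover have "X (Dy (\<lambda>z. h z w))" unfolding X_def using HF_Dy[OF h(1)] by (intro exI conjI) auto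
    ultimately show ?case using HF_differentiable[OF h(1)] h(2)
      unfolding X_def by fastforce
  qed
qed

lemma HF_Dx_deriv:
  assumes g: "HF g" and z: "z \<in> UHP"
  shows "Dx (\<lambda>z. deriv (g z) w) z = deriv (\<lambda>w. Dx (\<lambda>z. g z w) z) w"
    and "Dy (\<lambda>z. deriv (g z) w) z = deriv (\<lambda>w. Dy (\<lambda>z. g z w) z) w"
proof -
  obtain A B where AB: "hbase A" "hbase B" "\<And>z w. z \<in> UHP \<Longrightarrow> wderiv (\<lambda>z. g z w) (A z w) (B z w) z"
    by (rule HF_wderiv[OF g]) (rule that)
  note d = wderiv_deriv[OF HF_hbase[OF g] AB z]
  have A: "A z field_differentiable at w" and B: "B z field_differentiable at w"
    using AB(1,2) z by (auto simp: hbase_def intro: holomorphic_on_imp_differentiable_at)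
  have "(\<lambda>w. Dx (\<lambda>z. g z w) z) = (\<lambda>w. A z w + B z w)" using wderiv_Dx[OF AB(3)[OF z]] by auto
  thus "Dx (\<lambda>z. deriv (g z) w) z = deriv (\<lambda>w. Dx (\<lambda>z. g z w) z) w"
    using wderiv_Dx[OF d] A B by simp
  have "(\<lambda>w. Dy (\<lambda>z. g z w) z) = (\<lambda>w. \<i> * (A z w - B z w))" using wderiv_Dy[OF AB(3)[OF z]] by auto
  thus "Dy (\<lambda>z. deriv (g z) w) z = deriv (\<lambda>w. Dy (\<lambda>z. g z w) z) w"
    using wderiv_Dy[OF d] A B by (simp add: field_differentiable_diff)
qed

lemma HF_Delta:
  assumes g: "HF g"
  shows "HF (\<lambda>z w. Delta k (\<lambda>z. g z w) z)"
proof -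
  have i: "HF (\<lambda>z w. of_real (Im z) powi 2 * (Dx (Dx (\<lambda>z. g z w)) z + Dy (Dy (\<lambda>z. g z w)) z) +
     (- \<i> * of_int k) * (of_real (Im z) powi 1 * (Dx (\<lambda>z. g z w) z + \<i> * Dy (\<lambda>z. g z w) z)))"
    by (intro HF_add HF_cmult HF_mult HF_Im_powi HF_Dx[OF g] HF_Dy[OF g] HF_Dx[OF HF_Dx[OF g]] HF_Dy[OF HF_Dy[OF g]])
  show ?thesis
    by (rule HF_cong[OF i]) (simp add: Delta_def)
qed

lemma HF_Delta_deriv:
  assumes g: "HF g" and z: "z \<in> UHP"
  shows "Delta k (\<lambda>z. deriv (g z) w) z = deriv (\<lambda>w. Delta k (\<lambda>z. g z w) z) w"
proof -
  have xx: "Dx (Dx (\<lambda>z. deriv (g z) w)) z = deriv (\<lambda>w. Dx (Dx (\<lambda>z. g z w)) z) w"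
    using Dx_cong[OF z HF_Dx_deriv(1)[OF g]] HF_Dx_deriv(1)[OF HF_Dx[OF g] z] by simp
  have yy: "Dy (Dy (\<lambda>z. deriv (g z) w)) z = deriv (\<lambda>w. Dy (Dy (\<lambda>z. g z w)) z) w"
    using Dy_cong[OF z HF_Dx_deriv(2)[OF g]] HF_Dx_deriv(2)[OF HF_Dy[OF g] z] by simp
  have d: "(h z has_field_derivative deriv (h z) w) (at w)" if "HF h" for h
    by (rule holomorphic_derivI[OF HF_holomorphic[OF that z] open_UNIV]) simp
  have "((\<lambda>w. Delta k (\<lambda>z. g z w) z) has_field_derivative Delta k (\<lambda>z. deriv (g z) w) z) (at w)"
    unfolding Delta_def xx yy HF_Dx_deriv[OF g z]
    by (intro DERIV_diff DERIV_cmult DERIV_add 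
        d[OF HF_Dx[OF g]] d[OF HF_Dy[OF g]] d[OF HF_Dx[OF HF_Dx[OF g]]] d[OF HF_Dy[OF HF_Dy[OF g]]])
  thus ?thesis by (rule DERIV_imp_deriv[symmetric])
qed

lemma HF_Delta_higher_deriv:
  assumes g: "HF g" and z: "z \<in> UHP"
  shows "Delta k (\<lambda>z. (deriv ^^ n) (g z) w) z = (deriv ^^ n) (\<lambda>w. Delta k (\<lambda>z. g z w) z) w"
proof (induction n arbitrary: w)
  case (Suc n)
  have "(\<lambda>w. Delta k (\<lambda>z. (deriv ^^ n) (g z) w) z) = (deriv ^^ n) (\<lambda>w. Delta k (\<lambda>z. g z w) z)"
    using Suc by blast
  thus ?case using HF_Delta_deriv[OF HF_higher_deriv[OF g] z, of k n w] by simp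
qed simp

text \<open>Translation moves the real part into [0, 1). There, for y >= 1, \<open>hgt\<close> is at
  most 1 + (1 + y) + 1 <= 4 y, so a bound by a power of \<open>hgt\<close> is one by a power of y,
  uniformly in x.\<close>

lemma HF_moderate_growth:
  assumes g: "HF g" and per: "\<And>z n. z \<in> UHP \<Longrightarrow> g (z + of_int n) w = g z w"
  shows "moderate_growth (\<lambda>z. g z w)"
proof -
  obtain C r where C: "r \<ge> 0" "C \<ge> 0" "\<And>z x. z \<in> UHP \<Longrightarrow> norm x \<le> norm w \<Longrightarrow> norm (g z x) \<le> C * hgt z powr r"
    by (rule hbase_bound[OF HF_hbase[OF g], where R = "norm w"]) (rule that)
  have "norm (g (Complex x y) w) \<le> C * 4 powr r * y powr r" if y: "y \<ge> 1" for x y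
  proof -
    define z where "z = Complex (x - of_int \<lfloor>x\<rfloor>) y"
    have z: "z \<in> UHP" using y by (simp add: z_def UHP_def)
    have "Complex x y = z + of_int \<lfloor>x\<rfloor>" by (simp add: z_def complex_eq_iff)
    hence "g (Complex x y) w = g z w" using per[OF z] by simp
    also have "norm (g z w) \<le> C * hgt z powr r" by (rule C(3)[OF z order.refl])
    also have "C * hgt z powr r \<le> C * (4 * y) powr r"
    proof (rule mult_left_mono[OF powr_mono2[OF C(1)] C(2)])
      have "norm z \<le> \<bar>x - of_int \<lfloor>x\<rfloor>\<bar> + \<bar>y\<bar>" using cmod_le[of z] by (simp add: z_def)
      also have "\<dots> \<le> 1 + y" using y by linarith
      finally have "norm z \<le> 1 + y" .
      moreover have "1 / y \<le> 1" using y by simp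
      moreover have "hgt z = 1 + norm z + 1 / y" by (simp add: hgt_def z_def)
      ultimately show "hgt z \<le> 4 * y" using y by linarith
    qed (use hgt_bounds(1)[OF z] in simp)
    finally show ?thesis using y by (simp add: powr_mult)
  qed
  thus ?thesis unfolding moderate_growth_def by (intro exI[of _ r] exI[of _ "C * 4 powr r"] exI[of _ 1]) auto
qed

section \<open>Lattice sums of incomplete Gamma functions as a smooth family\<close>

text \<open>The power of q compensates the shift of w: for fixed w all b share the same order of
  decay, and the Euler operator maps the family to itself.\<close>

definition kpsi :: "nat \<Rightarrow> complex \<Rightarrow> real \<Rightarrow> complex" where
  "kpsi b w q = of_real q ^ b * psi (w + of_nat b) (of_real q)"

lemma kpsi_bound:
  assumes w: "Re w \<le> real n - 1" and q: "q > 0"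
  shows "norm (kpsi b w q) \<le> fact (n + b) / pi ^ (n + b) * q powr (- real n)"
proof -
  have "norm (psi (w + of_nat b) (of_real q)) \<le> fact (n + b) / (pi * q) ^ (n + b)"
    using psi_bound(2)[of "w + of_nat b" "n + b" "of_real q"] w q by simp
  hence "norm (kpsi b w q) \<le> q ^ b * (fact (n + b) / (pi * q) ^ (n + b))"
    unfolding kpsi_def norm_mult using q by (intro mult_mono) (auto simp: norm_power)
  also have "\<dots> = fact (n + b) / pi ^ (n + b) * q powr (- real n)"
    using q by (simp add: powr_minus powr_realpow power_mult_distrib power_add divide_simps)
  finally show ?thesis .
qed

lemma decays_kpsi: "Re w \<le> real n - 1 \<Longrightarrow> decays (kpsi b w) (real n)"
  unfolding decays_def using kpsi_bound by blast

definition kpsi' :: "nat \<Rightarrow> complex \<Rightarrow> real \<Rightarrow> complex" where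
  "kpsi' b w q = of_nat b * of_real q ^ (b - 1) * psi (w + of_nat b) (of_real q) - pi * (of_real q ^ b * psi (w + of_nat (Suc b)) (of_real q))"

lemma kpsi_deriv: 
  assumes q: "q > 0" 
  shows "(kpsi b w has_vector_derivative kpsi' b w q) (at q)"
proof -
  have p: "((\<lambda>x. psi (w + of_nat b) x) has_field_derivative (- pi * psi (w + of_nat b + 1) (of_real q))) (at (of_real q))"
    by (rule psi_deriv_q) (use q in simp)
  have "((\<lambda>x. x ^ b * psi (w + of_nat b) x) has_field_derivative kpsi' b w q) (at (of_real q))"
    by (rule DERIV_cong[OF DERIV_mult[OF DERIV_power[OF DERIV_ident] p]]) (simp add: kpsi'_def algebra_simps)
  thus ?thesis unfolding kpsi_def by (rule has_vector_derivative_real_field)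
qed

lemma euler_kpsi: "euler_op (kpsi' b w) q = of_nat b * kpsi b w q + (- pi) * kpsi (Suc b) w q"
  by (cases b) (simp_all add: euler_op_def kpsi'_def kpsi_def algebra_simps)

lemma decays_lin:
  assumes "decays f M" "decays g M"
  shows "decays (\<lambda>q. c * f q + d * g q) M"
proof -
  obtain C where C: "\<And>q. q > 0 \<Longrightarrow> norm (f q) \<le> C * q powr (-M)"
    using assms(1) by (auto simp: decays_def)
  obtain C' where C': "\<And>q. q > 0 \<Longrightarrow> norm (g q) \<le> C' * q powr (-M)"
    using assms(2) by (auto simp: decays_def)
  have "norm (c * f q + d * g q) \<le> (norm c * C + norm d * C') * q powr (-M)" if "q > 0" for q
  proof -
    have "norm (c * f q + d * g q) \<le> norm c * (C * q powr (-M)) + norm d * (C' * q powr (-M))"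
      by (intro norm_triangle_le add_mono) (auto simp: norm_mult intro!: mult_left_mono C C' that)
    thus ?thesis by (simp add: algebra_simps)
  qed
  thus ?thesis unfolding decays_def by blast
qed

lemma wderiv_lsum_kpsi:
  assumes z: "z \<in> UHP"
  shows "wderiv (\<lambda>z. lsum a j (kpsi b w) z)
    (1 / (2 * \<i>) * (of_int (a - j) * lsum (a - 1) j (kpsi b w) z + of_int j * lsum (a - 1) (j + 1) (kpsi b w) z - (of_nat b * lsum (a - 1) (j + 1) (kpsi b w) z + (- pi) * lsum (a - 1) (j + 1) (kpsi (Suc b) w) z)))
    (1 / (2 * \<i>) * ((of_nat b * lsum (a - 1) (j - 1) (kpsi b w) z + (- pi) * lsum (a - 1) (j - 1) (kpsi (Suc b) w) z) - of_int (a + j) * lsum (a - 1) j (kpsi b w) z + of_int j * lsum (a - 1) (j - 1) (kpsi b w) z)) z"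
proof -
  obtain n where "\<bar>Re w\<bar> + 2 \<le> real n" using real_arch_simple by blast
  hence n: "Re w \<le> real n - 1" "real n > 1" by auto
  note d = decays_kpsi[OF n(1)]
  have e: "euler_op (kpsi' b w) = (\<lambda>q. of_nat b * kpsi b w q + (- pi) * kpsi (Suc b) w q)"
    by (rule ext) (rule euler_kpsi)
  have e1: "lsum (a - 1) j' (euler_op (kpsi' b w)) z = of_nat b * lsum (a - 1) j' (kpsi b w) z + (- pi) * lsum (a - 1) j' (kpsi (Suc b) w) z" for j'
    unfolding e by (rule lsum_lin[OF z n(2) d d])
  have "decays (euler_op (kpsi' b w)) (real n)" unfolding e by (rule decays_lin[OF d d])
  from wderiv_lsum[OF z n(2) kpsi_deriv d this, of a j]
  show ?thesis unfolding e1 .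
qed

lemma hbase_lsum_kpsi: "hbase (\<lambda>z w. lsum a j (kpsi b w) z)"
proof (rule hbaseI)
  fix z assume z: "z \<in> UHP"
  have M: "\<exists>M. summable M \<and> (\<forall>i. \<forall>w. norm w \<le> R \<longrightarrow> norm (lterm a j (kpsi b w) z (lat i)) \<le> M i)" for R
  proof -
    obtain n where "\<bar>R\<bar> + 2 \<le> real n" using real_arch_simple by blast
    hence n: "R \<le> real n - 1" "real n > 1" by auto
    have "norm (lterm a j (kpsi b w) z (lat i)) \<le> hgt z powr \<bar>of_int a\<bar> * (fact (n + b) / pi ^ (n + b) * ((5 * hgt z ^ 3) powr real n * lsize i powr (- real n)))"
      if "norm w \<le> R" for i w
    proof (rule lterm_bound[OF z order.refl])
      have "Re w \<le> real n - 1" using that complex_Re_le_cmod[of w] n by linarith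
      thus "norm (kpsi b w q) \<le> fact (n + b) / pi ^ (n + b) * q powr (- real n)" if "q > 0" for q
        using kpsi_bound that by blast
    qed simp
    thus ?thesis using summable_lterm_bound[OF n(2)] by blast
  qed
  show "(\<lambda>w. lsum a j (kpsi b w) z) holomorphic_on UNIV"
    unfolding lsum_def
  proof (rule holomorphic_uniform_sequence)
    show "(\<lambda>w. \<Sum>i<n. lterm a j (kpsi b w) z (lat i)) holomorphic_on UNIV" for n
    proof -
      have 1: "(\<lambda>w. psi (w + of_nat b) (of_real (quad z (lat i)))) holomorphic_on UNIV" for i
      proof -
        have "((\<lambda>w. psi w (of_real (quad z (lat i)))) \<circ> (\<lambda>w. w + of_nat b)) holomorphic_on UNIV"
          by (rule holomorphic_on_compose_gen[OF _ psi_holomorphic]) (use quad_lat_pos[OF z] in \<open>auto intro!: holomorphic_intros\<close>)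
        thus ?thesis by (simp add: o_def)
      qed
      show ?thesis unfolding lterm_def kpsi_def
        by (intro holomorphic_on_sum holomorphic_on_mult holomorphic_on_const 1)
    qed
    show "\<exists>d>0. cball x d \<subseteq> UNIV \<and> uniform_limit (cball x d) (\<lambda>n w. \<Sum>i<n. lterm a j (kpsi b w) z (lat i)) (\<lambda>w. \<Sum>i. lterm a j (kpsi b w) z (lat i)) sequentially" for x
    proof -
      obtain M where M: "summable M" "\<And>i w. norm w \<le> norm x + 1 \<Longrightarrow> norm (lterm a j (kpsi b w) z (lat i)) \<le> M i"
        using M[of "norm x + 1"] by blast
      have "uniform_limit (cball x 1) (\<lambda>n w. \<Sum>i<n. lterm a j (kpsi b w) z (lat i)) (\<lambda>w. \<Sum>i. lterm a j (kpsi b w) z (lat i)) sequentially"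
      proof (rule Weierstrass_m_test[OF _ M(1)])
        fix i w assume w: "w \<in> cball x 1"
        have "norm w \<le> norm x + 1" using w norm_triangle_sub[of w x] by (simp add: dist_norm norm_minus_commute)
        thus "norm (lterm a j (kpsi b w) z (lat i)) \<le> M i" by (rule M(2))
      qed
      thus ?thesis by (intro exI[of _ 1]) auto
    qed
  qed simp
next
  fix R
  obtain n where "\<bar>R\<bar> + 2 \<le> real n" using real_arch_simple by blast
  hence n: "R \<le> real n - 1" "real n > 1" by auto
  have "norm (lsum a j (kpsi b w) z) \<le> fact (n + b) / pi ^ (n + b) * (5 powr real n * (\<Sum>i. lsize i powr (- real n))) * hgt z powr (\<bar>of_int a\<bar> + 3 * real n)"
    if "z \<in> UHP" "norm w \<le> R" for z w
  proof (rule lsum_bound[OF that(1) n(2)])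
    have "Re w \<le> real n - 1" using that complex_Re_le_cmod[of w] n by linarith
    thus "norm (kpsi b w q) \<le> fact (n + b) / pi ^ (n + b) * q powr (- real n)" if "q > 0" for q
      using kpsi_bound that by blast
  qed
  thus "\<exists>C r. r \<ge> 0 \<and> (\<forall>z\<in>UHP. \<forall>w. norm w \<le> R \<longrightarrow> norm (lsum a j (kpsi b w) z) \<le> C * hgt z powr r)"
    by (intro exI[of _ "fact (n + b) / pi ^ (n + b) * (5 powr real n * (\<Sum>i. lsize i powr (- real n)))"] exI[of _ "\<bar>of_int a\<bar> + 3 * real n"]) auto
qed

lemma hfam_diff: "hfam n g \<Longrightarrow> hfam n h \<Longrightarrow> hfam n (\<lambda>z w. g z w - h z w)"
  using hfam_add[OF _ hfam_cmult[of n h "-1"]] by simp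

text \<open>All of a, j and b change under differentiation, so the induction over the order has to
  quantify over them.\<close>

lemma HF_lsum_kpsi: "HF (\<lambda>z w. lsum a j (kpsi b w) z)"
proof -
  have "hfam n (\<lambda>z w. lsum a j (kpsi b w) z)" for n
  proof (induction n arbitrary: a j b)
    case 0
    show ?case by (simp add: hbase_lsum_kpsi)
  next
    case (Suc n)
    show ?case
      by (rule hfam_SucI[OF hbase_lsum_kpsi _ _ wderiv_lsum_kpsi])
         (intro hfam_cmult hfam_add hfam_diff Suc.IH)+
  qed
  thus ?thesis by (simp add: HF_def)
qed

section \<open>The continued Eisenstein series\<close>

abbreviation pw :: "complex \<Rightarrow> real \<Rightarrow> complex" where
  "pw w \<equiv> (\<lambda>q. of_real q powr (-w))"

lemma lsum_eq_infsum:
  assumes "z \<in> UHP" "M > 1" "decays \<phi> M"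
  shows "lsum a j \<phi> z = (\<Sum>\<^sub>\<infinity>v\<in>UNIV - {(0, 0)}. lterm a j \<phi> z v)"
proof -
  have "(\<Sum>\<^sub>\<infinity>v\<in>UNIV - {(0, 0)}. lterm a j \<phi> z v) = (\<Sum>\<^sub>\<infinity>i. lterm a j \<phi> z (lat i))"
    by (rule infsum_reindex_bij_betw[OF bij_betw_lat, symmetric])
  also have "\<dots> = lsum a j \<phi> z"
    unfolding lsum_def
    by (rule infsumI, rule norm_summable_imp_has_sum[OF summable_norm_lterm[OF assms]], rule summable_sums[OF summable_lterm[OF assms]])
  finally show ?thesis ..
qed

lemma powr_of_pos_real: "r > 0 \<Longrightarrow> complex_of_real r powr c = exp (c * of_real (ln r))"
  by (simp add: powr_def Ln_of_real)

text \<open>With w = s + j: |N|^(2j) = N^j (cnj N)^j trades part of |N|^(-2w) for the phase U^j,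
  leaving N^(-2j) |N|^(-2s).\<close>

lemma lterm_pw:
  assumes z: "z \<in> UHP" and v: "v \<noteq> (0, 0)"
  shows "lterm (- j) j (pw w) z v = of_real (Im z) powr (w - of_int j) / (lin z v powi (2 * j) * of_real (cmod (lin z v)) powr (2 * (w - of_int j)))"
proof -
  define N where "N = lin z v"
  define y where "y = Im z"
  have y: "y > 0" using z by (simp add: y_def UHP_def)
  have N: "N \<noteq> 0" using lin_nonzero[OF z v] by (simp add: N_def)
  have cN: "cnj N \<noteq> 0" using N by simp
  have nN: "cmod N > 0" using N by simp
  have 1: "complex_of_real y powr (w - of_int j) = of_real y powr w * of_real y powi (- j)"
    using y by (simp add: powr_diff complex_powr_of_int power_int_minus divide_inverse)
  have "complex_of_real (cmod N) powi (2 * j) = (of_real (cmod N) powi 2) powi j"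
    by (rule power_int_mult)
  also have "of_real (cmod N) powi 2 = N * cnj N"
    using complex_norm_square[of N] by simp
  finally have "complex_of_real (cmod N) powi (2 * j) = N powi j * cnj N powi j"
    by (simp add: power_int_mult_distrib)
  hence 2: "complex_of_real (cmod N) powr (2 * (w - of_int j)) = of_real (cmod N) powr (2 * w) / (N powi j * cnj N powi j)"
    using N complex_powr_of_int[of "of_real (cmod N)" "2 * j"] by (simp add: right_diff_distrib powr_diff)
  \<comment> \<open>All bases are positive reals, so the powers become exponentials of real
    logarithms and branches are no issue.\<close>
  have lnq: "ln (quad z v) = 2 * ln (cmod N) - ln y"
    using y nN by (simp add: quad_def N_def[symmetric] lin_def[symmetric] y_def[symmetric] ln_div ln_realpow)
  have 3: "complex_of_real (quad z v) powr (-w) = of_real y powr w / of_real (cmod N) powr (2 * w)"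
    using y nN quad_pos[OF z v] by (simp add: powr_of_pos_real lnq exp_diff[symmetric] algebra_simps)
  have 4: "N powi (2 * j) = N powi j * N powi j"
    unfolding mult_2 using N by (intro power_int_add) auto
  have nz: "N powi j \<noteq> 0" "cnj N powi j \<noteq> 0" "complex_of_real (cmod N) powr (2 * w) \<noteq> 0"
    using N by (auto simp: powr_def)
  have "lterm (- j) j (pw w) z v = of_real y powi (- j) * (cnj N powi j / N powi j) * (of_real y powr w / of_real (cmod N) powr (2 * w))"
    unfolding lterm_def 3 by (simp add: N_def y_def power_int_divide_distrib)
  also have "\<dots> = of_real y powr w * of_real y powi (- j) / (N powi j * N powi j * (of_real (cmod N) powr (2 * w) / (N powi j * cnj N powi j)))"
    using nz by (simp add: field_simps)
  finally show ?thesis unfolding N_def[symmetric] y_def[symmetric] 1 2 4 .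
qed

lemma EisE_eq_lsum:
  assumes z: "z \<in> UHP" and w: "Re w > 1"
  shows "EisE (2 * j) z (w - of_int j) = lsum (- j) j (pw w) z / 2"
proof -
  have "EisE (2 * j) z (w - of_int j) = 1 / 2 * (\<Sum>\<^sub>\<infinity>v\<in>UNIV - {(0, 0)}. lterm (- j) j (pw w) z v)"
    unfolding EisE_def
    by (rule arg_cong[where f = "\<lambda>x. 1 / 2 * x"], rule infsum_cong) 
       (auto simp: lterm_pw[OF z] lin_def split: prod.splits)
  thus ?thesis using lsum_eq_infsum[OF z w decays_powr, of "-j" j] by simp
qed

text \<open>A power is an eigenfunction of the Euler operator, with eigenvalue -w; the two sums with
  index j + 1, and likewise those with j - 1, therefore merge.\<close>

lemma wderiv_lsum_pw:
  assumes z: "z \<in> UHP" and w: "Re w > 1"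
  shows "wderiv (\<lambda>z. lsum a j (pw w) z)
    (1 / (2 * \<i>) * (of_int (a - j) * lsum (a - 1) j (pw w) z + (of_int j + w) * lsum (a - 1) (j + 1) (pw w) z))
    (1 / (2 * \<i>) * ((of_int j - w) * lsum (a - 1) (j - 1) (pw w) z - of_int (a + j) * lsum (a - 1) j (pw w) z)) z"
proof -
  define d where "d = (\<lambda>q::real. - w * complex_of_real q powr (- w - 1))"
  have dv: "(pw w has_vector_derivative d q) (at q)" if q: "q > 0" for q
  proof -
    have "((\<lambda>x. x powr (- w)) has_field_derivative d q) (at (complex_of_real q))"
      unfolding d_def by (rule has_field_derivative_powr) (use q in auto)
    thus ?thesis by (rule has_vector_derivative_real_field)
  qed
  have e: "euler_op d q = - w * pw w q" if "q > 0" for q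
    using that by (simp add: euler_op_def d_def powr_diff)
  have dec: "decays (euler_op d) (Re w)"
    unfolding decays_def
    by (rule exI[of _ "norm w"]) (simp add: e norm_mult norm_powr_real_powr)
  have el: "lsum a' j' (euler_op d) z = - w * lsum a' j' (pw w) z" for a' j'
  proof -
    have "lsum a' j' (euler_op d) z = lsum a' j' (\<lambda>q. - w * pw w q) z" by (rule lsum_cong[OF z e])
    also have "\<dots> = - w * lsum a' j' (pw w) z" by (rule lsum_cmult[OF z w decays_powr])
    finally show ?thesis .
  qed
  show ?thesis
    by (rule wderiv_eq[OF wderiv_lsum[OF z w dv decays_powr dec]]) (simp_all add: el algebra_simps)
qed

text \<open>The bridge from the half-plane of convergence to all w; each identity for the continued
  series passes through it or a consequence of it.\<close>

lemma entire_eqI: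
  fixes f g :: "complex \<Rightarrow> complex"
  assumes "f holomorphic_on UNIV" "g holomorphic_on UNIV" "\<And>w. Re w > c \<Longrightarrow> f w = g w"
  shows "f w = g w"
proof (rule analytic_continuation_open[of "{w. Re w > c}" UNIV f g])
  have "Complex (c + 1) 0 \<in> {w. Re w > c}" by simp
  thus "{w. Re w > c} \<noteq> {}" by blast
qed (use assms in \<open>auto simp: open_halfspace_Re_gt\<close>)

text \<open>
  The completion factor in the variable \<open>w\<close>, including the factor \<open>1 / 2\<close> of the series.
\<close>
definition ecoef :: "int \<Rightarrow> complex \<Rightarrow> complex" where
  "ecoef j w = w * (w - 1) * of_real pi powr (- w) * Gamma (w + of_int \<bar>j\<bar>) / 2"

text \<open>A specification instead of a formula: it determines g on \<open>UHP\<close>, so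
  whichever construction is convenient (in weight 2, raising from weight 0) may replace
  another.\<close>

definition Eis :: "int \<Rightarrow> (complex \<Rightarrow> complex \<Rightarrow> complex) \<Rightarrow> bool" where
  "Eis j g \<longleftrightarrow> HF g \<and> (\<forall>z\<in>UHP. \<forall>w. g z (1 - w) = g z w) \<and>
     (\<forall>z\<in>UHP. \<forall>w. Re w > 1 \<longrightarrow> g z w = ecoef j w * lsum (- j) j (pw w) z)"

lemma Eis_unique:
  assumes "Eis j g" "Eis j h" "z \<in> UHP"
  shows "g z w = h z w"
proof (rule entire_eqI[of "g z" "h z" 1])
  show "g z holomorphic_on UNIV" "h z holomorphic_on UNIV"
    using assms by (auto simp: Eis_def intro: HF_holomorphic)
qed (use assms in \<open>auto simp: Eis_def\<close>)

lemma kpsi_0: "kpsi 0 w = (\<lambda>q. psi w (of_real q))"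
  by (simp add: kpsi_def fun_eq_iff)

text \<open>w (w - 1) / 2 times 1/(w - 1) - 1/w is 1/2: the completion turns the polar part of
  \<open>lsum_mellin\<close> into the final constant.\<close>

definition eis0 :: "complex \<Rightarrow> complex \<Rightarrow> complex" where
  "eis0 z w = w * (w - 1) / 2 * (lsum 0 0 (kpsi 0 w) z + lsum 0 0 (kpsi 0 (1 - w)) z) + 1 / 2"

lemma Eis_eis0: "Eis 0 eis0"
  unfolding Eis_def
proof (intro conjI ballI allI impI)
  have "HF (\<lambda>z w. w * (w - 1) / 2 * (lsum 0 0 (kpsi 0 w) z + lsum 0 0 (kpsi 0 ((-1) * w + 1)) z) + 1 / 2)"
    by (intro HF_add HF_mult HF_lsum_kpsi HF_entire HF_compose_affine[OF HF_lsum_kpsi]) (auto intro!: holomorphic_intros)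
  thus "HF eis0" by (rule HF_cong) (simp add: eis0_def)
  fix z w assume z: "z \<in> UHP"
  show "eis0 z (1 - w) = eis0 z w" by (simp add: eis0_def algebra_simps)
  assume w: "Re w > 1"
  hence w0: "w \<noteq> 0" "w - 1 \<noteq> 0" by auto
  define P where "P = Gamma w * of_real pi powr (-w) * lsum 0 0 (pw w) z"
  have "lsum 0 0 (kpsi 0 w) z + lsum 0 0 (kpsi 0 (1 - w)) z = P - 1 / (w - 1) + 1 / w"
    using lsum_mellin[OF z w] by (simp add: kpsi_0 P_def)
  hence "eis0 z w = w * (w - 1) / 2 * (P - 1 / (w - 1) + 1 / w) + 1 / 2" by (simp add: eis0_def)
  also have "\<dots> = w * (w - 1) / 2 * P"
    using w0 by (simp add: field_simps)
  also have "\<dots> = ecoef 0 w * lsum (- 0) 0 (pw w) z"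
    by (simp add: P_def ecoef_def)
  finally show "eis0 z w = ecoef 0 w * lsum (- 0) 0 (pw w) z" .
qed

text \<open>At w = 0 and w = 1 the prefactor kills both lattice sums. These constants, traces of the
  poles, decide weights 0 and 2.\<close>

lemma Eis_0_values:
  assumes "Eis 0 g" "z \<in> UHP"
  shows "g z 0 = 1 / 2" "g z 1 = 1 / 2"
  using Eis_unique[OF assms(1) Eis_eis0 assms(2)] by (simp_all add: eis0_def)

section \<open>Raising and lowering operators\<close>

definition raise_op :: "int \<Rightarrow> (complex \<Rightarrow> complex \<Rightarrow> complex) \<Rightarrow> complex \<Rightarrow> complex \<Rightarrow> complex" where
  "raise_op j g z w = \<i> * (Dx (\<lambda>z. g z w) z - \<i> * Dy (\<lambda>z. g z w) z) + of_int (2 * j) * (of_real (Im z) powi (-1) * g z w)"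

definition lower_op :: "(complex \<Rightarrow> complex \<Rightarrow> complex) \<Rightarrow> complex \<Rightarrow> complex \<Rightarrow> complex" where
  "lower_op g z w = - \<i> * (of_real (Im z) powi 2 * (Dx (\<lambda>z. g z w) z + \<i> * Dy (\<lambda>z. g z w) z))"

lemma HF_raise_op:
  assumes "HF g"
  shows "HF (raise_op j g)"
proof -
  have "HF (\<lambda>z w. \<i> * (Dx (\<lambda>z. g z w) z + (- \<i>) * Dy (\<lambda>z. g z w) z) + of_int (2 * j) * (of_real (Im z) powi (-1) * g z w))"
    by (intro HF_add HF_cmult HF_mult HF_Im_powi HF_Dx HF_Dy assms)
  thus ?thesis by (rule HF_cong) (simp add: raise_op_def)
qed

lemma HF_lower_op:
  assumes "HF g"
  shows "HF (lower_op g)"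
proof -
  have "HF (\<lambda>z w. - \<i> * (of_real (Im z) powi 2 * (Dx (\<lambda>z. g z w) z + \<i> * Dy (\<lambda>z. g z w) z)))"
    by (intro HF_add HF_cmult HF_mult HF_Im_powi HF_Dx HF_Dy assms)
  thus ?thesis by (rule HF_cong) (simp add: lower_op_def)
qed

lemma raise_op_cong:
  assumes "z \<in> UHP" "\<And>z. z \<in> UHP \<Longrightarrow> g z w = h z w'"
  shows "raise_op j g z w = raise_op j h z w'"
proof -
  have "Dx (\<lambda>z. g z w) z = Dx (\<lambda>z. h z w') z" "Dy (\<lambda>z. g z w) z = Dy (\<lambda>z. h z w') z"
    using Dx_cong[OF assms] Dy_cong[OF assms] by simp_all
  thus ?thesis unfolding raise_op_def assms(2)[OF assms(1)] by simp
qed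

lemma lower_op_cong:
  assumes "z \<in> UHP" "\<And>z. z \<in> UHP \<Longrightarrow> g z w = h z w'"
  shows "lower_op g z w = lower_op h z w'"
proof -
  have "Dx (\<lambda>z. g z w) z = Dx (\<lambda>z. h z w') z" "Dy (\<lambda>z. g z w) z = Dy (\<lambda>z. h z w') z"
    using Dx_cong[OF assms] Dy_cong[OF assms] by simp_all
  thus ?thesis unfolding lower_op_def by simp
qed

text \<open>With a = -j the coefficient a - j = -2j of the unwanted sum is cancelled by the term
  2j/y of the raising operator, and a + j = 0 removes it for the lowering operator. What is left is
  a single sum with index j + 1 or j - 1.\<close>

lemma ladder_lsum:
  assumes z: "z \<in> UHP" and w: "Re w > 1"
  shows "raise_op j (\<lambda>z _. c * lsum (- j) j (pw w) z) z w = c * ((of_int j + w) * lsum (- (j + 1)) (j + 1) (pw w) z)"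
    and "lower_op (\<lambda>z _. c * lsum (- j) j (pw w) z) z w = c * ((w - of_int j) * lsum (- (j - 1)) (j - 1) (pw w) z)"
proof -
  note d = wderiv_cmult[OF wderiv_lsum_pw[OF z w, of "-j" j], of c]
  have i: "\<i> * (X + Y - \<i> * (\<i> * (X - Y))) = 2 * \<i> * X" "X + Y + \<i> * (\<i> * (X - Y)) = 2 * Y" for X Y :: complex
    by (simp_all add: algebra_simps)
  have m: "of_real (Im z) powi (-1) * lsum (-j) j (pw w) z = lsum (- j - 1) j (pw w) z"
    using lsum_Im_mult[OF z w decays_powr, of "-1" "-j" j] by (simp add: minus_diff_commute)
  have m2: "of_real (Im z) powi 2 * lsum (- j - 1) (j - 1) (pw w) z = lsum (- (j - 1)) (j - 1) (pw w) z"
    using lsum_Im_mult[OF z w decays_powr, of 2 "- j - 1" "j - 1"] by (simp add: algebra_simps)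
  have ji: "- j - 1 = - (j + 1)" by simp
  have "raise_op j (\<lambda>z _. c * lsum (- j) j (pw w) z) z w = 
     2 * \<i> * (c * (1 / (2 * \<i>) * (of_int (- j - j) * lsum (- j - 1) j (pw w) z + (of_int j + w) * lsum (- j - 1) (j + 1) (pw w) z)))
     + of_int (2 * j) * (c * lsum (- j - 1) j (pw w) z)"
    unfolding raise_op_def wderiv_Dx[OF d] wderiv_Dy[OF d] i m[symmetric] by (simp add: mult_ac)
  also have "\<dots> = c * ((of_int j + w) * lsum (- j - 1) (j + 1) (pw w) z)"
    by (simp add: field_simps)
  finally show "raise_op j (\<lambda>z _. c * lsum (- j) j (pw w) z) z w = c * ((of_int j + w) * lsum (- (j + 1)) (j + 1) (pw w) z)"
    unfolding ji .
  have "lower_op (\<lambda>z _. c * lsum (- j) j (pw w) z) z w = 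
     - \<i> * (2 * (c * (1 / (2 * \<i>) * ((of_int j - w) * (of_real (Im z) powi 2 * lsum (- j - 1) (j - 1) (pw w) z)))))"
    unfolding lower_op_def wderiv_Dx[OF d] wderiv_Dy[OF d] i by (simp add: mult_ac)
  also have "\<dots> = c * ((w - of_int j) * lsum (- (j - 1)) (j - 1) (pw w) z)"
    unfolding m2 by (simp add: field_simps)
  finally show "lower_op (\<lambda>z _. c * lsum (- j) j (pw w) z) z w = c * ((w - of_int j) * lsum (- (j - 1)) (j - 1) (pw w) z)" .
qed

lemma Gamma_step:
  fixes w :: complex
  assumes "Re w > 1" "j \<ge> 0"
  shows "Gamma (w + of_int (j + 1)) = (w + of_int j) * Gamma (w + of_int j)"
proof -
  have "w + of_int j \<noteq> 0" using assms by (auto simp: complex_eq_iff)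
  moreover have "w + of_int j \<notin> \<int>\<^sub>\<le>\<^sub>0"
    using assms by (auto elim!: nonpos_Ints_cases simp: complex_eq_iff)
  ultimately show ?thesis using Gamma_plus1[of "w + of_int j"] by (simp add: add.assoc)
qed

text \<open>For j < 0 the factor w + j would not match the change from |j| to |j + 1| in the Gamma
  factor; hence each operator is applied only in the direction away from weight 0.\<close>

lemma Eis_raise:
  assumes g: "Eis j g" and j: "j \<ge> 0"
  shows "Eis (j + 1) (raise_op j g)"
  unfolding Eis_def
proof (intro conjI ballI allI impI)
  show "HF (raise_op j g)" using g by (auto simp: Eis_def intro: HF_raise_op)
  fix z w assume z: "z \<in> UHP"
  show "raise_op j g z (1 - w) = raise_op j g z w"
    by (rule raise_op_cong[OF z]) (use g in \<open>auto simp: Eis_def\<close>)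
  assume w: "Re w > 1"
  have "raise_op j g z w = raise_op j (\<lambda>z _. ecoef j w * lsum (- j) j (pw w) z) z w"
    by (rule raise_op_cong[OF z]) (use g w in \<open>auto simp: Eis_def\<close>)
  also have "\<dots> = ecoef (j + 1) w * lsum (- (j + 1)) (j + 1) (pw w) z"
    unfolding ladder_lsum(1)[OF z w] using Gamma_step[OF w j] j by (simp add: ecoef_def add.commute)
  finally show "raise_op j g z w = ecoef (j + 1) w * lsum (- (j + 1)) (j + 1) (pw w) z" .
qed

lemma Eis_lower:
  assumes g: "Eis j g" and j: "j \<le> 0"
  shows "Eis (j - 1) (lower_op g)"
  unfolding Eis_def
proof (intro conjI ballI allI impI)
  show "HF (lower_op g)" using g by (auto simp: Eis_def intro: HF_lower_op)
  fix z w assume z: "z \<in> UHP"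
  show "lower_op g z (1 - w) = lower_op g z w"
    by (rule lower_op_cong[OF z]) (use g in \<open>auto simp: Eis_def\<close>)
  assume w: "Re w > 1"
  have "lower_op g z w = lower_op (\<lambda>z _. ecoef j w * lsum (- j) j (pw w) z) z w"
    by (rule lower_op_cong[OF z]) (use g w in \<open>auto simp: Eis_def\<close>)
  also have "\<dots> = ecoef (j - 1) w * lsum (- (j - 1)) (j - 1) (pw w) z"
    unfolding ladder_lsum(2)[OF z w] using Gamma_step[OF w, of "-j"] j by (simp add: ecoef_def add.commute)
  finally show "lower_op g z w = ecoef (j - 1) w * lsum (- (j - 1)) (j - 1) (pw w) z" .
qed

lemma Eis_exists: "\<exists>g. Eis j g"
proof -
  have "\<exists>g. Eis (int n) g" for n
  proof (induction n)
    case 0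
    show ?case using Eis_eis0 by auto
  next
    case (Suc n)
    then obtain g where "Eis (int n) g" by blast
    from Eis_raise[OF this] show ?case by (auto simp: add.commute)
  qed
  moreover have "\<exists>g. Eis (- int n) g" for n
  proof (induction n)
    case 0
    show ?case using Eis_eis0 by auto
  next
    case (Suc n)
    then obtain g where "Eis (- int n) g" by blast
    from Eis_lower[OF this] have "Eis (- int (Suc n)) (lower_op g)" by (simp add: minus_diff_commute)
    thus ?case by blast
  qed
  ultimately show ?thesis by (metis int_cases2)
qed

section \<open>Modularity and the Laplace eigenvalue\<close>

lemma quad_lin: "quad z v = (cmod (lin z v))\<^sup>2 / Im z"
  by (simp add: quad_def lin_def)

lemma lin_moebius:
  assumes det: "a * d - b * c = 1" and D: "of_int c * z + of_int d \<noteq> 0"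
  shows "lin ((of_int a * z + of_int b) / (of_int c * z + of_int d)) (m, n) = 
     lin z (m * a + n * c, m * b + n * d) / (of_int c * z + of_int d)"
  using D by (simp add: lin_def field_simps)

lemma Im_moebius:
  assumes det: "a * d - b * c = (1::int)" and z: "z \<in> UHP"
  shows "of_int c * z + of_int d \<noteq> 0"
    and "Im ((of_int a * z + of_int b) / (of_int c * z + of_int d)) = Im z / (cmod (of_int c * z + of_int d))\<^sup>2"
proof -
  have cd: "(c, d) \<noteq> (0, 0)" using det by auto
  show D: "of_int c * z + of_int d \<noteq> 0"
    using lin_nonzero[OF z cd] by (simp add: lin_def)
  have det': "of_int a * of_int d - of_int b * of_int c = (1::real)"
    using arg_cong[OF det, of real_of_int] by simp
  have "Im ((of_int a * z + of_int b) * cnj (of_int c * z + of_int d)) = (of_int a * of_int d - of_int b * of_int c) * Im z"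
    by (simp add: algebra_simps)
  hence im: "Im ((of_int a * z + of_int b) * cnj (of_int c * z + of_int d)) = Im z" unfolding det' by simp
  show "Im ((of_int a * z + of_int b) / (of_int c * z + of_int d)) = Im z / (cmod (of_int c * z + of_int d))\<^sup>2"
    unfolding complex_div_cnj[of "of_int a * z + of_int b"] Im_divide_of_real im ..
qed

lemma moebius_UHP:
  assumes det: "a * d - b * c = (1::int)" and z: "z \<in> UHP"
  shows "(of_int a * z + of_int b) / (of_int c * z + of_int d) \<in> UHP"
  using Im_moebius[OF assms] z by (simp add: UHP_def)

text \<open>With D = cz + d, N is divided by D and the imaginary part by |D|^2 while the matrix acts
  on (m, n) from the right. So \<open>quad\<close> is invariant, and |D|^(2j) (D / cnj D)^j = D^(2j)
  is the whole automorphy factor, for any \<open>\<phi>\<close>.\<close>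

lemma lterm_moebius:
  assumes det: "a * d - b * c = (1::int)" and z: "z \<in> UHP"
  shows "lterm (- j) j \<phi> ((of_int a * z + of_int b) / (of_int c * z + of_int d)) (m, n) = 
     (of_int c * z + of_int d) powi (2 * j) * lterm (- j) j \<phi> z (m * a + n * c, m * b + n * d)"
proof -
  define D where "D = of_int c * z + of_int d"
  define z' where "z' = (of_int a * z + of_int b) / D"
  define N where "N = lin z (m * a + n * c, m * b + n * d)"
  have D0: "D \<noteq> 0" using Im_moebius(1)[OF det z] by (simp add: D_def)
  hence D: "D \<noteq> 0" "cnj D \<noteq> 0" by simp_all
  have y: "Im z' = Im z / (cmod D)\<^sup>2" unfolding z'_def D_def by (rule Im_moebius(2)[OF det z])
  have N: "lin z' (m, n) = N / D" unfolding z'_def N_def D_def by (rule lin_moebius[OF det]) (use D in \<open>simp add: D_def\<close>)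
  have q: "quad z' (m, n) = quad z (m * a + n * c, m * b + n * d)"
    unfolding quad_lin N y N_def[symmetric] using D by (simp add: norm_divide power_divide)
  have yc: "complex_of_real (Im z') = of_real (Im z) / (D * cnj D)"
    unfolding y by (simp add: complex_norm_square[symmetric])
  have "complex_of_real (Im z') powi (-j) = of_real (Im z) powi (-j) * D powi j * cnj D powi j"
    unfolding yc power_int_divide_distrib power_int_mult_distrib power_int_minus by (simp add: field_simps)
  moreover have "(cnj (N / D) / (N / D)) powi j = (cnj N / N) powi j * D powi j / cnj D powi j"
    by (simp add: power_int_divide_distrib power_int_mult_distrib field_simps)
  moreover have "D powi (2 * j) = D powi j * D powi j"
    unfolding mult_2 using D by (intro power_int_add) auto
  ultimately have "lterm (- j) j \<phi> z' (m, n) = D powi (2 * j) * lterm (- j) j \<phi> z (m * a + n * c, m * b + n * d)"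
    unfolding lterm_def N q N_def[symmetric] using D by simp
  thus ?thesis by (simp add: D_def z'_def)
qed

lemma lsum_moebius:
  assumes det: "a * d - b * c = (1::int)" and z: "z \<in> UHP" and M: "M > 1" "decays \<phi> M"
  shows "lsum (- j) j \<phi> ((of_int a * z + of_int b) / (of_int c * z + of_int d)) = (of_int c * z + of_int d) powi (2 * j) * lsum (- j) j \<phi> z"
proof -
  \<comment> \<open>The right action of the matrix on the lattice; \<open>t'\<close> is that of its
    inverse, which is integral as the determinant is 1.\<close>
  define t where "t = (\<lambda>(m, n). (m * a + n * c, m * b + n * d))"
  define t' where "t' = (\<lambda>(m, n). (m * d - n * c, n * a - m * b))"
  have 1: "t' (t v) = v" for v
  proof -
    obtain m n where v: "v = (m, n)" by force
    have "(m * a + n * c) * d - (m * b + n * d) * c = m * (a * d - b * c)"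
      "(m * b + n * d) * a - (m * a + n * c) * b = n * (a * d - b * c)" by (simp_all add: algebra_simps)
    thus ?thesis by (simp add: v t_def t'_def det)
  qed
  have 2: "t (t' v) = v" for v
  proof -
    obtain m n where v: "v = (m, n)" by force
    have "(m * d - n * c) * a + (n * a - m * b) * c = m * (a * d - b * c)"
      "(m * d - n * c) * b + (n * a - m * b) * d = n * (a * d - b * c)" by (simp_all add: algebra_simps)
    thus ?thesis by (simp add: v t_def t'_def det)
  qed
  have t0: "t (0, 0) = (0, 0)" "t' (0, 0) = (0, 0)" by (simp_all add: t_def t'_def)
  have bij: "bij_betw t (UNIV - {(0, 0)}) (UNIV - {(0, 0)})"
  proof (rule bij_betwI[where g = t'])
    have "t v \<noteq> (0, 0)" "t' v \<noteq> (0, 0)" if "v \<noteq> (0, 0)" for v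
      using that 1[of v] 2[of v] t0 by auto
    thus "t \<in> UNIV - {(0, 0)} \<rightarrow> UNIV - {(0, 0)}" "t' \<in> UNIV - {(0, 0)} \<rightarrow> UNIV - {(0, 0)}" by auto
  qed (use 1 2 in auto)
  have "lsum (- j) j \<phi> ((of_int a * z + of_int b) / (of_int c * z + of_int d)) = 
     (\<Sum>\<^sub>\<infinity>v\<in>UNIV - {(0, 0)}. (of_int c * z + of_int d) powi (2 * j) * lterm (- j) j \<phi> z (t v))"
    unfolding lsum_eq_infsum[OF moebius_UHP[OF det z] M]
    by (rule infsum_cong) (auto simp: lterm_moebius[OF det z] t_def split: prod.splits)
  also have "\<dots> = (of_int c * z + of_int d) powi (2 * j) * (\<Sum>\<^sub>\<infinity>v\<in>UNIV - {(0, 0)}. lterm (- j) j \<phi> z (t v))"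
    by (rule infsum_cmult_right')
  also have "(\<Sum>\<^sub>\<infinity>v\<in>UNIV - {(0, 0)}. lterm (- j) j \<phi> z (t v)) = lsum (- j) j \<phi> z"
    unfolding lsum_eq_infsum[OF z M] by (rule infsum_reindex_bij_betw[OF bij])
  finally show ?thesis .
qed

lemma Eis_moebius:
  assumes g: "Eis j g" and det: "a * d - b * c = (1::int)" and z: "z \<in> UHP"
  shows "g ((of_int a * z + of_int b) / (of_int c * z + of_int d)) w = (of_int c * z + of_int d) powi (2 * j) * g z w"
proof (rule entire_eqI[of "g ((of_int a * z + of_int b) / (of_int c * z + of_int d))" "\<lambda>w. (of_int c * z + of_int d) powi (2 * j) * g z w" 1])
  note z' = moebius_UHP[OF det z]
  show "g ((of_int a * z + of_int b) / (of_int c * z + of_int d)) holomorphic_on UNIV"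
    using g z' by (auto simp: Eis_def intro: HF_holomorphic)
  show "(\<lambda>w. (of_int c * z + of_int d) powi (2 * j) * g z w) holomorphic_on UNIV"
    using g z by (intro holomorphic_on_mult holomorphic_on_const) (auto simp: Eis_def intro: HF_holomorphic)
  fix w :: complex assume w: "Re w > 1"
  show "g ((of_int a * z + of_int b) / (of_int c * z + of_int d)) w = (of_int c * z + of_int d) powi (2 * j) * g z w"
    using g z z' w lsum_moebius[OF det z w decays_powr, of j] by (simp add: Eis_def)
qed

text \<open>Under w = s + j the region Re s > 1 - k/2 becomes Re w > 1 and the Gamma argument w +
  |j|. The description operator is resolved by the identity theorem.\<close>

lemma EisEhh_eq:
  assumes g: "Eis j g" and z: "z \<in> UHP"
  shows "EisEhh (2 * j) z = (\<lambda>s. g z (s + of_int j))"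
proof -
  have h: "(\<lambda>s. g z (s + of_int j)) holomorphic_on UNIV"
    using HF_holomorphic[OF HF_compose_affine[of g 1 "of_int j"] z] g by (simp add: Eis_def)
  have eq: "g z (s + of_int j) = (s + of_int (2 * j) / 2) * (s + of_int (2 * j) / 2 - 1) *
               complex_of_real pi powr (- (s + of_int (2 * j) / 2)) *
               Gamma (s + of_int (2 * j) / 2 + of_int \<bar>2 * j\<bar> / 2) * EisE (2 * j) z s"
    if s: "Re s > 1 - real_of_int (2 * j) / 2" for s
  proof -
    have w: "Re (s + of_int j) > 1" using s by simp
    have "g z (s + of_int j) = ecoef j (s + of_int j) * lsum (- j) j (pw (s + of_int j)) z"
      using g z w by (simp add: Eis_def)
    also have "lsum (- j) j (pw (s + of_int j)) z = 2 * EisE (2 * j) z s"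
    proof -
      have "EisE (2 * j) z s = lsum (- j) j (pw (s + of_int j)) z / 2"
        using EisE_eq_lsum[OF z w, of j] by (simp only: add_diff_cancel_right')
      thus ?thesis by (simp only:) simp
    qed
    finally show ?thesis by (simp add: ecoef_def abs_mult)
  qed
  show ?thesis
    unfolding EisEhh_def
  proof (rule the_equality)
    fix f assume f: "f holomorphic_on UNIV \<and> (\<forall>s. 1 - real_of_int (2 * j) / 2 < Re s \<longrightarrow>
         f s = (s + of_int (2 * j) / 2) * (s + of_int (2 * j) / 2 - 1) *
               complex_of_real pi powr (- (s + of_int (2 * j) / 2)) *
               Gamma (s + of_int (2 * j) / 2 + of_int \<bar>2 * j\<bar> / 2) * EisE (2 * j) z s)"
    show "f = (\<lambda>s. g z (s + of_int j))"
    proof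
      fix s
      show "f s = g z (s + of_int j)"
        by (rule entire_eqI[of f "\<lambda>s. g z (s + of_int j)" "1 - real_of_int (2 * j) / 2"])
           (use f h eq in auto)
    qed
  qed (use h eq in blast)
qed

section \<open>The Laplace equation\<close>

text \<open>The Laplacian is four times the mixed Wirtinger derivative, here as
  \<open>2 * A2 + 2 * B1\<close>; the pure derivatives \<open>A1\<close> and \<open>B2\<close>
  cancel, and the first-order part is twice \<open>B\<close>.\<close>

lemma Delta_wderiv:
  assumes f: "\<And>z. z \<in> UHP \<Longrightarrow> wderiv f (A z) (B z) z" and z: "z \<in> UHP"
    and A: "wderiv A A1 A2 z" and B: "wderiv B B1 B2 z"
  shows "Delta k f z = of_real ((Im z)\<^sup>2) * (2 * A2 + 2 * B1) - \<i> * of_int k * of_real (Im z) * (2 * B z)"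
proof -
  have "Dx (Dx f) z = Dx (\<lambda>z. A z + B z) z" by (rule Dx_cong[OF z]) (rule wderiv_Dx[OF f])
  also have "\<dots> = (A1 + B1) + (A2 + B2)" by (rule wderiv_Dx[OF wderiv_add[OF A B]])
  finally have xx: "Dx (Dx f) z = (A1 + B1) + (A2 + B2)" .
  have "Dy (Dy f) z = Dy (\<lambda>z. \<i> * (A z + (- 1) * B z)) z" by (rule Dy_cong[OF z]) (simp add: wderiv_Dy[OF f])
  also have "\<dots> = \<i> * (\<i> * (A1 + (- 1) * B1) - \<i> * (A2 + (- 1) * B2))"
    by (rule wderiv_Dy[OF wderiv_cmult[OF wderiv_add[OF A wderiv_cmult[OF B]]]])
  finally have yy: "Dy (Dy f) z = - (A1 - B1) + (A2 - B2)" by (simp add: algebra_simps)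
  have "Dx (Dx f) z + Dy (Dy f) z = 2 * A2 + 2 * B1" unfolding xx yy by (simp add: algebra_simps)
  moreover have "Dx f z + \<i> * Dy f z = 2 * B z"
    by (simp add: wderiv_Dx[OF f[OF z]] wderiv_Dy[OF f[OF z]] algebra_simps)
  ultimately show ?thesis unfolding Delta_def by simp
qed

text \<open>Only two sums occur, \<open>x0\<close> with index j - 1 and \<open>x1\<close> with index
  j. The \<open>x0\<close> parts of the second- and first-order terms cancel; \<open>x1\<close>
  leaves (w - j)(w + j - 1), which is s (s + k - 1) for w = s + j.\<close>

lemma Delta_lsum_pw:
  assumes z: "z \<in> UHP" and w: "Re w > 1"
  shows "Delta (2 * j) (\<lambda>z. c * lsum (- j) j (pw w) z) z = (w - of_int j) * (w + of_int j - 1) * (c * lsum (- j) j (pw w) z)"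
proof -
  define X where "X = (\<lambda>a j z. lsum a j (pw w) z)"
  define e where "e = 1 / (2 * \<i>)"
  have e2: "e * e = - 1 / 4" by (simp add: e_def)
  have ie: "\<i> * e = 1 / 2" by (simp add: e_def)
  define A where "A = (\<lambda>z. e * ((- 2 * of_int j) * X (- j - 1) j z + (of_int j + w) * X (- j - 1) (j + 1) z))"
  define B where "B = (\<lambda>z. e * ((of_int j - w) * X (- j - 1) (j - 1) z))"
  have f: "wderiv (\<lambda>z. c * lsum (- j) j (pw w) z) (c * A z) (c * B z) z" if "z \<in> UHP" for z
    by (rule wderiv_eq[OF wderiv_cmult[OF wderiv_lsum_pw[OF that w]]]) (simp_all add: A_def B_def X_def e_def)
  have dX: "wderiv (\<lambda>z. X a j z) (e * (of_int (a - j) * X (a - 1) j z + (of_int j + w) * X (a - 1) (j + 1) z))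
    (e * ((of_int j - w) * X (a - 1) (j - 1) z - of_int (a + j) * X (a - 1) j z)) z" for a j
    unfolding X_def e_def by (rule wderiv_lsum_pw[OF z w])
  define x0 where "x0 = X (- j - 2) (j - 1) z"
  define x1 where "x1 = X (- j - 2) j z"
  define y where "y = complex_of_real (Im z)"
  \<comment> \<open>Only the mixed derivatives enter \<open>Delta\<close>, so the other component is
    left existential.\<close>
  have wA: "\<exists>A1. wderiv A A1 (e * e * ((- 2 * of_int j) * ((of_int j - w) * x0 + x1) + (of_int j + w) * ((of_int j + 1 - w) * x1))) z"
    unfolding A_def
    by (rule exI, rule wderiv_eq[OF wderiv_cmult[OF wderiv_add[OF wderiv_cmult[OF dX] wderiv_cmult[OF dX]]] refl])
       (simp add: x0_def x1_def algebra_simps)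
  then obtain A1 where wA: "wderiv A A1 (e * e * ((- 2 * of_int j) * ((of_int j - w) * x0 + x1) + (of_int j + w) * ((of_int j + 1 - w) * x1))) z" ..
  have wB: "\<exists>B2. wderiv B (e * e * ((of_int j - w) * ((- 2 * of_int j) * x0 + (of_int j - 1 + w) * x1))) B2 z"
    unfolding B_def
    by (rule exI, rule wderiv_eq[OF wderiv_cmult[OF wderiv_cmult[OF dX]] _ refl])
       (simp add: x0_def x1_def algebra_simps)
  then obtain B2 where wB: "wderiv B (e * e * ((of_int j - w) * ((- 2 * of_int j) * x0 + (of_int j - 1 + w) * x1))) B2 z" ..
  have y1: "X (- j - 1) (j - 1) z = y * x0"
    using lsum_Im_mult[OF z w decays_powr, of 1 "- j - 2" "j - 1"] by (simp add: X_def x0_def y_def minus_diff_commute)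
  have y2: "lsum (- j) j (pw w) z = y\<^sup>2 * x1"
    using lsum_Im_mult[OF z w decays_powr, of 2 "- j - 2" j] by (simp add: X_def x1_def y_def)
  have Bz: "B z = e * ((of_int j - w) * (y * x0))" by (simp add: B_def y1)
  have "Delta (2 * j) (\<lambda>z. c * lsum (- j) j (pw w) z) z = 
     y\<^sup>2 * (2 * (c * (e * e * ((- 2 * of_int j) * ((of_int j - w) * x0 + x1) + (of_int j + w) * ((of_int j + 1 - w) * x1)))) +
         2 * (c * (e * e * ((of_int j - w) * ((- 2 * of_int j) * x0 + (of_int j - 1 + w) * x1))))) - 
     \<i> * of_int (2 * j) * y * (2 * (c * (e * ((of_int j - w) * (y * x0)))))"
    using Delta_wderiv[OF f z wderiv_cmult[OF wA] wderiv_cmult[OF wB], of "2 * j"] by (simp add: Bz y_def)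
  also have "\<dots> = y\<^sup>2 * c * (e * e) * (2 * ((- 2 * of_int j) * ((of_int j - w) * x0 + x1) + (of_int j + w) * ((of_int j + 1 - w) * x1)) +
         2 * ((of_int j - w) * ((- 2 * of_int j) * x0 + (of_int j - 1 + w) * x1))) - 
     (\<i> * e) * of_int (2 * j) * y * (2 * (c * ((of_int j - w) * (y * x0))))"
    by (simp add: algebra_simps)
  also have "\<dots> = (w - of_int j) * (w + of_int j - 1) * (c * (y\<^sup>2 * x1))"
    unfolding e2 ie by (simp add: field_simps power2_eq_square)
  finally show ?thesis unfolding y2 .
qed

text \<open>The joint control of families pays off here: by \<open>HF_Delta\<close> the left side is
  entire in w, so a differentiated identity can be continued as well.\<close>

lemma Delta_Eis:
  assumes g: "Eis j g" and z: "z \<in> UHP"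
  shows "Delta (2 * j) (\<lambda>z. g z w) z = (w - of_int j) * (w + of_int j - 1) * g z w"
proof (rule entire_eqI[of "\<lambda>w. Delta (2 * j) (\<lambda>z. g z w) z" "\<lambda>w. (w - of_int j) * (w + of_int j - 1) * g z w" 1])
  have HF: "HF g" using g by (simp add: Eis_def)
  show "(\<lambda>w. Delta (2 * j) (\<lambda>z. g z w) z) holomorphic_on UNIV"
    by (rule HF_holomorphic[OF HF_Delta[OF HF] z])
  show "(\<lambda>w. (w - of_int j) * (w + of_int j - 1) * g z w) holomorphic_on UNIV"
    by (intro holomorphic_intros HF_holomorphic[OF HF z])
  fix w :: complex assume w: "Re w > 1"
  have eq: "g z w = ecoef j w * lsum (- j) j (pw w) z" if "z \<in> UHP" for z
    using g w that by (simp add: Eis_def)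
  have "Delta (2 * j) (\<lambda>z. g z w) z = Delta (2 * j) (\<lambda>z. ecoef j w * lsum (- j) j (pw w) z) z"
    by (rule Delta_cong[OF z eq])
  thus "Delta (2 * j) (\<lambda>z. g z w) z = (w - of_int j) * (w + of_int j - 1) * g z w"
    unfolding Delta_lsum_pw[OF z w] eq[OF z] .
qed

section \<open>Taylor coefficients\<close>

lemma HF_Dx_cmult:
  assumes f: "HF f" and z: "z \<in> UHP"
  shows "Dx (\<lambda>z. c * f z w) z = c * Dx (\<lambda>z. f z w) z" "Dy (\<lambda>z. c * f z w) z = c * Dy (\<lambda>z. f z w) z"
proof -
  obtain A B where AB: "\<And>z w. z \<in> UHP \<Longrightarrow> wderiv (\<lambda>z. f z w) (A z w) (B z w) z"
    by (rule HF_wderiv[OF f]) (rule that)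
  note d = AB[OF z, of w]
  show "Dx (\<lambda>z. c * f z w) z = c * Dx (\<lambda>z. f z w) z" "Dy (\<lambda>z. c * f z w) z = c * Dy (\<lambda>z. f z w) z"
    unfolding wderiv_Dx[OF d] wderiv_Dy[OF d] wderiv_Dx[OF wderiv_cmult[OF d]] wderiv_Dy[OF wderiv_cmult[OF d]]
    by (simp_all add: algebra_simps)
qed

lemma HF_Delta_cmult:
  assumes f: "HF f" and z: "z \<in> UHP"
  shows "Delta k (\<lambda>z. c * f z w) z = c * Delta k (\<lambda>z. f z w) z"
proof -
  have x: "Dx (Dx (\<lambda>z. c * f z w)) z = c * Dx (Dx (\<lambda>z. f z w)) z"
    using Dx_cong[OF z HF_Dx_cmult(1)[OF f, of _ c w]] HF_Dx_cmult(1)[OF HF_Dx[OF f] z, of c w] by simp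
  have y: "Dy (Dy (\<lambda>z. c * f z w)) z = c * Dy (Dy (\<lambda>z. f z w)) z"
    using Dy_cong[OF z HF_Dx_cmult(2)[OF f, of _ c w]] HF_Dx_cmult(2)[OF HF_Dy[OF f] z, of c w] by simp
  show ?thesis unfolding Delta_def x y HF_Dx_cmult[OF f z] by (simp add: algebra_simps)
qed

lemma Delta_pow_cong:
  assumes "\<And>z. z \<in> UHP \<Longrightarrow> f z = g z" "z \<in> UHP"
  shows "(Delta k ^^ m) f z = (Delta k ^^ m) g z"
  using assms(2)
proof (induction m arbitrary: z)
  case (Suc m)
  show ?case using Delta_cong[OF Suc.prems Suc.IH] by simp
qed (use assms in simp)

lemma Delta_pow_eigen:
  assumes g: "HF g" and l: "\<And>z. z \<in> UHP \<Longrightarrow> Delta k (\<lambda>z. g z w) z = l * g z w" and z: "z \<in> UHP"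
  shows "(Delta k ^^ m) (\<lambda>z. g z w) z = l ^ m * g z w"
  using z
proof (induction m arbitrary: z)
  case (Suc m)
  have "(Delta k ^^ Suc m) (\<lambda>z. g z w) z = Delta k (\<lambda>z. l ^ m * g z w) z"
    using Delta_cong[OF Suc.prems Suc.IH] by simp
  also have "\<dots> = l ^ Suc m * g z w"
    unfolding HF_Delta_cmult[OF g Suc.prems] l[OF Suc.prems] by simp
  finally show ?case .
qed simp

text \<open>The first conjunct is carried along because exchanging one more \<open>Delta\<close>
  with d/dw requires the previous power to be a smooth family.\<close>

lemma Delta_pow_higher_deriv:
  assumes g: "HF g"
  shows "HF (\<lambda>z w. (Delta k ^^ m) (\<lambda>z. g z w) z) \<and> 
    (\<forall>z\<in>UHP. (Delta k ^^ m) (\<lambda>z. (deriv ^^ n) (g z) w) z = (deriv ^^ n) (\<lambda>w. (Delta k ^^ m) (\<lambda>z. g z w) z) w)"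
proof (induction m)
  case (Suc m)
  have HF: "HF (\<lambda>z w. (Delta k ^^ m) (\<lambda>z. g z w) z)" using Suc by blast
  have "(Delta k ^^ Suc m) (\<lambda>z. (deriv ^^ n) (g z) w) z = (deriv ^^ n) (\<lambda>w. (Delta k ^^ Suc m) (\<lambda>z. g z w) z) w"
    if z: "z \<in> UHP" for z
  proof -
    have "(Delta k ^^ Suc m) (\<lambda>z. (deriv ^^ n) (g z) w) z = Delta k (\<lambda>z. (deriv ^^ n) (\<lambda>w. (Delta k ^^ m) (\<lambda>z. g z w) z) w) z"
      unfolding funpow.simps(2) o_def by (rule Delta_cong[OF z]) (use Suc in blast)
    also have "\<dots> = (deriv ^^ n) (\<lambda>w. Delta k (\<lambda>z. (Delta k ^^ m) (\<lambda>z. g z w) z) z) w"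
      by (rule HF_Delta_higher_deriv[OF HF z])
    finally show ?thesis by simp
  qed
  with HF_Delta[OF HF, of k] show ?case by simp
qed (use g in simp)

lemma higher_deriv_times_ident:
  assumes f: "f holomorphic_on UNIV"
  shows "(deriv ^^ Suc n) (\<lambda>s. s * f s) z = z * (deriv ^^ Suc n) f z + of_nat (Suc n) * (deriv ^^ n) f z"
proof (induction n arbitrary: z)
  case 0
  have "(f has_field_derivative deriv f z) (at z)" by (rule holomorphic_derivI[OF f open_UNIV]) simp
  from DERIV_imp_deriv[OF DERIV_mult[OF DERIV_ident this]] show ?case by (simp add: algebra_simps)
next
  case (Suc n)
  have d: "((deriv ^^ m) f has_field_derivative (deriv ^^ Suc m) f z) (at z)" for m
    using holomorphic_derivI[OF holomorphic_higher_deriv[OF f open_UNIV] open_UNIV, of z m] by simp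
  have "(deriv ^^ Suc n) (\<lambda>s. s * f s) = (\<lambda>z. z * (deriv ^^ Suc n) f z + of_nat (Suc n) * (deriv ^^ n) f z)"
    using Suc.IH by blast
  hence "(deriv ^^ Suc (Suc n)) (\<lambda>s. s * f s) z = deriv (\<lambda>z. z * (deriv ^^ Suc n) f z + of_nat (Suc n) * (deriv ^^ n) f z) z"
    by simp
  also have "\<dots> = 1 * (deriv ^^ Suc n) f z + (deriv ^^ Suc (Suc n)) f z * z + of_nat (Suc n) * (deriv ^^ Suc n) f z"
    by (rule DERIV_imp_deriv, rule DERIV_add[OF DERIV_mult[OF DERIV_ident d] DERIV_cmult[OF d]])
  finally show ?case by (simp add: algebra_simps)
qed

text \<open>After division by factorials this is the shift of Taylor coefficients by m, in the
  derivative form that matches \<open>EisCoeff\<close>.\<close>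

lemma higher_deriv_power_mult:
  assumes f: "f holomorphic_on UNIV"
  shows "(deriv ^^ (m + i)) (\<lambda>s. s ^ m * f s) 0 = fact (m + i) / fact i * (deriv ^^ i) f 0"
    and "n < m \<Longrightarrow> (deriv ^^ n) (\<lambda>s. s ^ m * f s) 0 = 0"
proof -
  show "(deriv ^^ (m + i)) (\<lambda>s. s ^ m * f s) 0 = fact (m + i) / fact i * (deriv ^^ i) f 0"
  proof (induction m)
    case (Suc m)
    have h: "(\<lambda>s. s ^ m * f s) holomorphic_on UNIV" by (intro holomorphic_intros f)
    have "(deriv ^^ (Suc m + i)) (\<lambda>s. s ^ Suc m * f s) 0 = (deriv ^^ Suc (m + i)) (\<lambda>s. s * (s ^ m * f s)) 0"
      by (simp add: mult.assoc)
    also have "\<dots> = of_nat (Suc (m + i)) * (fact (m + i) / fact i * (deriv ^^ i) f 0)"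
      unfolding higher_deriv_times_ident[OF h] Suc.IH by simp
    finally show ?case by simp
  qed simp
  show "(deriv ^^ n) (\<lambda>s. s ^ m * f s) 0 = 0" if "n < m"
    using that
  proof (induction m arbitrary: n)
    case (Suc m)
    have h: "(\<lambda>s. s ^ m * f s) holomorphic_on UNIV" by (intro holomorphic_intros f)
    show ?case
    proof (cases n)
      case (Suc n')
      have "(deriv ^^ n) (\<lambda>s. s ^ Suc m * f s) 0 = (deriv ^^ Suc n') (\<lambda>s. s * (s ^ m * f s)) 0"
        unfolding Suc by (simp add: mult.assoc)
      also have "\<dots> = of_nat (Suc n') * (deriv ^^ n') (\<lambda>s. s ^ m * f s) 0"
        unfolding higher_deriv_times_ident[OF h] by simp
      also have "(deriv ^^ n') (\<lambda>s. s ^ m * f s) 0 = 0"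
        by (rule Suc.IH) (use Suc.prems Suc in simp)
      finally show ?thesis by simp
    qed simp
  qed simp
qed

lemma EisCoeff_eq:
  assumes "Eis j g" "z \<in> UHP"
  shows "EisCoeff n (2 * j) z = (deriv ^^ n) (\<lambda>s. g z (s + of_int j)) 0 / fact n"
  by (simp add: EisCoeff_def EisEhh_eq[OF assms])

text \<open>Smoothness, modularity and growth hold for every coefficient, so membership reduces to
  the Laplace condition. As \<open>Delta\<close> commutes with d/ds and acts by s (s + k - 1), that
  condition concerns a single Taylor coefficient.\<close>

lemma EisCoeff_in_V_iff:
  assumes g: "Eis j g"
  shows "EisCoeff n (2 * j) \<in> V (2 * j) m \<longleftrightarrow>
    (\<forall>z\<in>UHP. (deriv ^^ n) (\<lambda>s. s ^ m * ((s + of_int (2 * j) - 1) ^ m * g z (s + of_int j))) 0 = 0)"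
proof -
  define K where "K = (\<lambda>z s. g z (s + of_int j))"
  define T where "T = (\<lambda>z w. 1 / fact n * (deriv ^^ n) (K z) w)"
  have "HF g" using g by (simp add: Eis_def)
  hence K: "HF K" using HF_compose_affine[of g 1 "of_int j"] by (simp add: K_def)
  have T: "HF T" unfolding T_def by (intro HF_cmult HF_higher_deriv K)
  have eq: "EisCoeff n (2 * j) z = T z 0" if "z \<in> UHP" for z
    using EisCoeff_eq[OF g that] by (simp add: T_def K_def)
  have mob: "T ((of_int a * z + of_int b) / (of_int c * z + of_int d)) 0 = (of_int c * z + of_int d) powi (2 * j) * T z 0"
    if "a * d - b * c = 1" "z \<in> UHP" for a b c d :: int and z
  proof -
    have "K ((of_int a * z + of_int b) / (of_int c * z + of_int d)) = (\<lambda>s. (of_int c * z + of_int d) powi (2 * j) * K z s)"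
      unfolding K_def by (rule ext) (rule Eis_moebius[OF g that])
    moreover have "(deriv ^^ n) (\<lambda>s. (of_int c * z + of_int d) powi (2 * j) * K z s) 0 = (of_int c * z + of_int d) powi (2 * j) * (deriv ^^ n) (K z) 0"
      by (rule higher_deriv_cmult[OF HF_holomorphic[OF K that(2)]]) auto
    ultimately show ?thesis unfolding T_def by simp
  qed
  have smooth: "smooth_on UHP (EisCoeff n (2 * j))"
    by (rule smooth_on_UHP_cong[OF HF_smooth[OF T, of 0]]) (simp add: eq)
  have "modular_of_weight (2 * j) (EisCoeff n (2 * j))"
    unfolding modular_of_weight_def using smooth moebius_UHP eq mob by auto
  moreover have "moderate_growth (\<lambda>z. T z 0)"
  proof (rule HF_moderate_growth[OF T])
    fix z :: complex and i :: int assume "z \<in> UHP"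
    thus "T (z + of_int i) 0 = T z 0" using mob[of 1 1 i 0 z] by simp
  qed
  hence "moderate_growth (EisCoeff n (2 * j))"
    unfolding moderate_growth_def using eq by (simp add: UHP_def)
  moreover have "(Delta (2 * j) ^^ m) (EisCoeff n (2 * j)) z = 
     1 / fact n * (deriv ^^ n) (\<lambda>s. s ^ m * ((s + of_int (2 * j) - 1) ^ m * g z (s + of_int j))) 0" if z: "z \<in> UHP" for z
  proof -
    have "HF (\<lambda>z. (deriv ^^ n) (K z))" by (rule HF_higher_deriv[OF K])
    have c: "(Delta (2 * j) ^^ m) (\<lambda>z. c * f z w) z = c * (Delta (2 * j) ^^ m) (\<lambda>z. f z w) z" 
      if f: "HF f" for c w f
      using z
    proof (induction m arbitrary: z)
      case (Suc m)
      have "HF (\<lambda>z w. (Delta (2 * j) ^^ m) (\<lambda>z. f z w) z)" using Delta_pow_higher_deriv[OF f] by blast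
      from HF_Delta_cmult[OF this Suc.prems] Delta_cong[OF Suc.prems Suc.IH] show ?case by simp
    qed simp
    have "(Delta (2 * j) ^^ m) (EisCoeff n (2 * j)) z = (Delta (2 * j) ^^ m) (\<lambda>z. T z 0) z"
      by (rule Delta_pow_cong[OF eq z])
    also have "\<dots> = 1 / fact n * (Delta (2 * j) ^^ m) (\<lambda>z. (deriv ^^ n) (K z) 0) z"
      unfolding T_def by (rule c[OF HF_higher_deriv[OF K]])
    also have "(Delta (2 * j) ^^ m) (\<lambda>z. (deriv ^^ n) (K z) 0) z = (deriv ^^ n) (\<lambda>s. (Delta (2 * j) ^^ m) (\<lambda>z. K z s) z) 0"
      using Delta_pow_higher_deriv[OF K] z by blast
    also have "(\<lambda>s. (Delta (2 * j) ^^ m) (\<lambda>z. K z s) z) = (\<lambda>s. s ^ m * ((s + of_int (2 * j) - 1) ^ m * g z (s + of_int j)))"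
    proof
      fix s
      have "Delta (2 * j) (\<lambda>z. K z s) z = (s * (s + of_int (2 * j) - 1)) * K z s" if "z \<in> UHP" for z
        using Delta_Eis[OF g that, of "s + of_int j"] by (simp add: K_def add.assoc)
      from Delta_pow_eigen[OF K this z, where m = m]
      show "(Delta (2 * j) ^^ m) (\<lambda>z. K z s) z = s ^ m * ((s + of_int (2 * j) - 1) ^ m * g z (s + of_int j))"
        by (simp add: power_mult_distrib K_def)
    qed
    finally show ?thesis .
  qed
  ultimately show ?thesis unfolding V_def by simp
qed

lemma Eis_shift_holomorphic:
  assumes g: "Eis j g" and z: "z \<in> UHP"
  shows "(\<lambda>s. (s + c) ^ m * g z (s + of_int j)) holomorphic_on UNIV"
proof -
  have "HF g" using g by (simp add: Eis_def)
  hence "(\<lambda>s. g z (s + of_int j)) holomorphic_on UNIV"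
    using HF_holomorphic[OF HF_compose_affine[of g 1 "of_int j"] z] by simp
  thus ?thesis by (intro holomorphic_intros)
qed

lemma EisCoeff_in_V_Suc:
  shows "EisCoeff n (2 * j) \<in> V (2 * j) (n + 1)"
proof -
  obtain g where g: "Eis j g" using Eis_exists by blast
  show ?thesis unfolding EisCoeff_in_V_iff[OF g]
    using higher_deriv_power_mult(2)[OF Eis_shift_holomorphic[OF g, of _ "of_int (2 * j) - 1" "n + 1"], of _ n "n + 1"]
    by (simp add: add_diff_eq)
qed

text \<open>For even k the factor s + k - 1 of the eigenvalue does not vanish at s = 0, so the
  eigenvalue has a simple zero there; each \<open>Delta\<close> raises the order in s by exactly
  one.\<close>

lemma of_int_odd_nonzero: "of_int (2 * j) - 1 \<noteq> (0::complex)"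
proof
  assume "of_int (2 * j) - 1 = (0::complex)"
  hence "complex_of_int (2 * j) = of_int 1" by simp
  hence "2 * j = 1" by (simp only: of_int_eq_iff)
  thus False by presburger
qed

text \<open>The case m = n extracts the leading coefficient, the value at s = 0 (that is, w = j)
  times (k - 1)^n.\<close>

lemma EisCoeff_in_V_same_iff:
  assumes g: "Eis j g"
  shows "EisCoeff n (2 * j) \<in> V (2 * j) n \<longleftrightarrow> (\<forall>z\<in>UHP. g z (of_int j) = 0)"
proof -
  have "(deriv ^^ n) (\<lambda>s. s ^ n * ((s + of_int (2 * j) - 1) ^ n * g z (s + of_int j))) 0 = 
     fact n * ((of_int (2 * j) - 1) ^ n * g z (of_int j))" if "z \<in> UHP" for z
    using higher_deriv_power_mult(1)[OF Eis_shift_holomorphic[OF g that, of "of_int (2 * j) - 1" n], of n 0]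
    by (simp add: add_diff_eq)
  thus ?thesis unfolding EisCoeff_in_V_iff[OF g] using of_int_odd_nonzero[of j] by simp
qed

text \<open>If the value at s = 0 vanishes, the next coefficient leads: in the product rule, the
  term with the derivative of the eigenvalue factor drops out.\<close>

lemma EisCoeff_Suc_in_V_iff:
  assumes g: "Eis j g" and g0: "\<And>z. z \<in> UHP \<Longrightarrow> g z (of_int j) = 0"
  shows "EisCoeff (n + 1) (2 * j) \<in> V (2 * j) n \<longleftrightarrow> (\<forall>z\<in>UHP. deriv (g z) (of_int j) = 0)"
proof -
  have eq: "(deriv ^^ (n + 1)) (\<lambda>s. s ^ n * ((s + of_int (2 * j) - 1) ^ n * g z (s + of_int j))) 0 = 
     fact (n + 1) * ((of_int (2 * j) - 1) ^ n * deriv (g z) (of_int j))" if z: "z \<in> UHP" for z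
  proof -
    have "HF g" using g by (simp add: Eis_def)
    hence "(g z has_field_derivative deriv (g z) (of_int j)) (at (0 + of_int j))"
      using holomorphic_derivI[OF HF_holomorphic[OF _ z] open_UNIV, of g "of_int j"] by simp
    hence "((\<lambda>s. g z (s + of_int j)) has_field_derivative deriv (g z) (of_int j)) (at 0)"
      using DERIV_shift by blast
    moreover have "((\<lambda>s. (s + (of_int (2 * j) - 1)) ^ n) has_field_derivative of_nat n * (of_int (2 * j) - 1) ^ (n - 1)) (at (0::complex))"
      by (auto intro!: derivative_eq_intros)
    ultimately have "((\<lambda>s. (s + (of_int (2 * j) - 1)) ^ n * g z (s + of_int j)) has_field_derivative
       of_nat n * (of_int (2 * j) - 1) ^ (n - 1) * g z (0 + of_int j) + deriv (g z) (of_int j) * (0 + (of_int (2 * j) - 1)) ^ n) (at 0)"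
      by (rule DERIV_mult[rotated])
    hence "deriv (\<lambda>s. (s + (of_int (2 * j) - 1)) ^ n * g z (s + of_int j)) 0 = (of_int (2 * j) - 1) ^ n * deriv (g z) (of_int j)"
      using g0[OF z] by (simp add: DERIV_imp_deriv)
    thus ?thesis
      using higher_deriv_power_mult(1)[OF Eis_shift_holomorphic[OF g z, of "of_int (2 * j) - 1" n], of n 1]
      by (simp add: add_diff_eq)
  qed
  show ?thesis unfolding EisCoeff_in_V_iff[OF g]
    by (intro ball_cong refl) (simp only: eq mult_eq_0_iff fact_nonzero power_eq_0_iff of_int_odd_nonzero simp_thms)
qed

section \<open>Nonvanishing outside weight 2\<close>

text \<open>On the imaginary axis at height y the vectors with m = 0 have phase 1 and positive
  terms, among them y^w from (0, 1). The vectors with m nonzero contribute at most C y^(w - 1) in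
  absolute value, so a height above C suffices.\<close>

lemma lsum_pw_nonzero:
  assumes w: "w \<ge> (2::real)"
  shows "\<exists>z\<in>UHP. lsum (- j) j (pw (of_real w)) z \<noteq> 0"
proof -
  define C where "C = (\<Sum>i. lsize i powr (- (w - 1/2)))"
  have sC: "summable (\<lambda>i. lsize i powr (- (w - 1/2)))" using w by (intro summable_lsize) simp
  have C0: "C \<ge> 0" unfolding C_def by (intro suminf_nonneg sC) simp
  \<comment> \<open>Any y >= 1 above C would do; C does not depend on y.\<close>
  define y where "y = C + 1"
  have y: "y \<ge> 1" "y > C" using C0 by (simp_all add: y_def)
  define z where "z = Complex 0 y"
  have z: "z \<in> UHP" using y by (simp add: z_def UHP_def)
  define t where "t = (\<lambda>v. lterm 0 j (pw (of_real w)) z v)"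
  have w1: "Re (complex_of_real w) > 1" using w by simp
  have st: "summable (\<lambda>i. t (lat i))" unfolding t_def by (rule summable_lterm[OF z w1 decays_powr])
  have q: "quad z (m, n) = ((of_int m * y)\<^sup>2 + (of_int n)\<^sup>2) / y" for m n
    by (simp add: quad_altdef z_def)
  have tq: "t v = (cnj (lin z v) / lin z v) powi j * of_real (quad z v powr (-w))" if "v \<noteq> (0, 0)" for v
    using quad_pos[OF z that] by (simp add: t_def lterm_def powr_of_real[symmetric])
  have t0: "t (0, n) = of_real (quad z (0, n) powr (-w))" if "n \<noteq> 0" for n
    using that by (subst tq) (auto simp: lin_def)
  have tm: "- (y powr (w - 1) * ((of_int m)\<^sup>2 + (of_int n)\<^sup>2) powr (- (w - 1/2))) \<le> Re (t (m, n))" if m: "m \<noteq> 0" for m n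
  proof -
    have mn: "(m, n) \<noteq> (0, 0)" using m by simp
    define A where "A = (of_int m * y)\<^sup>2 + (of_int n :: real)\<^sup>2"
    have m1: "(1::real) \<le> (of_int m)\<^sup>2"
    proof -
      have "1 \<le> m\<^sup>2" using m by (simp add: int_one_le_iff_zero_less)
      hence "real_of_int 1 \<le> real_of_int (m\<^sup>2)" by (subst of_int_le_iff)
      thus ?thesis by simp
    qed
    have Ay: "y\<^sup>2 \<le> A" using m1 by (simp add: A_def power_mult_distrib mult_le_cancel_right1 add_increasing2)
    have Al: "(of_int m)\<^sup>2 + (of_int n)\<^sup>2 \<le> A"
      using y by (simp add: A_def power_mult_distrib mult_le_cancel_left1 one_le_power)
    have A0: "A > 0" using Ay y by (smt (verit) zero_less_power)
    have "norm (t (m, n)) = quad z (m, n) powr (-w)"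
      unfolding tq[OF mn] using lin_nonzero[OF z mn] by (simp add: norm_mult norm_power_int norm_divide)
    also have "\<dots> = (A / y) powr (-w)" by (simp add: q A_def)
    also have "\<dots> = y powr w * A powr (-w)" using A0 y by (simp add: powr_divide powr_minus divide_simps)
    \<comment> \<open>A half power of A >= y^2 is given up to gain the factor 1/y; the exponent w -
      1/2 that remains still exceeds 1 because w >= 2.\<close>
    also have "A powr (-w) = A powr (-1/2) * A powr (- (w - 1/2))" by (simp add: powr_add[symmetric])
    also have "\<dots> \<le> y powr (-1) * ((of_int m)\<^sup>2 + (of_int n)\<^sup>2) powr (- (w - 1/2))"
    proof (rule mult_mono)
      have "(of_int m)\<^sup>2 + (of_int n)\<^sup>2 > (0::real)"
        by (rule add_pos_nonneg) (use m1 in linarith, simp)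
      thus "A powr (- (w - 1/2)) \<le> ((of_int m)\<^sup>2 + (of_int n)\<^sup>2) powr (- (w - 1/2))"
        using Al w by (intro powr_mono2') auto
      have "A powr (-1/2) \<le> (y\<^sup>2) powr (-1/2)" using Ay y by (intro powr_mono2') auto
      also have "y\<^sup>2 = y powr 2" using y by simp
      also have "(y powr 2) powr (-1/2) = y powr (-1)" by (simp only: powr_powr) simp
      finally show "A powr (-1/2) \<le> y powr (-1)" .
    qed auto
    finally have "norm (t (m, n)) \<le> y powr w * (y powr (-1) * ((of_int m)\<^sup>2 + (of_int n)\<^sup>2) powr (- (w - 1/2)))"
      using y by (simp add: mult_left_mono)
    also have "\<dots> = y powr (w - 1) * ((of_int m)\<^sup>2 + (of_int n)\<^sup>2) powr (- (w - 1/2))"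
      unfolding mult.assoc[symmetric] powr_add[symmetric] by simp
    finally show ?thesis using abs_Re_le_cmod[of "t (m, n)"] by linarith
  qed
  \<comment> \<open>Adding the majorant makes every term nonnegative, so the whole series is at
    least its term at (0, 1).\<close>
  define p where "p = (\<lambda>i. Re (t (lat i)) + y powr (w - 1) * lsize i powr (- (w - 1/2)))"
  have p: "p i \<ge> 0" for i
  proof -
    obtain m n where v: "lat i = (m, n)" by force
    show ?thesis
    proof (cases "m = 0")
      case True
      hence "n \<noteq> 0" using lat_nonzero[of i] v by auto
      thus ?thesis using True t0[of n] y by (simp add: p_def v)
    next
      case False
      thus ?thesis using tm[of m n] by (simp add: p_def v lsize_def)
    qed
  qed
  obtain i where i: "lat i = (0, 1)"
    using bij_betw_lat by (metis (no_types, lifting) DiffI UNIV_I bij_betw_def empty_iff imageE insert_iff prod.inject zero_neq_one)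
  have sp: "summable p" unfolding p_def by (intro summable_add summable_Re st summable_mult sC)
  have "y powr w \<le> Re (t (lat i))" using t0[of 1] y by (simp add: i q powr_divide powr_minus divide_simps)
  hence "y powr w \<le> p i" unfolding p_def using y by (simp add: add_increasing2)
  also have "p i \<le> suminf p" using sum_le_suminf[OF sp, of "{i}"] p by simp
  also have "suminf p = Re (\<Sum>i. t (lat i)) + y powr (w - 1) * C"
    unfolding p_def C_def using st sC by (simp add: suminf_add[symmetric] suminf_mult summable_Re summable_mult Re_suminf)
  finally have "y powr w - y powr (w - 1) * C \<le> Re (\<Sum>i. t (lat i))" by simp
  moreover have "y powr w = y powr (w - 1) * y" using y by (simp add: powr_diff)
  moreover have "y powr (w - 1) * y - y powr (w - 1) * C > 0"
    using y unfolding right_diff_distrib[symmetric] by (intro mult_pos_pos) auto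
  ultimately have "lsum 0 j (pw (of_real w)) z \<noteq> 0" unfolding lsum_def t_def[symmetric] by auto
  moreover have "of_real (Im z) powi (- j) * lsum 0 j (pw (of_real w)) z = lsum (- j) j (pw (of_real w)) z"
    using lsum_Im_mult[OF z w1 decays_powr, of "- j" 0 j] by simp
  ultimately show ?thesis using z by (intro bexI[of _ z]) (auto simp: UHP_def)
qed

lemma ecoef_nonzero:
  assumes w: "w \<ge> (2::real)"
  shows "ecoef j (of_real w) \<noteq> 0"
proof -
  have "Gamma (complex_of_real w + of_int \<bar>j\<bar>) \<noteq> 0"
  proof -
    have "complex_of_real w + of_int \<bar>j\<bar> = of_real (w + of_int \<bar>j\<bar>)"
      by (simp del: of_int_abs)
    moreover have "Gamma (w + of_int \<bar>j\<bar>) > 0" using w by (intro Gamma_real_pos) linarith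
    ultimately show ?thesis by (simp only: Gamma_complex_of_real) simp
  qed
  moreover have "complex_of_real w \<noteq> 0" "complex_of_real w - 1 \<noteq> 0" using w by (auto simp: complex_eq_iff)
  ultimately show ?thesis by (simp add: ecoef_def powr_def)
qed

lemma Eis_nonzero:
  assumes g: "Eis j g" and w: "w \<ge> (2::real)"
  shows "\<exists>z\<in>UHP. g z (of_real w) \<noteq> 0"
proof -
  obtain z where z: "z \<in> UHP" "lsum (- j) j (pw (of_real w)) z \<noteq> 0" using lsum_pw_nonzero[OF w] by blast
  have "g z (of_real w) = ecoef j (of_real w) * lsum (- j) j (pw (of_real w)) z"
    using g z w by (simp add: Eis_def)
  with z ecoef_nonzero[OF w, of j] have "g z (of_real w) \<noteq> 0" by simp
  with z(1) show ?thesis by blast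
qed

text \<open>For integers other than 0 and 1, one of j and 1 - j is at least 2 and lies in the region
  of convergence; at 0 the constant 1/2 takes over.\<close>

lemma EisCoeff_notin_V:
  assumes j: "j \<noteq> 1"
  shows "EisCoeff n (2 * j) \<notin> V (2 * j) n"
proof -
  obtain g where g: "Eis j g" using Eis_exists by blast
  have "\<exists>z\<in>UHP. g z (of_int j) \<noteq> 0"
  proof -
    consider "j = 0" | "j \<ge> 2" | "j \<le> -1" using j by linarith
    thus ?thesis
    proof cases
      case 1
      have "\<i> \<in> UHP" by (simp add: UHP_def)
      with Eis_0_values(1)[of g \<i>] g 1 show ?thesis by (intro bexI[of _ \<i>]) auto
    next
      case 2
      with Eis_nonzero[OF g, of "of_int j"] show ?thesis by simp
    next
      case 3
      with Eis_nonzero[OF g, of "1 - of_int j"] obtain z where z: "z \<in> UHP" "g z (1 - of_int j) \<noteq> 0" by auto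
      moreover have "g z (1 - of_int j) = g z (of_int j)" using g z(1) by (simp add: Eis_def)
      ultimately show ?thesis by auto
    qed
  qed
  thus ?thesis unfolding EisCoeff_in_V_same_iff[OF g] by blast
qed

section \<open>Weight 2\<close>

text \<open>Weight 2 is raised from weight 0, where the value at w = 1 is constant in z; for j = 0
  the raising operator is a pure derivative and kills constants.\<close>

lemma Eis_1_zero:
  assumes g: "Eis 1 g" and z: "z \<in> UHP"
  shows "g z 1 = 0"
proof -
  have "Eis 1 (raise_op 0 eis0)" using Eis_raise[OF Eis_eis0] by simp
  hence "g z 1 = raise_op 0 eis0 z 1" using Eis_unique[OF g _ z] by blast
  also have "\<dots> = raise_op 0 (\<lambda>z w. 1 / 2) z 1"
    by (rule raise_op_cong[OF z]) (rule Eis_0_values(2)[OF Eis_eis0])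
  also have "\<dots> = 0"
    using wderiv_Dx[OF wderiv_const, of "1/2" z] wderiv_Dy[OF wderiv_const, of "1/2" z] by (simp add: raise_op_def)
  finally show ?thesis .
qed

text \<open>Lowering back to weight 0 costs w (w - 1), which has a simple zero at w = 1: the first
  derivative there still sees the constant 1/2.\<close>

lemma lower_Eis_1:
  assumes g: "Eis 1 g" and z: "z \<in> UHP"
  shows "lower_op g z w = w * (w - 1) * eis0 z w"
proof (rule entire_eqI[of "lower_op g z" "\<lambda>w. w * (w - 1) * eis0 z w" 1])
  have HF: "HF g" "HF eis0" using g Eis_eis0 by (auto simp: Eis_def)
  show "lower_op g z holomorphic_on UNIV" by (rule HF_holomorphic[OF HF_lower_op[OF HF(1)] z])
  show "(\<lambda>w. w * (w - 1) * eis0 z w) holomorphic_on UNIV"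
    by (intro holomorphic_intros HF_holomorphic[OF HF(2) z])
  fix w :: complex assume w: "Re w > 1"
  have "lower_op g z w = lower_op (\<lambda>z _. ecoef 1 w * lsum (- 1) 1 (pw w) z) z w"
    by (rule lower_op_cong[OF z]) (use g w in \<open>auto simp: Eis_def\<close>)
  also have "\<dots> = ecoef 1 w * ((w - 1) * lsum 0 0 (pw w) z)"
    using ladder_lsum(2)[OF z w, of "ecoef 1 w" 1] by simp
  also have "ecoef 1 w = w * ecoef 0 w"
    using Gamma_step[OF w, of 0] by (simp add: ecoef_def)
  also have "w * ecoef 0 w * ((w - 1) * lsum 0 0 (pw w) z) = w * (w - 1) * eis0 z w"
    using Eis_eis0 z w by (simp add: Eis_def mult_ac)
  finally show "lower_op g z w = w * (w - 1) * eis0 z w" .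
qed

text \<open>If the w-derivative vanished on all of \<open>UHP\<close>, so would that of the lowered
  series; but w (w - 1) times \<open>eis0\<close> has derivative \<open>eis0 z 1\<close> at w = 1,
  which is 1/2.\<close>

lemma deriv_Eis_1_nonzero:
  assumes g: "Eis 1 g"
  shows "\<exists>z\<in>UHP. deriv (g z) 1 \<noteq> 0"
proof (rule ccontr)
  assume "\<not> ?thesis"
  hence 0: "deriv (g z) 1 = 0" if "z \<in> UHP" for z using that by blast
  have HF: "HF g" "HF eis0" using g Eis_eis0 by (auto simp: Eis_def)
  have z: "\<i> \<in> UHP" by (simp add: UHP_def)
  have "Dx (\<lambda>z. deriv (g z) 1) \<i> = Dx (\<lambda>z. 0) \<i>" "Dy (\<lambda>z. deriv (g z) 1) \<i> = Dy (\<lambda>z. 0) \<i>"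
    using Dx_cong[OF z 0] Dy_cong[OF z 0] by simp_all
  hence D0: "Dx (\<lambda>z. deriv (g z) 1) \<i> = 0" "Dy (\<lambda>z. deriv (g z) 1) \<i> = 0"
    using wderiv_Dx[OF wderiv_const, of 0 \<i>] wderiv_Dy[OF wderiv_const, of 0 \<i>] by simp_all
  \<comment> \<open>Vanishing throughout \<open>UHP\<close> passes to the z-derivatives, and these
    commute with d/dw.\<close>
  have d: "((\<lambda>w. Dx (\<lambda>z. g z w) \<i>) has_field_derivative 0) (at 1)" "((\<lambda>w. Dy (\<lambda>z. g z w) \<i>) has_field_derivative 0) (at 1)"
    using holomorphic_derivI[OF HF_holomorphic[OF HF_Dx[OF HF(1)] z] open_UNIV, of 1]
      holomorphic_derivI[OF HF_holomorphic[OF HF_Dy[OF HF(1)] z] open_UNIV, of 1]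
    by (simp_all add: HF_Dx_deriv[OF HF(1) z, symmetric] D0)
  have "((\<lambda>w. lower_op g \<i> w) has_field_derivative - \<i> * (of_real (Im \<i>) powi 2 * (0 + \<i> * 0))) (at 1)"
    unfolding lower_op_def by (intro DERIV_cmult DERIV_add d)
  hence L: "(lower_op g \<i> has_field_derivative 0) (at 1)" by simp
  have e: "(eis0 \<i> has_field_derivative deriv (eis0 \<i>) 1) (at 1)"
    by (rule holomorphic_derivI[OF HF_holomorphic[OF HF(2) z] open_UNIV]) simp
  have "((\<lambda>w. w * (w - 1) * eis0 \<i> w) has_field_derivative eis0 \<i> 1) (at 1)"
    by (auto intro!: derivative_eq_intros e)
  moreover have "lower_op g \<i> = (\<lambda>w. w * (w - 1) * eis0 \<i> w)"
    by (rule ext) (rule lower_Eis_1[OF g z])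
  ultimately have "eis0 \<i> 1 = 0" using L by (metis DERIV_unique)
  thus False using Eis_0_values(2)[OF Eis_eis0 z] by simp
qed

text \<open>Everything moves down by one: the vanishing value gives order n, and relative to the
  exponent n - 1 the n-th coefficient is the one just above the leading one.\<close>

lemma EisCoeff_weight_2:
  assumes n: "n \<ge> 1"
  shows "EisCoeff n 2 \<in> V 2 n - V 2 (n - 1)"
proof -
  obtain g where g: "Eis 1 g" using Eis_exists by blast
  have g0: "g z (of_int 1) = 0" if "z \<in> UHP" for z using Eis_1_zero[OF g that] by simp
  have "EisCoeff n (2 * 1) \<in> V (2 * 1) n" unfolding EisCoeff_in_V_same_iff[OF g] using g0 by blast
  moreover have "EisCoeff n (2 * 1) \<notin> V (2 * 1) (n - 1)"
    using EisCoeff_Suc_in_V_iff[OF g g0, of "n - 1"] deriv_Eis_1_nonzero[OF g] n by auto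
  ultimately show ?thesis by simp
qed

theorem theorem8p4:
  shows "(\<forall>k::int. \<forall>n::nat. even k \<and> k \<le> 0 \<longrightarrow> F n k \<in> V k (n + 1))
       \<and> (\<forall>k::int. \<forall>n::nat. even k \<and> k \<ge> 2 \<longrightarrow> G n k \<in> V k (n + 1))
       \<and> (\<forall>k::int. \<forall>n::nat. even k \<and> k \<le> 0 \<longrightarrow> F n k \<in> V k (n + 1) - V k n)
       \<and> (\<forall>k::int. \<forall>n::nat. even k \<and> k \<ge> 4 \<longrightarrow> G n k \<in> V k (n + 1) - V k n)
       \<and> (\<forall>n::nat. n \<ge> 1 \<longrightarrow> G n 2 \<in> V 2 n - V 2 (n - 1))"
proof -
  have mem: "EisCoeff n k \<in> V k (n + 1)" if k: "even k" for k n
  proof -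
    obtain j where "k = 2 * j" using k by (rule evenE)
    thus ?thesis using EisCoeff_in_V_Suc by simp
  qed
  have notin: "EisCoeff n k \<notin> V k n" if k: "even k" "k \<noteq> 2" for k n
  proof -
    obtain j where j: "k = 2 * j" using k(1) by (rule evenE)
    with k(2) have "j \<noteq> 1" by simp
    thus ?thesis unfolding j by (rule EisCoeff_notin_V)
  qed
  show ?thesis
    unfolding F_def G_def using mem notin EisCoeff_weight_2 by auto
qed

end
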